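(* Let $\gamma\in(0,1)$, $d\in\mathbb N$, $T>0$, and let $\mathbf n$ denote the integer part of $1/\gamma$. The maps $$I_1^\gamma:\bar{\mathscr R}^\gamma([0,T],\mathbb R^d)\to\mathscr R^\gamma([0,T],\mathbb R^d),\quad \bar{\mathbf X}\mapsto\mathbf X,\ \ \mathbf X_t:=\pi^{\mathbf n}\bar{\mathbf X}_t,$$ $$I_2^\gamma:\mathscr R^\gamma([0,T],\mathbb R^d)\to\check{\mathscr R}^\gamma([0,T],\mathbb R^d),\quad \mathbf X\mapsto\check{\mathbf X},\ \ \check{\mathbf X}_{st}(y):=\langle y,\mathbf X_{st}\rangle,$$ $$I_3^\gamma:\bar{\mathscr R}^\gamma([0,T],\mathbb R^d)\to\hat{\mathscr R}^\gamma([0,T],\mathbb R^d),\quad \bar{\mathbf X}\mapsto\hat{\mathbf X},\ \ \hat{\mathbf X}_{st}(y):=\langle y,\bar{\mathbf X}_{st}\rangle$$ are well-defined and bijective.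
   Context: Trees and forests: $\mathscr T_d$ is the set of (non-planar) rooted trees with nodes decorated by $\{1,\dots,d\}$, $\mathscr F_d$ is the free commutative monoid on $\mathscr T_d$ (forests), with product $\odot$ (written $\zeta_1\zeta_2$) and unit $\mathbf 1$; $|\zeta|$ is the number of nodes; $\lfloor\zeta\rfloor_i$ is the tree obtained by grafting the trees of $\zeta$ onto a new root labelled $i$. $\mathscr F_d^n$, $\mathscr T_d^n$ are the forests resp. trees with at most $n$ nodes. $\langle M\rangle$ is the real vector space with basis $M$ and $V^*$ the algebraic dual. $\langle\mathscr F_d\rangle$ is graded by the number of nodes; $\langle\mathscr F_d\rangle_\Pi$ denotes its space of formal series (product of homogeneous components); $\pi^n$ is the projection onto the components of degree at most $n$ (on tensors: total degree at most $n$). $\langle\cdot,\cdot\rangle$ is the bilinear pairing with $\langle\zeta,\eta\rangle=\delta_{\zeta,\eta}$ for forests (extended to pair finite sums with series). Coproducts and products: $\Delta_\star:\langle\mathscr F_d\rangle\to\langle\mathscr F_d\rangle\otimes\langle\mathscr F_d\rangle$ is the algebra homomorphism for $\odot$ with $\Delta_\star\mathbf 1=\mathbf 1\otimes\mathbf 1$, $\Delta_\star\lfloor\zeta\rfloor_i=\lfloor\zeta\rfloor_i\otimes\mathbf 1+(\mathrm{id}\otimes\lfloor\cdot\rfloor_i)\Delta_\star\zeta$. $\star$ is the dual (Grossman–Larson) product, $\zeta_1\star\zeta_2=\sum_{\eta\in\mathscr F_d}\langle\zeta_1\otimes\zeta_2,\Delta_\star\eta\rangle\,\eta$, extended to series;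 $x\star_n y:=\pi^n(x\star y)$. $\Delta_\odot$ is the dual of $\odot$: $\Delta_\odot\zeta=\sum_{\zeta_1\zeta_2=\zeta}\zeta_1\otimes\zeta_2$ (sum over ordered pairs), extended degreewise to series. $\varepsilon(\zeta)=\delta_{\zeta,\mathbf 1}$ is the counit and $\varepsilon_{\mathbf n}$ its restriction to $\langle\mathscr F_d^{\mathbf n}\rangle$. Groups: $\mathscr G_d:=\{g\in\langle\mathscr F_d\rangle_\Pi\setminus\{0\}:\Delta_\odot g=g\otimes g\}$ (group under $\star$), $\mathscr G^n_d:=\{g\in\langle\mathscr F_d^n\rangle\setminus\{0\}:\Delta_\odot g=\pi^n(g\otimes g)\}$ (group under $\star_n$). One has $\mathscr G^n_d=\exp_{\star_n}(\langle\mathscr T_d^n\rangle)$ with $\exp_{\star_n}(u)=\sum_{k\ge 0}u^{\star_n k}/k!$ injective, and one sets $\big\|\exp_{\star_n}\big(\sum_{\tau\in\mathscr T_d^n}b_\tau\tau\big)\big\|_{\mathscr G^n_d}:=\sum_{\tau\in\mathscr T^n_d}|b_\tau|^{1/|\tau|}$. Four definitions of $d$-dimensional $\gamma$-Hölder branched rough paths: (1) $\mathscr R^\gamma([0,T],\mathbb R^d)$: maps $\mathbf X:[0,T]\to\mathscr G^{\mathbf n}_d$ with $\mathbf X_0=\mathbf 1$ and $\sup_{s<t}\|\mathbf X_{st}\|_{\mathscr G^{\mathbf n}_d}/|t-s|^\gamma<\infty$, where $\mathbf X_{st}:=\mathbf X_s^{-1}\star_{\mathbf n}\mathbf X_t$.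 (2) $\bar{\mathscr R}^\gamma([0,T],\mathbb R^d)$: maps $\bar{\mathbf X}:[0,T]\to\mathscr G_d$ with $\bar{\mathbf X}_0=\mathbf 1$ and $\sup_{s<t}\|\pi^n\bar{\mathbf X}_{st}\|_{\mathscr G^n_d}/|t-s|^\gamma<\infty$ for all $n\in\mathbb N$, where $\bar{\mathbf X}_{st}:=\bar{\mathbf X}_s^{-1}\star\bar{\mathbf X}_t$. (3) $\check{\mathscr R}^\gamma([0,T],\mathbb R^d)$: maps $\check{\mathbf X}:[0,T]^2\to\langle\mathscr F_d^{\mathbf n}\rangle^*$ such that: $\check{\mathbf X}_{st}(\mathbf 1)=1$ and $\check{\mathbf X}_{st}(\zeta_1\zeta_2)=\check{\mathbf X}_{st}(\zeta_1)\check{\mathbf X}_{st}(\zeta_2)$ for all forests with $|\zeta_1|+|\zeta_2|\le\mathbf n$; $\check{\mathbf X}_{tt}=\varepsilon_{\mathbf n}$ and $\check{\mathbf X}_{st}(\zeta)=(\check{\mathbf X}_{su}\otimes\check{\mathbf X}_{ut})\Delta_\star\zeta$ for all $\zeta\in\mathscr F_d^{\mathbf n}$, $s,u,t\in[0,T]$; $\sup_{s\ne t}|\check{\mathbf X}_{st}(\zeta)|/|t-s|^{\gamma|\zeta|}<\infty$ for all $\zeta\in\mathscr F_d^{\mathbf n}$. (4) $\hat{\mathscr R}^\gamma([0,T],\mathbb R^d)$: maps $\hat{\mathbf X}:[0,T]^2\to\langle\mathscr F_d\rangle^*$ such that: $\hat{\mathbf X}_{st}(\mathbf 1)=1$ and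 $\hat{\mathbf X}_{st}(\zeta_1\zeta_2)=\hat{\mathbf X}_{st}(\zeta_1)\hat{\mathbf X}_{st}(\zeta_2)$ for all forests; $\hat{\mathbf X}_{tt}=\varepsilon$ and $\hat{\mathbf X}_{st}(\zeta)=(\hat{\mathbf X}_{su}\otimes\hat{\mathbf X}_{ut})\Delta_\star\zeta$ for all forests $\zeta$ and $s,u,t\in[0,T]$; $\sup_{s\ne t}|\hat{\mathbf X}_{st}(\zeta)|/|t-s|^{\gamma|\zeta|}<\infty$ for all forests $\zeta$. *)

theory Defs
  imports
    Complex_Main
    "HOL-Library.Multiset"
    "HOL-Library.FuncSet"
    "HOL-Library.Product_Plus"
    "HOL-Library.Poly_Mapping"
    "HOL-Algebra.Group"
begin

section \<open>Trees and forests\<close>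

text \<open>
  Non-planar rooted trees: the children of a node form a multiset. The decorations
  \<open>{1,\<dots>,d}\<close> are modelled by a type \<open>'d\<close>, finite where it matters, with \<open>d = CARD('d)\<close>.
  The free commutative monoid of forests is the monoid of finite multisets of trees:
  \<open>\<odot>\<close> is multiset sum and the unit forest \<open>\<one>\<close> is \<open>{#}\<close>.
\<close>

datatype 'd rtree = Node 'd "'d rtree multiset"

type_synonym 'd forest = "'d rtree multiset"

primrec tree_size :: "'d rtree \<Rightarrow> nat" where
  "tree_size (Node i \<zeta>) = Suc (sum_mset (image_mset tree_size \<zeta>))"

definition forest_size :: "'d forest \<Rightarrow> nat" where
  "forest_size \<zeta> = sum_mset (image_mset tree_size \<zeta>)"

definition forests_upto :: "nat \<Rightarrow> 'd forest set" where
  "forests_upto n = {\<zeta>. forest_size \<zeta> \<le> n}"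

definition trees_upto :: "nat \<Rightarrow> 'd rtree set" where
  "trees_upto n = {\<tau>. tree_size \<tau> \<le> n}"


section \<open>Vector spaces spanned by forests\<close>

text \<open>
  A formal series is its family of coefficients; since there are only finitely many forests
  of each degree (for finite \<open>'d\<close>), arbitrary families are exactly the product of the
  homogeneous components. The space with basis \<open>M\<close> is the space of finitely supported families
  with support in \<open>M\<close>, so it sits inside the formal series. Tensors are
  families indexed by pairs of forests.
\<close>

type_synonym 'd series = "'d forest \<Rightarrow> real"
type_synonym 'd tensor = "'d forest \<times> 'd forest \<Rightarrow> real"

definition free_space :: "'b set \<Rightarrow> ('b \<Rightarrow> real) set" where
  "free_space M = {x. finite {b. x b \<noteq> 0} \<and> {b. x b \<noteq> 0} \<subseteq> M}"

definition basis_vec :: "'b \<Rightarrow> 'b \<Rightarrow> real" where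
  "basis_vec b = (\<lambda>c. if c = b then 1 else 0)"

text \<open>
  Algebraic dual of a subspace \<open>V\<close>: functionals have domain \<open>V\<close>, encoded as usual by
  extensionality (value \<open>undefined\<close> outside \<open>V\<close>).
\<close>

definition alg_dual :: "('b \<Rightarrow> real) set \<Rightarrow> (('b \<Rightarrow> real) \<Rightarrow> real) set" where
  "alg_dual V = {f \<in> extensional V.
     \<forall>x\<in>V. \<forall>y\<in>V. \<forall>a b. f (\<lambda>c. a * x c + b * y c) = a * f x + b * f y}"

text \<open>Only the first argument needs to be a finite sum.\<close>

definition pairing :: "('b \<Rightarrow> real) \<Rightarrow> ('b \<Rightarrow> real) \<Rightarrow> real" where
  "pairing y g = (\<Sum>b | y b \<noteq> 0. y b * g b)"

definition proj :: "nat \<Rightarrow> 'd series \<Rightarrow> 'd series" where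
  "proj n x = (\<lambda>\<zeta>. if forest_size \<zeta> \<le> n then x \<zeta> else 0)"

definition proj_tensor :: "nat \<Rightarrow> 'd tensor \<Rightarrow> 'd tensor" where
  "proj_tensor n w = (\<lambda>(\<zeta>\<^sub>1, \<zeta>\<^sub>2). if forest_size \<zeta>\<^sub>1 + forest_size \<zeta>\<^sub>2 \<le> n then w (\<zeta>\<^sub>1, \<zeta>\<^sub>2) else 0)"

definition tensor :: "'d series \<Rightarrow> 'd series \<Rightarrow> 'd tensor" where
  "tensor x y = (\<lambda>(\<zeta>\<^sub>1, \<zeta>\<^sub>2). x \<zeta>\<^sub>1 * y \<zeta>\<^sub>2)"

definition counit :: "'d series \<Rightarrow> real" where
  "counit x = x {#}"


section \<open>Coproducts and the Grossman-Larson product\<close>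

text \<open>
  Finitely supported maps on pairs of forests, with their convolution product, form the algebra
  \<open>\<langle>\<F>\<rangle> \<otimes> \<langle>\<F>\<rangle>\<close> with componentwise \<open>\<odot>\<close>. \<open>graft_right i\<close> is \<open>id \<otimes> \<lfloor>\<cdot>\<rfloor>\<^sub>i\<close>.
\<close>

definition graft_right ::
  "'d \<Rightarrow> ('d forest \<times> 'd forest \<Rightarrow>\<^sub>0 real) \<Rightarrow> ('d forest \<times> 'd forest \<Rightarrow>\<^sub>0 real)" where
  "graft_right i w =
     (\<Sum>p\<in>Poly_Mapping.keys w.
        Poly_Mapping.single (fst p, {#Node i (snd p)#}) (Poly_Mapping.lookup w p))"

primrec coprod_star_tree :: "'d rtree \<Rightarrow> ('d forest \<times> 'd forest \<Rightarrow>\<^sub>0 real)" where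
  "coprod_star_tree (Node i \<zeta>) =
     Poly_Mapping.single ({#Node i \<zeta>#}, {#}) 1
     + graft_right i (prod_mset (image_mset coprod_star_tree \<zeta>))"

definition coprod_star :: "'d forest \<Rightarrow> ('d forest \<times> 'd forest \<Rightarrow>\<^sub>0 real)" where
  "coprod_star \<zeta> = prod_mset (image_mset coprod_star_tree \<zeta>)"

text \<open>The three defining properties of \<open>\<Delta>\<^sub>\<star>\<close>:\<close>

lemma coprod_star_one: "coprod_star {#} = Poly_Mapping.single ({#}, {#}) 1"
  by (simp add: coprod_star_def zero_prod_def flip: single_one)

lemma coprod_star_mult: "coprod_star (\<zeta>\<^sub>1 + \<zeta>\<^sub>2) = coprod_star \<zeta>\<^sub>1 * coprod_star \<zeta>\<^sub>2"
  by (simp add: coprod_star_def)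

lemma coprod_star_graft:
  "coprod_star {#Node i \<zeta>#} =
     Poly_Mapping.single ({#Node i \<zeta>#}, {#}) 1 + graft_right i (coprod_star \<zeta>)"
  by (simp add: coprod_star_def)

definition star :: "'d series \<Rightarrow> 'd series \<Rightarrow> 'd series" where
  "star x y = (\<lambda>\<eta>. pairing (Poly_Mapping.lookup (coprod_star \<eta>)) (tensor x y))"

definition star_trunc :: "nat \<Rightarrow> 'd series \<Rightarrow> 'd series \<Rightarrow> 'd series" where
  "star_trunc n x y = proj n (star x y)"

text \<open>
  Dual of \<open>\<odot>\<close>: the coefficient of \<open>\<zeta>\<^sub>1 \<otimes> \<zeta>\<^sub>2\<close> in \<open>\<Delta>\<^sub>\<odot> x\<close> is the coefficient of \<open>\<zeta>\<^sub>1\<zeta>\<^sub>2\<close> in \<open>x\<close>.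
\<close>

definition coprod_odot :: "'d series \<Rightarrow> 'd tensor" where
  "coprod_odot x = (\<lambda>(\<zeta>\<^sub>1, \<zeta>\<^sub>2). x (\<zeta>\<^sub>1 + \<zeta>\<^sub>2))"

lemma coprod_odot_forest:
  "coprod_odot (basis_vec \<zeta>) p = (if fst p + snd p = \<zeta> then 1 else 0)"
  by (simp add: coprod_odot_def basis_vec_def split: prod.split)


section \<open>The groups and the homogeneous norm\<close>

definition GL_group :: "'d series monoid" where
  "GL_group =
     \<lparr>carrier = {g. g \<noteq> (\<lambda>_. 0) \<and> coprod_odot g = tensor g g},
      mult = star, one = basis_vec {#}\<rparr>"

definition GL_group_trunc :: "nat \<Rightarrow> 'd series monoid" where
  "GL_group_trunc n =
     \<lparr>carrier = {g \<in> free_space (forests_upto n).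
        g \<noteq> (\<lambda>_. 0) \<and> coprod_odot g = proj_tensor n (tensor g g)},
      mult = star_trunc n, one = basis_vec {#}\<rparr>"

text \<open>The exponential series is taken coefficientwise; it is used on \<open>\<langle>\<T>\<^sup>n\<rangle>\<close>, where it is finite.\<close>

definition exp_trunc :: "nat \<Rightarrow> 'd series \<Rightarrow> 'd series" where
  "exp_trunc n u = (\<lambda>\<zeta>. suminf (\<lambda>k. (star_trunc n u ^^ k) (basis_vec {#}) \<zeta> / fact k))"

definition tree_space :: "nat \<Rightarrow> 'd series set" where
  "tree_space n = free_space ((\<lambda>\<tau>. {#\<tau>#}) ` trees_upto n)"

definition log_trunc :: "nat \<Rightarrow> 'd series \<Rightarrow> 'd series" where
  "log_trunc n g = (THE u. u \<in> tree_space n \<and> exp_trunc n u = g)"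

definition hom_norm :: "nat \<Rightarrow> 'd series \<Rightarrow> real" where
  "hom_norm n g =
     (\<Sum>\<tau>\<in>trees_upto n. \<bar>log_trunc n g {#\<tau>#}\<bar> powr (1 / real (tree_size \<tau>)))"


section \<open>Branched rough paths\<close>

text \<open>
  Maps on \<open>[0,T]\<close> and \<open>[0,T]\<^sup>2\<close> are extensional functions (\<open>undefined\<close> outside the domain), so that
  equality of elements is equality of maps on the domain.
\<close>

definition rp_order :: "real \<Rightarrow> nat" where
  "rp_order \<gamma> = nat \<lfloor>1 / \<gamma>\<rfloor>"

definition increment :: "'d series monoid \<Rightarrow> (real \<Rightarrow> 'd series) \<Rightarrow> real \<Rightarrow> real \<Rightarrow> 'd series" where
  "increment G X s t = inv\<^bsub>G\<^esub> (X s) \<otimes>\<^bsub>G\<^esub> X t"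

definition rough_paths :: "real \<Rightarrow> real \<Rightarrow> (real \<Rightarrow> 'd series) set" where
  "rough_paths \<gamma> T =
     {X \<in> {0..T} \<rightarrow>\<^sub>E carrier (GL_group_trunc (rp_order \<gamma>)).
        X 0 = basis_vec {#} \<and>
        bdd_above {hom_norm (rp_order \<gamma>) (increment (GL_group_trunc (rp_order \<gamma>)) X s t)
                     / \<bar>t - s\<bar> powr \<gamma> | s t. 0 \<le> s \<and> s < t \<and> t \<le> T}}"

definition full_rough_paths :: "real \<Rightarrow> real \<Rightarrow> (real \<Rightarrow> 'd series) set" where
  "full_rough_paths \<gamma> T =
     {X \<in> {0..T} \<rightarrow>\<^sub>E carrier GL_group.
        X 0 = basis_vec {#} \<and>
        (\<forall>n. bdd_above {hom_norm n (proj n (increment GL_group X s t))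
                          / \<bar>t - s\<bar> powr \<gamma> | s t. 0 \<le> s \<and> s < t \<and> t \<le> T})}"

text \<open>
  The functional \<open>f \<otimes> g\<close> on a tensor \<open>w\<close>, by its values \<open>f \<zeta>\<^sub>1 * g \<zeta>\<^sub>2\<close> on the basis \<open>\<zeta>\<^sub>1 \<otimes> \<zeta>\<^sub>2\<close>.
\<close>

definition tensor_functional ::
  "('d series \<Rightarrow> real) \<Rightarrow> ('d series \<Rightarrow> real) \<Rightarrow> ('d forest \<times> 'd forest \<Rightarrow>\<^sub>0 real) \<Rightarrow> real" where
  "tensor_functional f g w =
     pairing (Poly_Mapping.lookup w) (\<lambda>(\<zeta>\<^sub>1, \<zeta>\<^sub>2). f (basis_vec \<zeta>\<^sub>1) * g (basis_vec \<zeta>\<^sub>2))"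

definition functional_rough_paths ::
  "real \<Rightarrow> real \<Rightarrow> (real \<times> real \<Rightarrow> 'd series \<Rightarrow> real) set" where
  "functional_rough_paths \<gamma> T =
     {X \<in> {0..T} \<times> {0..T} \<rightarrow>\<^sub>E alg_dual (free_space (forests_upto (rp_order \<gamma>))).
        (\<forall>s\<in>{0..T}. \<forall>t\<in>{0..T}.
           X (s, t) (basis_vec {#}) = 1 \<and>
           (\<forall>\<zeta>\<^sub>1 \<zeta>\<^sub>2. forest_size \<zeta>\<^sub>1 + forest_size \<zeta>\<^sub>2 \<le> rp_order \<gamma> \<longrightarrow>
              X (s, t) (basis_vec (\<zeta>\<^sub>1 + \<zeta>\<^sub>2)) =
              X (s, t) (basis_vec \<zeta>\<^sub>1) * X (s, t) (basis_vec \<zeta>\<^sub>2))) \<and>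
        (\<forall>t\<in>{0..T}. X (t, t) = restrict counit (free_space (forests_upto (rp_order \<gamma>)))) \<and>
        (\<forall>s\<in>{0..T}. \<forall>u\<in>{0..T}. \<forall>t\<in>{0..T}. \<forall>\<zeta>\<in>forests_upto (rp_order \<gamma>).
           X (s, t) (basis_vec \<zeta>) =
           tensor_functional (X (s, u)) (X (u, t)) (coprod_star \<zeta>)) \<and>
        (\<forall>\<zeta>\<in>forests_upto (rp_order \<gamma>).
           bdd_above {\<bar>X (s, t) (basis_vec \<zeta>)\<bar> / \<bar>t - s\<bar> powr (\<gamma> * real (forest_size \<zeta>))
                      | s t. s \<in> {0..T} \<and> t \<in> {0..T} \<and> s \<noteq> t})}"

definition full_functional_rough_paths ::
  "real \<Rightarrow> real \<Rightarrow> (real \<times> real \<Rightarrow> 'd series \<Rightarrow> real) set" where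
  "full_functional_rough_paths \<gamma> T =
     {X \<in> {0..T} \<times> {0..T} \<rightarrow>\<^sub>E alg_dual (free_space UNIV).
        (\<forall>s\<in>{0..T}. \<forall>t\<in>{0..T}.
           X (s, t) (basis_vec {#}) = 1 \<and>
           (\<forall>\<zeta>\<^sub>1 \<zeta>\<^sub>2.
              X (s, t) (basis_vec (\<zeta>\<^sub>1 + \<zeta>\<^sub>2)) =
              X (s, t) (basis_vec \<zeta>\<^sub>1) * X (s, t) (basis_vec \<zeta>\<^sub>2))) \<and>
        (\<forall>t\<in>{0..T}. X (t, t) = restrict counit (free_space UNIV)) \<and>
        (\<forall>s\<in>{0..T}. \<forall>u\<in>{0..T}. \<forall>t\<in>{0..T}. \<forall>\<zeta>.
           X (s, t) (basis_vec \<zeta>) =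
           tensor_functional (X (s, u)) (X (u, t)) (coprod_star \<zeta>)) \<and>
        (\<forall>\<zeta>.
           bdd_above {\<bar>X (s, t) (basis_vec \<zeta>)\<bar> / \<bar>t - s\<bar> powr (\<gamma> * real (forest_size \<zeta>))
                      | s t. s \<in> {0..T} \<and> t \<in> {0..T} \<and> s \<noteq> t})}"


section \<open>The maps\<close>

definition I1 :: "real \<Rightarrow> real \<Rightarrow> (real \<Rightarrow> 'd series) \<Rightarrow> (real \<Rightarrow> 'd series)" where
  "I1 \<gamma> T X = (\<lambda>t\<in>{0..T}. proj (rp_order \<gamma>) (X t))"

definition I2 :: "real \<Rightarrow> real \<Rightarrow> (real \<Rightarrow> 'd series) \<Rightarrow> (real \<times> real \<Rightarrow> 'd series \<Rightarrow> real)" where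
  "I2 \<gamma> T X = (\<lambda>(s, t)\<in>{0..T} \<times> {0..T}. \<lambda>y\<in>free_space (forests_upto (rp_order \<gamma>)).
     pairing y (increment (GL_group_trunc (rp_order \<gamma>)) X s t))"

text \<open>
  The exponent \<open>\<gamma>\<close> enters the third map only through its domain and codomain.
\<close>

definition I3 :: "real \<Rightarrow> (real \<Rightarrow> 'd series) \<Rightarrow> (real \<times> real \<Rightarrow> 'd series \<Rightarrow> real)" where
  "I3 T X = (\<lambda>(s, t)\<in>{0..T} \<times> {0..T}. \<lambda>y\<in>free_space UNIV.
     pairing y (increment GL_group X s t))"

end

theory Submission
  imports Defs "HOL-Library.Extended_Nat"
begin

text \<open>
  The Grossman-Larson groups consist of characters of the free commutative monoid of forests, so
  an element is determined by its values on trees, and the truncated group is the image of the full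
  one under the projection (\<open>cutoff\<close>), which is a homomorphism because \<open>\<Delta>\<^sub>\<star>\<close> respects the grading.
  Writing the truncation level as an \<open>enat\<close> therefore treats the truncated and the full objects at
  once: \<open>GL N\<close> is the group, \<open>path_space N\<close> the set of paths with Hoelder increments and
  \<open>functional_space N\<close> the corresponding set of functionals.

  All estimates are of one kind: a family of series \<open>x i\<close> is \<^emph>\<open>graded bounded\<close> with respect to
  scales \<open>h i\<close> if \<open>\<bar>x i \<zeta>\<bar> \<le> C h i ^ \<bar>\<zeta>\<bar>\<close> with \<open>C\<close> depending on \<open>\<zeta>\<close> only. Since every term
  \<open>a \<otimes> b\<close> of \<open>\<Delta>\<^sub>\<star> \<zeta>\<close> satisfies \<open>\<bar>a\<bar> + \<bar>b\<bar> = \<bar>\<zeta>\<bar>\<close>, this property passes through products, inverses,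
  the exponential and the logarithm. Hence a bound on the homogeneous norm, which is phrased in terms
  of the logarithm, is equivalent to graded boundedness of the group elements themselves
  (\<open>hom_norm_bounded_iff\<close>).

  \<^emph>\<open>Paths and functionals.\<close> A functional is given by its coefficients on the basis of forests. The
  axioms of a functional rough path say exactly that the coefficients of \<open>X\<^sub>s\<^sub>t\<close> form elements of
  the group satisfying Chen's relation \<open>X\<^sub>s\<^sub>u \<star> X\<^sub>u\<^sub>t = X\<^sub>s\<^sub>t\<close>, so they are the increments of the path
  \<open>t \<mapsto> X\<^sub>0\<^sub>t\<close>. This gives the bijectivity of the second and third map
  (\<open>functional_of_path_bij\<close>).

  \<^emph>\<open>Truncation.\<close> For the first map suppose that increments are known up to degree \<open>m\<close>, where
  \<open>\<theta> = \<gamma> (m + 1) > 1\<close>. On a forest of degree \<open>m + 1\<close>, two extensions differ by an additive function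
  of \<open>(s, t)\<close> of size \<open>\<bar>t - s\<bar> powr \<theta>\<close>, which must vanish; this is injectivity. For surjectivity,
  any extension of the path to a path of full characters has increments that satisfy Chen's relation.
  On a tree \<open>\<tau>\<close> of degree \<open>m + 1\<close> these increments fail to be additive only by terms of order
  \<open>\<bar>t - s\<bar> powr \<theta>\<close>, because those terms involve lower degrees only. The sewing lemma supplies a
  function \<open>f\<close> of one variable such that subtracting its increments makes the value at \<open>\<tau>\<close> itself of that order, and
  subtracting \<open>f\<close> from the path at \<open>\<tau>\<close> changes nothing else up to degree \<open>m + 1\<close>. Iterating over
  \<open>m\<close> yields the full rough path (\<open>cutoff_path_bij\<close>).
\<close>

section \<open>The calculus of admissible cuts\<close>

text \<open>
  The linear extension of \<open>F\<close> from the basis to finite formal sums.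
\<close>

definition pm_eval :: "('b \<Rightarrow>\<^sub>0 real) \<Rightarrow> ('b \<Rightarrow> real) \<Rightarrow> real" where
  "pm_eval w F = (\<Sum>p\<in>Poly_Mapping.keys w. Poly_Mapping.lookup w p * F p)"

lemma pairing_lookup: "pairing (Poly_Mapping.lookup w) F = pm_eval w F"
  by (auto simp: pairing_def pm_eval_def in_keys_iff intro!: sum.cong)

lemma pm_eval_superset:
  assumes "finite S" "Poly_Mapping.keys w \<subseteq> S"
  shows "pm_eval w F = (\<Sum>p\<in>S. Poly_Mapping.lookup w p * F p)"
  unfolding pm_eval_def
  by (rule sum.mono_neutral_left) (use assms in \<open>auto simp: in_keys_iff\<close>)

lemma pm_eval_single: "pm_eval (Poly_Mapping.single p c) F = c * F p"
  by (simp add: pm_eval_def case_prod_unfold)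

lemma pm_eval_zero: "pm_eval 0 F = 0"
  by (simp add: pm_eval_def case_prod_unfold)

lemma pm_eval_plus: "pm_eval (w + v) F = pm_eval w F + pm_eval v F"
proof -
  let ?S = "Poly_Mapping.keys w \<union> Poly_Mapping.keys v"
  have "Poly_Mapping.keys (w + v) \<subseteq> ?S" by (rule keys_add)
  then have "pm_eval (w + v) F = (\<Sum>p\<in>?S. Poly_Mapping.lookup (w + v) p * F p)"
    by (intro pm_eval_superset) auto
  also have "\<dots> = (\<Sum>p\<in>?S. Poly_Mapping.lookup w p * F p) + (\<Sum>p\<in>?S. Poly_Mapping.lookup v p * F p)"
    by (simp add: lookup_add distrib_right sum.distrib)
  also have "\<dots> = pm_eval w F + pm_eval v F"
    by (subst (1 2) pm_eval_superset[of ?S, symmetric]) auto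
  finally show ?thesis .
qed

lemma pm_eval_sum: "pm_eval (\<Sum>i\<in>I. w i) F = (\<Sum>i\<in>I. pm_eval (w i) F)"
  by (induction I rule: infinite_finite_induct) (auto simp: pm_eval_zero pm_eval_plus)

lemma poly_mapping_sum_single:
  "w = (\<Sum>p\<in>Poly_Mapping.keys w. Poly_Mapping.single p (Poly_Mapping.lookup w p))"
proof (rule poly_mapping_eqI)
  fix k
  show "Poly_Mapping.lookup w k =
    Poly_Mapping.lookup (\<Sum>p\<in>Poly_Mapping.keys w. Poly_Mapping.single p (Poly_Mapping.lookup w p)) k"
    by (auto simp: lookup_sum lookup_single when_def in_keys_iff)
qed

text \<open>
  Multiplicativity of \<open>\<Delta>\<^sub>\<star>\<close> enters through this rule only: evaluating on a convolution product is
  an iterated evaluation.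
\<close>

lemma pm_eval_mult:
  fixes w v :: "'b::monoid_add \<Rightarrow>\<^sub>0 real"
  shows "pm_eval (w * v) F = pm_eval w (\<lambda>p. pm_eval v (\<lambda>q. F (p + q)))"
proof -
  have "w * v = (\<Sum>p\<in>Poly_Mapping.keys w. \<Sum>q\<in>Poly_Mapping.keys v.
      Poly_Mapping.single (p + q) (Poly_Mapping.lookup w p * Poly_Mapping.lookup v q))"
    by (subst (1) poly_mapping_sum_single[of w], subst (1) poly_mapping_sum_single[of v])
      (simp add: sum_product mult_single)
  then show ?thesis
    by (simp add: pm_eval_sum pm_eval_single) (simp add: pm_eval_def sum_distrib_left mult.assoc)
qed

text \<open>
  Sweedler notation: \<open>cuts \<zeta> F\<close> is the sum of \<open>F \<zeta>\<^sub>1 \<zeta>\<^sub>2\<close> over the terms of \<open>\<Delta>\<^sub>\<star> \<zeta>\<close>. From here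
  on the coproduct is used only through the three equations for \<open>{#}\<close>, sums and grafting, so no
  explicit coefficients appear.
\<close>

definition cuts :: "'d forest \<Rightarrow> ('d forest \<Rightarrow> 'd forest \<Rightarrow> real) \<Rightarrow> real" where
  "cuts \<zeta> F = pm_eval (coprod_star \<zeta>) (\<lambda>(a, b). F a b)"

lemma star_eq_cuts: "star x y \<zeta> = cuts \<zeta> (\<lambda>a b. x a * y b)"
  by (simp add: star_def cuts_def pairing_lookup tensor_def)

lemma cuts_empty [simp]: "cuts {#} F = F {#} {#}"
  by (simp add: cuts_def coprod_star_one pm_eval_single del: single_one)

lemma cuts_plus:
  "cuts (\<zeta> + \<eta>) F = cuts \<zeta> (\<lambda>a b. cuts \<eta> (\<lambda>a' b'. F (a + a') (b + b')))"
  by (simp add: cuts_def coprod_star_mult pm_eval_mult plus_prod_def case_prod_unfold)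

lemma cuts_graft:
  "cuts {#Node i \<zeta>#} F = F {#Node i \<zeta>#} {#} + cuts \<zeta> (\<lambda>a b. F a {#Node i b#})"
  by (simp add: cuts_def coprod_star_graft pm_eval_plus pm_eval_single graft_right_def pm_eval_sum
      case_prod_unfold) (simp add: pm_eval_def case_prod_unfold)

lemma cuts_add: "cuts \<zeta> (\<lambda>a b. F a b + G a b) = cuts \<zeta> F + cuts \<zeta> G"
  by (simp add: cuts_def pm_eval_def case_prod_unfold distrib_left sum.distrib)

lemma cuts_cmult: "cuts \<zeta> (\<lambda>a b. c * F a b) = c * cuts \<zeta> F"
  by (simp add: cuts_def pm_eval_def case_prod_unfold sum_distrib_left mult.left_commute)

lemma cuts_cmult_right: "cuts \<zeta> (\<lambda>a b. F a b * c) = cuts \<zeta> F * c"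
  using cuts_cmult[of \<zeta> c F] by (simp add: mult.commute)

lemma cuts_zero [simp]: "cuts \<zeta> (\<lambda>a b. 0) = 0"
  by (simp add: cuts_def pm_eval_def case_prod_unfold)

lemma cuts_sum: "cuts \<zeta> (\<lambda>a b. \<Sum>i\<in>I. F i a b) = (\<Sum>i\<in>I. cuts \<zeta> (F i))"
  by (induction I rule: infinite_finite_induct) (simp_all add: cuts_add)

lemma cuts_commute:
  "cuts \<zeta> (\<lambda>a b. cuts \<eta> (\<lambda>c e. F a b c e)) = cuts \<eta> (\<lambda>c e. cuts \<zeta> (\<lambda>a b. F a b c e))"
proof -
  have "cuts \<zeta> (\<lambda>a b. cuts \<eta> (\<lambda>c e. F a b c e)) =
    (\<Sum>p\<in>Poly_Mapping.keys (coprod_star \<zeta>). \<Sum>q\<in>Poly_Mapping.keys (coprod_star \<eta>).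
      Poly_Mapping.lookup (coprod_star \<zeta>) p * (Poly_Mapping.lookup (coprod_star \<eta>) q *
        F (fst p) (snd p) (fst q) (snd q)))"
    by (simp add: cuts_def pm_eval_def case_prod_unfold sum_distrib_left)
  also have "\<dots> = cuts \<eta> (\<lambda>c e. cuts \<zeta> (\<lambda>a b. F a b c e))"
    by (subst sum.swap) (simp add: cuts_def pm_eval_def case_prod_unfold sum_distrib_left mult.left_commute)
  finally show ?thesis .
qed

lemma forest_size_empty [simp]: "forest_size {#} = 0"
  by (simp add: forest_size_def)

lemma forest_size_plus [simp]: "forest_size (\<zeta> + \<eta>) = forest_size \<zeta> + forest_size \<eta>"
  by (simp add: forest_size_def)

lemma forest_size_add_mset [simp]: "forest_size (add_mset \<tau> \<zeta>) = tree_size \<tau> + forest_size \<zeta>"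
  by (simp add: forest_size_def)

lemma tree_size_Node: "tree_size (Node i \<zeta>) = Suc (forest_size \<zeta>)"
  by (simp add: forest_size_def)

lemma tree_size_neq_0 [simp]: "tree_size \<tau> \<noteq> 0"
  by (cases \<tau>) simp

lemma tree_size_pos [simp]: "0 < tree_size \<tau>"
  by (cases \<tau>) simp

lemma forest_size_eq_0_iff [simp]: "forest_size \<zeta> = 0 \<longleftrightarrow> \<zeta> = {#}"
  by (cases \<zeta>) simp_all

text \<open>
  The induction that mirrors the defining properties of \<open>\<Delta>\<^sub>\<star>\<close>: products and grafting.
\<close>

lemma forest_induct [case_names empty graft plus]:
  assumes "P {#}"
    and graft: "\<And>i \<zeta>. P \<zeta> \<Longrightarrow> P {#Node i \<zeta>#}"
    and plus: "\<And>\<zeta> \<eta>. P \<zeta> \<Longrightarrow> P \<eta> \<Longrightarrow> P (\<zeta> + \<eta>)"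
  shows "P \<zeta>"
proof (induction "forest_size \<zeta>" arbitrary: \<zeta> rule: less_induct)
  case less
  show ?case
  proof (cases \<zeta>)
    case empty
    with assms(1) show ?thesis by simp
  next
    case (add \<tau> \<eta>)
    obtain i \<xi> where \<tau>: "\<tau> = Node i \<xi>" by (cases \<tau>)
    have "P {#\<tau>#}" unfolding \<tau> by (intro graft less) (simp add: add \<tau> flip: forest_size_def)
    moreover have "P \<eta>" by (intro less) (simp add: add)
    ultimately show ?thesis using plus[of "{#\<tau>#}" \<eta>] add by simp
  qed
qed

text \<open>
  The grading of \<open>\<Delta>\<^sub>\<star>\<close>, in the form of a congruence rule.
\<close>

lemma cuts_cong:
  assumes "\<And>a b. forest_size a + forest_size b = forest_size \<zeta> \<Longrightarrow> F a b = G a b"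
  shows "cuts \<zeta> F = cuts \<zeta> G"
  using assms
proof (induction \<zeta> arbitrary: F G rule: forest_induct)
  case empty
  then show ?case by simp
next
  case (graft i \<zeta>)
  have "cuts \<zeta> (\<lambda>a b. F a {#Node i b#}) = cuts \<zeta> (\<lambda>a b. G a {#Node i b#})"
    by (rule graft.IH, rule graft.prems) (simp add: tree_size_Node del: tree_size.simps)
  then show ?case by (simp add: cuts_graft graft.prems)
next
  case (plus \<zeta> \<eta>)
  show ?case
    unfolding cuts_plus
    by (rule plus.IH(1), rule plus.IH(2), rule plus.prems) simp
qed

text \<open>
  On products both sides factor, up to exchanging independent sums. On \<open>\<lfloor>\<zeta>\<rfloor>\<^sub>i\<close> both sides equal
  \<open>F \<lfloor>\<zeta>\<rfloor> \<one> \<one>\<close>, plus the sum over \<open>\<Delta>\<^sub>\<star> \<zeta>\<close> in which the root lies in the middle slot, plus the sum in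
  which it lies in the last slot, where the induction hypothesis applies.
\<close>

lemma cuts_coassoc:
  "cuts \<eta> (\<lambda>a b. cuts a (\<lambda>c e. F c e b)) = cuts \<eta> (\<lambda>a b. cuts b (\<lambda>c e. F a c e))"
proof (induction \<eta> arbitrary: F rule: forest_induct)
  case empty
  show ?case by simp
next
  case (graft i \<zeta>)
  have "cuts \<zeta> (\<lambda>a b. cuts a (\<lambda>c e. F c e {#Node i b#})) =
    cuts \<zeta> (\<lambda>a b. cuts b (\<lambda>c e. F a c {#Node i e#}))"
    by (rule graft.IH)
  then show ?case
    by (simp add: cuts_graft cuts_add)
next
  case (plus \<zeta> \<eta>)
  have "cuts (\<zeta> + \<eta>) (\<lambda>a b. cuts a (\<lambda>c e. F c e b)) =
    cuts \<zeta> (\<lambda>a b. cuts \<eta> (\<lambda>a' b'. cuts a (\<lambda>c e. cuts a' (\<lambda>c' e'. F (c + c') (e + e') (b + b')))))"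
    by (simp only: cuts_plus)
  also have "\<dots> =
    cuts \<zeta> (\<lambda>a b. cuts a (\<lambda>c e. cuts \<eta> (\<lambda>a' b'. cuts a' (\<lambda>c' e'. F (c + c') (e + e') (b + b')))))"
    by (rule cuts_cong, rule cuts_commute)
  also have "\<dots> =
    cuts \<zeta> (\<lambda>a b. cuts b (\<lambda>c e. cuts \<eta> (\<lambda>a' b'. cuts b' (\<lambda>c' e'. F (a + a') (c + c') (e + e')))))"
    by (rule trans[OF plus.IH(1)]) (intro cuts_cong plus.IH(2))
  also have "\<dots> =
    cuts \<zeta> (\<lambda>a b. cuts \<eta> (\<lambda>a' b'. cuts b (\<lambda>c e. cuts b' (\<lambda>c' e'. F (a + a') (c + c') (e + e')))))"
    by (rule cuts_cong, rule cuts_commute[symmetric])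
  also have "\<dots> = cuts (\<zeta> + \<eta>) (\<lambda>a b. cuts b (\<lambda>c e. F a c e))"
    by (simp only: cuts_plus)
  finally show ?case .
qed

lemma cuts_counit_right: "cuts \<zeta> (\<lambda>a b. if b = {#} then F a else 0) = F \<zeta>"
proof (induction \<zeta> arbitrary: F rule: forest_induct)
  case (plus \<zeta> \<eta>)
  have "cuts (\<zeta> + \<eta>) (\<lambda>a b. if b = {#} then F a else 0) =
    cuts \<zeta> (\<lambda>a b. if b = {#} then cuts \<eta> (\<lambda>a' b'. if b' = {#} then F (a + a') else 0) else 0)"
    unfolding cuts_plus by (rule cuts_cong) simp
  then show ?case by (simp add: plus.IH)
qed (simp_all add: cuts_graft)

lemma cuts_counit_left: "cuts \<zeta> (\<lambda>a b. if a = {#} then F b else 0) = F \<zeta>"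
proof (induction \<zeta> arbitrary: F rule: forest_induct)
  case (plus \<zeta> \<eta>)
  have "cuts (\<zeta> + \<eta>) (\<lambda>a b. if a = {#} then F b else 0) =
    cuts \<zeta> (\<lambda>a b. if a = {#} then cuts \<eta> (\<lambda>a' b'. if a' = {#} then F (b + b') else 0) else 0)"
    unfolding cuts_plus by (rule cuts_cong) simp
  then show ?case by (simp add: plus.IH)
qed (simp_all add: cuts_graft)

text \<open>
  The reduced coproduct. Both factors of its terms have smaller degree than \<open>\<zeta>\<close>, which makes every
  recursion and induction over the degree below work.
\<close>

definition proper_cuts :: "'d forest \<Rightarrow> ('d forest \<Rightarrow> 'd forest \<Rightarrow> real) \<Rightarrow> real" where
  "proper_cuts \<zeta> F = cuts \<zeta> (\<lambda>a b. if a = {#} \<or> b = {#} then 0 else F a b)"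

lemma cuts_split:
  assumes "\<zeta> \<noteq> {#}"
  shows "cuts \<zeta> F = F \<zeta> {#} + F {#} \<zeta> + proper_cuts \<zeta> F"
proof -
  have "cuts \<zeta> F = cuts \<zeta> (\<lambda>a b. ((if b = {#} then F a {#} else 0) + (if a = {#} then F {#} b else 0))
      + (if a = {#} \<or> b = {#} then 0 else F a b))"
    by (rule cuts_cong) (use assms in auto)
  then show ?thesis
    by (simp add: cuts_add cuts_counit_left cuts_counit_right proper_cuts_def)
qed

lemma proper_cuts_cong:
  assumes "\<And>a b. forest_size a + forest_size b = forest_size \<zeta> \<Longrightarrow> a \<noteq> {#} \<Longrightarrow> b \<noteq> {#} \<Longrightarrow>
    forest_size a < forest_size \<zeta> \<Longrightarrow> forest_size b < forest_size \<zeta> \<Longrightarrow> F a b = G a b"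
  shows "proper_cuts \<zeta> F = proper_cuts \<zeta> G"
  unfolding proper_cuts_def
proof (rule cuts_cong)
  fix a b :: "'a forest"
  assume sz: "forest_size a + forest_size b = forest_size \<zeta>"
  show "(if a = {#} \<or> b = {#} then 0 else F a b) = (if a = {#} \<or> b = {#} then 0 else G a b)"
  proof (cases "a = {#} \<or> b = {#}")
    case False
    then have "0 < forest_size a" "0 < forest_size b" by (metis forest_size_eq_0_iff gr0I)+
    then show ?thesis using False sz assms[of a b] by simp
  qed auto
qed

text \<open>
  The assumption that there are finitely many decorations enters through this lemma. A tree of size
  \<open>n + 1\<close> is a root label and a forest of size \<open>n\<close>, and a forest of size at most \<open>n + 1\<close> is a multiset
  of at most \<open>n + 1\<close> trees of at most that size, so the two claims are proved together.
\<close>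

lemma finite_trees_forests:
  "finite (trees_upto n :: ('d::finite) rtree set) \<and> finite (forests_upto n :: 'd forest set)"
proof (induction n)
  case 0
  have "(trees_upto 0 :: 'd rtree set) = {}" "(forests_upto 0 :: 'd forest set) = {{#}}"
    by (auto simp: trees_upto_def forests_upto_def)
  then show ?case by simp
next
  case (Suc n)
  have "(trees_upto (Suc n) :: 'd rtree set) \<subseteq> (\<lambda>(i, \<zeta>). Node i \<zeta>) ` (UNIV \<times> forests_upto n)"
  proof
    fix \<tau> :: "'d rtree"
    assume "\<tau> \<in> trees_upto (Suc n)"
    then show "\<tau> \<in> (\<lambda>(i, \<zeta>). Node i \<zeta>) ` (UNIV \<times> forests_upto n)"
      by (cases \<tau>) (auto simp: trees_upto_def forests_upto_def simp flip: forest_size_def)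
  qed
  then have T: "finite (trees_upto (Suc n) :: 'd rtree set)"
    by (rule finite_subset) (use Suc in auto)
  have sz: "size \<zeta> \<le> forest_size \<zeta>" for \<zeta> :: "'d forest"
  proof (induction \<zeta>)
    case (add \<tau> \<zeta>)
    have "1 \<le> tree_size \<tau>" by (cases \<tau>) simp
    then show ?case using add unfolding size_add_mset forest_size_add_mset by linarith
  qed simp
  have mem: "\<tau> \<in># \<zeta> \<Longrightarrow> tree_size \<tau> \<le> forest_size \<zeta>" for \<zeta> :: "'d forest" and \<tau>
    by (auto dest!: multi_member_split)
  have "(forests_upto (Suc n) :: 'd forest set) \<subseteq> (\<Union>k\<le>Suc n. multisets_of_size (trees_upto (Suc n)) k)"
  proof
    fix \<zeta> :: "'d forest"
    assume "\<zeta> \<in> forests_upto (Suc n)"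
    then have \<zeta>: "forest_size \<zeta> \<le> Suc n" by (simp add: forests_upto_def)
    have "set_mset \<zeta> \<subseteq> trees_upto (Suc n)"
      using mem[of _ \<zeta>] \<zeta> unfolding trees_upto_def by (blast intro: order_trans)
    then have "\<zeta> \<in> multisets_of_size (trees_upto (Suc n)) (size \<zeta>)"
      by (simp add: multisets_of_size_def)
    moreover have "size \<zeta> \<in> {..Suc n}" using sz[of \<zeta>] \<zeta> by simp
    ultimately show "\<zeta> \<in> (\<Union>k\<le>Suc n. multisets_of_size (trees_upto (Suc n)) k)" by blast
  qed
  then have "finite (forests_upto (Suc n) :: 'd forest set)"
    by (rule finite_subset) (use T in auto)
  with T show ?case by simp
qed

section \<open>Characters of the forest monoid\<close>

definition character :: "'d series \<Rightarrow> bool" where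
  "character g \<longleftrightarrow> g {#} = 1 \<and> (\<forall>\<zeta> \<eta>. g (\<zeta> + \<eta>) = g \<zeta> * g \<eta>)"

abbreviation unit_series :: "'d series" where
  "unit_series \<equiv> basis_vec {#}"

lemma unit_series_apply: "unit_series \<zeta> = (if \<zeta> = {#} then 1 else 0)"
  by (simp add: basis_vec_def)

lemma character_empty: "character g \<Longrightarrow> g {#} = 1"
  and character_plus: "character g \<Longrightarrow> g (\<zeta> + \<eta>) = g \<zeta> * g \<eta>"
  by (auto simp: character_def)

lemma character_add_mset: "character g \<Longrightarrow> g (add_mset \<tau> \<zeta>) = g {#\<tau>#} * g \<zeta>"
  using character_plus[of g "{#\<tau>#}" \<zeta>] by simp

lemma character_unit: "character unit_series"
  by (simp add: character_def unit_series_apply)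

text \<open>
  The character with prescribed values on trees.
\<close>

definition from_trees :: "('d rtree \<Rightarrow> real) \<Rightarrow> 'd series" where
  "from_trees f \<zeta> = prod_mset (image_mset f \<zeta>)"

lemma character_from_trees: "character (from_trees f)"
  by (simp add: character_def from_trees_def)

lemma from_trees_single [simp]: "from_trees f {#\<tau>#} = f \<tau>"
  by (simp add: from_trees_def)

lemma character_eqI:
  assumes "character g" "character h"
    and "\<And>\<tau>. tree_size \<tau> \<le> forest_size \<zeta> \<Longrightarrow> g {#\<tau>#} = h {#\<tau>#}"
  shows "g \<zeta> = h \<zeta>"
  using assms(3)
proof (induction \<zeta>)
  case empty
  show ?case by (simp add: character_empty[OF assms(1)] character_empty[OF assms(2)])
next
  case (add \<tau> \<zeta>)
  then have "g {#\<tau>#} = h {#\<tau>#}" "g \<zeta> = h \<zeta>" by simp_all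
  then show ?case
    using character_add_mset[OF assms(1), of \<tau> \<zeta>] character_add_mset[OF assms(2), of \<tau> \<zeta>] by simp
qed

lemma star_assoc: "star (star x y) z = star x (star y z)"
proof
  fix \<zeta>
  have "star (star x y) z \<zeta> = cuts \<zeta> (\<lambda>a b. cuts a (\<lambda>c e. x c * y e * z b))"
    by (simp add: star_eq_cuts cuts_cmult_right)
  also have "\<dots> = cuts \<zeta> (\<lambda>a b. cuts b (\<lambda>c e. x a * y c * z e))"
    by (rule cuts_coassoc)
  also have "\<dots> = star x (star y z) \<zeta>"
    by (simp add: star_eq_cuts cuts_cmult mult.assoc)
  finally show "star (star x y) z \<zeta> = star x (star y z) \<zeta>" .
qed

lemma star_unit_left: "star unit_series x = x"
proof
  fix \<zeta>
  have "star unit_series x \<zeta> = cuts \<zeta> (\<lambda>a b. if a = {#} then x b else 0)"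
    unfolding star_eq_cuts by (rule cuts_cong) (simp add: unit_series_apply)
  then show "star unit_series x \<zeta> = x \<zeta>" by (simp add: cuts_counit_left)
qed

lemma star_unit_right: "star x unit_series = x"
proof
  fix \<zeta>
  have "star x unit_series \<zeta> = cuts \<zeta> (\<lambda>a b. if b = {#} then x a else 0)"
    unfolding star_eq_cuts by (rule cuts_cong) (simp add: unit_series_apply)
  then show "star x unit_series \<zeta> = x \<zeta>" by (simp add: cuts_counit_right)
qed

lemma star_empty [simp]: "star x y {#} = x {#} * y {#}"
  by (simp add: star_eq_cuts)

lemma star_split:
  assumes "\<zeta> \<noteq> {#}"
  shows "star x y \<zeta> = x \<zeta> * y {#} + x {#} * y \<zeta> + proper_cuts \<zeta> (\<lambda>a b. x a * y b)"
  by (simp add: star_eq_cuts cuts_split[OF assms])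

lemma star_cong:
  assumes "\<And>a. forest_size a \<le> forest_size \<zeta> \<Longrightarrow> x a = x' a"
    and "\<And>a. forest_size a \<le> forest_size \<zeta> \<Longrightarrow> y a = y' a"
  shows "star x y \<zeta> = star x' y' \<zeta>"
  unfolding star_eq_cuts by (rule cuts_cong) (simp add: assms)

text \<open>
  \<open>\<Delta>\<^sub>\<star>\<close> is multiplicative, and a product of two sums factors.
\<close>

lemma character_star:
  assumes "character g" "character h"
  shows "character (star g h)"
  unfolding character_def
proof (intro conjI allI)
  show "star g h {#} = 1"
    by (simp add: character_empty[OF assms(1)] character_empty[OF assms(2)])
  fix \<zeta> \<eta>
  have "star g h (\<zeta> + \<eta>) = cuts \<zeta> (\<lambda>a b. cuts \<eta> (\<lambda>a' b'. (g a * h b) * (g a' * h b')))"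
    unfolding star_eq_cuts cuts_plus
    by (intro cuts_cong) (simp add: character_plus[OF assms(1)] character_plus[OF assms(2)])
  then show "star g h (\<zeta> + \<eta>) = star g h \<zeta> * star g h \<eta>"
    by (simp add: cuts_cmult cuts_cmult_right star_eq_cuts)
qed

text \<open>
  Recursion over the size of a tree, for equations that do not descend along the structure of the tree:
  cutting a tree yields smaller forests whose trees need not be subtrees.
\<close>

lemma tree_recursion:
  fixes \<Phi> :: "('d rtree \<Rightarrow> 'a) \<Rightarrow> 'd rtree \<Rightarrow> 'a"
  assumes "\<And>f f' \<tau>. (\<And>\<sigma>. tree_size \<sigma> < tree_size \<tau> \<Longrightarrow> f \<sigma> = f' \<sigma>) \<Longrightarrow> \<Phi> f \<tau> = \<Phi> f' \<tau>"
  shows "\<exists>f. \<forall>\<tau>. f \<tau> = \<Phi> f \<tau>"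
proof -
  have "adm_wf (measure tree_size) \<Phi>"
    unfolding adm_wf_def
  proof (intro allI impI)
    fix f f' :: "'d rtree \<Rightarrow> 'a" and \<tau>
    assume *: "\<forall>\<sigma>. (\<sigma>, \<tau>) \<in> measure tree_size \<longrightarrow> f \<sigma> = f' \<sigma>"
    show "\<Phi> f \<tau> = \<Phi> f' \<tau>"
      by (rule assms) (use * in simp)
  qed
  then have "wfrec (measure tree_size) \<Phi> = \<Phi> (wfrec (measure tree_size) \<Phi>)"
    by (rule wfrec_fixpoint[OF wf_measure])
  then show ?thesis by (metis fun_cong)
qed

lemma from_trees_cong:
  assumes "\<And>\<tau>. tree_size \<tau> \<le> forest_size \<zeta> \<Longrightarrow> f \<tau> = f' \<tau>"
  shows "from_trees f \<zeta> = from_trees f' \<zeta>"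
  by (rule character_eqI[OF character_from_trees character_from_trees]) (simp add: assms)

text \<open>
  The equation \<open>(g \<star> h) \<tau> = 0\<close> determines \<open>h \<tau>\<close> from the values of \<open>h\<close> on smaller trees. Extending
  these values multiplicatively makes \<open>g \<star> h\<close> a character, and a character that agrees with the unit
  on trees is the unit. This avoids showing directly that an antipode is multiplicative.
\<close>

lemma character_right_inverse:
  fixes g :: "'d series"
  assumes g: "character g"
  obtains h where "character h" "star g h = unit_series"
proof -
  define \<Phi> where "\<Phi> f \<tau> = - g {#\<tau>#} - proper_cuts {#\<tau>#} (\<lambda>a b. g a * from_trees f b)" for f \<tau>
  have "\<exists>f. \<forall>\<tau>. f \<tau> = \<Phi> f \<tau>"
  proof (rule tree_recursion[of \<Phi>])
    fix f f' :: "'d rtree \<Rightarrow> real" and \<tau> :: "'d rtree"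
    assume eq: "\<And>\<sigma>. tree_size \<sigma> < tree_size \<tau> \<Longrightarrow> f \<sigma> = f' \<sigma>"
    have "proper_cuts {#\<tau>#} (\<lambda>a b. g a * from_trees f b) = proper_cuts {#\<tau>#} (\<lambda>a b. g a * from_trees f' b)"
    proof (rule proper_cuts_cong)
      fix a b :: "'d forest"
      assume "forest_size b < forest_size {#\<tau>#}"
      then have "from_trees f b = from_trees f' b"
        by (intro from_trees_cong) (simp add: eq)
      then show "g a * from_trees f b = g a * from_trees f' b" by simp
    qed
    then show "\<Phi> f \<tau> = \<Phi> f' \<tau>" by (simp add: \<Phi>_def)
  qed
  then obtain f where f: "\<And>\<tau>. f \<tau> = \<Phi> f \<tau>" by blast
  let ?h = "from_trees f"
  have h: "character ?h" by (rule character_from_trees)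
  have on_trees: "star g ?h {#\<tau>#} = 0" for \<tau>
    using f[of \<tau>] by (simp add: star_split character_empty[OF g] character_empty[OF h] \<Phi>_def)
  have "star g ?h \<zeta> = unit_series \<zeta>" for \<zeta>
    by (rule character_eqI[OF character_star[OF g h] character_unit]) (simp add: on_trees unit_series_apply)
  then have "star g ?h = unit_series" ..
  with h show thesis by (rule that)
qed

section \<open>The truncated groups as quotients of the group of characters\<close>

definition cutoff :: "enat \<Rightarrow> 'd series \<Rightarrow> 'd series" where
  "cutoff N x = (\<lambda>\<zeta>. if enat (forest_size \<zeta>) \<le> N then x \<zeta> else 0)"

lemma cutoff_infinity [simp]: "cutoff \<infinity> x = x"
  by (simp add: cutoff_def)

lemma cutoff_enat: "cutoff (enat n) x = proj n x"
  by (simp add: cutoff_def proj_def)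

lemma cutoff_eq_iff:
  "cutoff N x = cutoff N y \<longleftrightarrow> (\<forall>\<zeta>. enat (forest_size \<zeta>) \<le> N \<longrightarrow> x \<zeta> = y \<zeta>)"
  by (auto simp: cutoff_def fun_eq_iff)

lemma cutoff_cutoff [simp]: "cutoff N (cutoff N x) = cutoff N x"
  by (simp add: cutoff_def fun_eq_iff)

lemma cutoff_unit [simp]: "cutoff N unit_series = unit_series"
  by (auto simp: cutoff_def fun_eq_iff unit_series_apply simp flip: zero_enat_def)

text \<open>
  The truncation is a congruence for \<open>\<star>\<close>, since no term of \<open>\<Delta>\<^sub>\<star> \<zeta>\<close> has larger degree than \<open>\<zeta>\<close>.
\<close>

lemma cutoff_star_cong:
  fixes x y :: "'d series"
  assumes "cutoff N x = cutoff N x'" "cutoff N y = cutoff N y'"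
  shows "cutoff N (star x y) = cutoff N (star x' y')"
  unfolding cutoff_eq_iff
proof (intro allI impI)
  fix \<zeta> :: "'d forest"
  assume \<zeta>: "enat (forest_size \<zeta>) \<le> N"
  have le: "enat (forest_size a) \<le> N" if "forest_size a \<le> forest_size \<zeta>" for a :: "'d forest"
    using \<zeta> that by (metis enat_ord_simps(1) order_trans)
  show "star x y \<zeta> = star x' y' \<zeta>"
    by (rule star_cong) (use assms le in \<open>auto simp: cutoff_eq_iff\<close>)
qed

text \<open>
  The carrier is given as a quotient of the group of characters, so that the group axioms and all
  later computations can be carried out without truncation. The value \<open>N = \<infinity>\<close> is the full group.
\<close>

definition GL :: "enat \<Rightarrow> 'd series monoid" where
  "GL N = \<lparr>carrier = cutoff N ` Collect character, mult = \<lambda>x y. cutoff N (star x y), one = unit_series\<rparr>"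

definition truncated_character :: "enat \<Rightarrow> 'd series \<Rightarrow> bool" where
  "truncated_character N g \<longleftrightarrow> g {#} = 1 \<and>
     (\<forall>\<zeta> \<eta>. enat (forest_size \<zeta> + forest_size \<eta>) \<le> N \<longrightarrow> g (\<zeta> + \<eta>) = g \<zeta> * g \<eta>) \<and>
     (\<forall>\<zeta>. \<not> enat (forest_size \<zeta>) \<le> N \<longrightarrow> g \<zeta> = 0)"

text \<open>
  A truncated character extends to a character by its values on trees of degree at most \<open>N\<close>; the
  values on the other trees may be arbitrary, here zero.
\<close>

lemma truncated_character_iff:
  "truncated_character N g \<longleftrightarrow> (\<exists>G. character G \<and> g = cutoff N G)"
proof
  assume g: "truncated_character N g"
  let ?G = "from_trees (\<lambda>\<tau>. g {#\<tau>#})"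
  have "?G \<zeta> = g \<zeta>" if "enat (forest_size \<zeta>) \<le> N" for \<zeta>
    using that
  proof (induction \<zeta>)
    case empty
    show ?case using g by (simp add: truncated_character_def from_trees_def)
  next
    case (add \<tau> \<zeta>)
    have "enat (forest_size \<zeta>) \<le> N"
      using add.prems by (metis enat_ord_simps(1) forest_size_add_mset le_add2 order_trans)
    then have "?G \<zeta> = g \<zeta>" by (rule add.IH)
    moreover have "g ({#\<tau>#} + \<zeta>) = g {#\<tau>#} * g \<zeta>"
      using g add.prems unfolding truncated_character_def by (auto simp del: union_mset_add_mset_left)
    ultimately show ?case by (simp add: from_trees_def)
  qed
  then have "g = cutoff N ?G"
    using g by (auto simp: cutoff_def truncated_character_def)
  then show "\<exists>G. character G \<and> g = cutoff N G"
    using character_from_trees by blast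
next
  assume "\<exists>G. character G \<and> g = cutoff N G"
  then obtain G where "character G" "g = cutoff N G" by blast
  moreover have "enat m \<le> N" if "enat n \<le> N" "m \<le> n" for m n
    using that by (metis enat_ord_simps(1) order_trans)
  moreover have "(0::enat) \<le> N" by simp
  ultimately show "truncated_character N g"
    by (auto simp: truncated_character_def cutoff_def character_def zero_enat_def[symmetric])
qed

lemma carrier_GL: "carrier (GL N) = Collect (truncated_character N)"
  by (auto simp: GL_def truncated_character_iff)

lemma one_GL: "\<one>\<^bsub>GL N\<^esub> = unit_series"
  by (simp add: GL_def)

lemma mult_GL: "x \<otimes>\<^bsub>GL N\<^esub> y = cutoff N (star x y)"
  by (simp add: GL_def)

lemma cutoff_in_carrier_GL: "character G \<Longrightarrow> cutoff N G \<in> carrier (GL N)"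
  by (auto simp: carrier_GL truncated_character_iff)

lemma carrier_GL_cutoffE:
  assumes "g \<in> carrier (GL N)"
  obtains G where "character G" "g = cutoff N G"
  using assms by (auto simp: carrier_GL truncated_character_iff)

lemma mult_GL_cutoff: "cutoff N x \<otimes>\<^bsub>GL N\<^esub> cutoff N y = cutoff N (star x y)"
  unfolding mult_GL by (rule cutoff_star_cong) simp_all

lemma group_GL: "group (GL N :: 'd series monoid)"
proof (rule groupI)
  fix x y :: "'d series"
  assume "x \<in> carrier (GL N :: 'd series monoid)" "y \<in> carrier (GL N :: 'd series monoid)"
  then obtain X Y where "character X" "x = cutoff N X" "character Y" "y = cutoff N Y"
    by (metis carrier_GL_cutoffE)
  then show "x \<otimes>\<^bsub>GL N\<^esub> y \<in> carrier (GL N :: 'd series monoid)"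
    by (simp add: mult_GL_cutoff cutoff_in_carrier_GL character_star)
next
  show "\<one>\<^bsub>GL N\<^esub> \<in> carrier (GL N :: 'd series monoid)"
    using cutoff_in_carrier_GL[OF character_unit, of N] by (simp add: one_GL)
next
  fix x y z :: "'d series"
  assume "x \<in> carrier (GL N :: 'd series monoid)" "y \<in> carrier (GL N :: 'd series monoid)" "z \<in> carrier (GL N :: 'd series monoid)"
  then obtain X Y Z where "x = cutoff N X" "y = cutoff N Y" "z = cutoff N Z"
    by (metis carrier_GL_cutoffE)
  then show "x \<otimes>\<^bsub>GL N\<^esub> y \<otimes>\<^bsub>GL N\<^esub> z = x \<otimes>\<^bsub>GL N\<^esub> (y \<otimes>\<^bsub>GL N\<^esub> z)"
    by (simp add: mult_GL_cutoff star_assoc)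
next
  fix x :: "'d series"
  assume "x \<in> carrier (GL N :: 'd series monoid)"
  then obtain X where "x = cutoff N X" by (metis carrier_GL_cutoffE)
  then show "\<one>\<^bsub>GL N\<^esub> \<otimes>\<^bsub>GL N\<^esub> x = x"
    by (simp add: mult_GL one_GL star_unit_left)
next
  fix x :: "'d series"
  assume "x \<in> carrier (GL N :: 'd series monoid)"
  then obtain X where X: "character X" "x = cutoff N X" by (metis carrier_GL_cutoffE)
  obtain Y where Y: "character Y" "star X Y = unit_series"
    using character_right_inverse[OF X(1)] .
  obtain Z where Z: "character Z" "star Y Z = unit_series"
    using character_right_inverse[OF Y(1)] .
  (* X and Z are a left and a right inverse of Y, so the right inverse Y of X is also a left inverse. *)
  have "Z = X"
    using Y Z by (metis star_assoc star_unit_left star_unit_right)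
  then have "cutoff N Y \<otimes>\<^bsub>GL N\<^esub> x = \<one>\<^bsub>GL N\<^esub>"
    using Z by (simp add: X mult_GL_cutoff one_GL)
  then show "\<exists>y\<in>carrier (GL N :: 'd series monoid). y \<otimes>\<^bsub>GL N\<^esub> x = \<one>\<^bsub>GL N\<^esub>"
    using cutoff_in_carrier_GL[OF Y(1)] by blast
qed

text \<open>
  A nonzero multiplicative \<open>g\<close> has \<open>g \<one> = 1\<close>, because \<open>g \<zeta> = g \<one> * g \<zeta>\<close> for a \<open>\<zeta>\<close> with
  \<open>g \<zeta> \<noteq> 0\<close>.
\<close>

lemma GL_group_eq: "GL_group = (GL \<infinity> :: 'd series monoid)"
proof -
  have "(g \<noteq> (\<lambda>_. 0) \<and> coprod_odot g = tensor g g) \<longleftrightarrow> character g" for g :: "'d series"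
  proof
    assume g: "g \<noteq> (\<lambda>_. 0) \<and> coprod_odot g = tensor g g"
    then have odot: "coprod_odot g = tensor g g" by simp
    have plus: "g (\<zeta> + \<eta>) = g \<zeta> * g \<eta>" for \<zeta> \<eta>
      using fun_cong[OF odot, of "(\<zeta>, \<eta>)"] by (simp add: coprod_odot_def tensor_def)
    obtain \<zeta> where "g \<zeta> \<noteq> 0" using g by auto
    moreover have "g \<zeta> = g {#} * g \<zeta>" using plus[of "{#}" \<zeta>] by simp
    ultimately show "character g" by (simp add: character_def plus)
  next
    assume "character g"
    then show "g \<noteq> (\<lambda>_. 0) \<and> coprod_odot g = tensor g g"
      by (auto simp: coprod_odot_def tensor_def character_def)
  qed
  then have "carrier GL_group = carrier (GL \<infinity> :: 'd series monoid)"
    by (simp add: GL_group_def GL_def)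
  then show ?thesis
    by (simp add: GL_group_def GL_def fun_eq_iff)
qed

lemma GL_group_trunc_eq: "GL_group_trunc n = (GL (enat n) :: ('d::finite) series monoid)"
proof -
  have "(g \<in> free_space (forests_upto n) \<and> g \<noteq> (\<lambda>_. 0) \<and> coprod_odot g = proj_tensor n (tensor g g))
     \<longleftrightarrow> truncated_character (enat n) g" for g :: "'d series"
  proof
    assume g: "g \<in> free_space (forests_upto n) \<and> g \<noteq> (\<lambda>_. 0) \<and> coprod_odot g = proj_tensor n (tensor g g)"
    then have odot: "coprod_odot g = proj_tensor n (tensor g g)" by simp
    have plus: "g (\<zeta> + \<eta>) = (if forest_size \<zeta> + forest_size \<eta> \<le> n then g \<zeta> * g \<eta> else 0)" for \<zeta> \<eta>
      using fun_cong[OF odot, of "(\<zeta>, \<eta>)"]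
      by (simp add: coprod_odot_def tensor_def proj_tensor_def)
    have zero: "g \<zeta> = 0" if "\<not> forest_size \<zeta> \<le> n" for \<zeta>
      using g that by (auto simp: free_space_def forests_upto_def)
    obtain \<zeta> where "g \<zeta> \<noteq> 0" using g by auto
    moreover from this have "g \<zeta> = g {#} * g \<zeta>" using plus[of "{#}" \<zeta>] zero[of \<zeta>] by (auto split: if_splits)
    ultimately show "truncated_character (enat n) g" by (simp add: truncated_character_def plus zero)
  next
    assume g: "truncated_character (enat n) g"
    have "{\<zeta>. g \<zeta> \<noteq> 0} \<subseteq> forests_upto n"
      using g by (auto simp: truncated_character_def forests_upto_def)
    then have "g \<in> free_space (forests_upto n)"
      using finite_subset finite_trees_forests unfolding free_space_def by blast
    then show "g \<in> free_space (forests_upto n) \<and> g \<noteq> (\<lambda>_. 0) \<and> coprod_odot g = proj_tensor n (tensor g g)"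
      using g by (auto simp: coprod_odot_def tensor_def proj_tensor_def truncated_character_def fun_eq_iff
          intro: exI[of _ "{#}"])
  qed
  then have "carrier (GL_group_trunc n) = carrier (GL (enat n) :: 'd series monoid)"
    by (simp add: GL_group_trunc_def carrier_GL)
  then show ?thesis
    by (simp add: GL_group_trunc_def GL_def star_trunc_def cutoff_enat fun_eq_iff)
qed

lemma cutoff_hom: "cutoff N \<in> hom (GL \<infinity>) (GL N)"
  unfolding hom_def
proof (intro CollectI conjI ballI Pi_I)
  fix x y :: "'a series"
  show "cutoff N (x \<otimes>\<^bsub>GL \<infinity>\<^esub> y) = cutoff N x \<otimes>\<^bsub>GL N\<^esub> cutoff N y"
    by (simp add: mult_GL_cutoff) (simp add: mult_GL)
qed (auto simp: carrier_GL truncated_character_iff)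

lemma increment_cutoff:
  assumes "X s \<in> carrier (GL \<infinity>)" "X t \<in> carrier (GL \<infinity>)"
  shows "increment (GL N) (\<lambda>t. cutoff N (X t)) s t = cutoff N (increment (GL \<infinity>) X s t)"
proof -
  interpret group_hom "GL \<infinity>" "GL N" "cutoff N"
    by (simp add: group_hom_def group_hom_axioms_def group_GL cutoff_hom)
  show ?thesis using assms by (simp add: increment_def)
qed

section \<open>Homogeneous bounds\<close>

text \<open>
  A bound of homogeneity \<open>k\<close> in the scales \<open>h\<close>, uniform over the index set. The index set will
  consist of pairs or triples of times and \<open>h\<close> of powers of the length of the time interval.
\<close>

definition hbound :: "'i set \<Rightarrow> ('i \<Rightarrow> real) \<Rightarrow> nat \<Rightarrow> ('i \<Rightarrow> real) \<Rightarrow> bool" where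
  "hbound S h k f \<longleftrightarrow> (\<exists>C. \<forall>i\<in>S. \<bar>f i\<bar> \<le> C * h i ^ k)"

lemma hboundI: "(\<And>i. i \<in> S \<Longrightarrow> \<bar>f i\<bar> \<le> C * h i ^ k) \<Longrightarrow> hbound S h k f"
  by (auto simp: hbound_def)

lemma hboundE:
  assumes "hbound S h k f"
  obtains C where "\<And>i. i \<in> S \<Longrightarrow> \<bar>f i\<bar> \<le> C * h i ^ k"
  using assms by (auto simp: hbound_def)

lemma hbound_cong: "(\<And>i. i \<in> S \<Longrightarrow> f i = g i) \<Longrightarrow> hbound S h k f = hbound S h k g"
  by (simp add: hbound_def)

lemma hbound_transfer:
  "hbound S h k f \<Longrightarrow> (\<And>i. i \<in> S \<Longrightarrow> g i = f i) \<Longrightarrow> hbound S h k g"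
  by (simp add: hbound_def)

lemma hbound_zero [simp]: "hbound S h k (\<lambda>i. 0)"
  by (rule hboundI[where C = 0]) simp

lemma hbound_add:
  assumes "hbound S h k f" "hbound S h k g"
  shows "hbound S h k (\<lambda>i. f i + g i)"
proof -
  obtain C D where "\<And>i. i \<in> S \<Longrightarrow> \<bar>f i\<bar> \<le> C * h i ^ k" "\<And>i. i \<in> S \<Longrightarrow> \<bar>g i\<bar> \<le> D * h i ^ k"
    using assms by (metis hboundE)
  then show ?thesis
    by (intro hboundI[where C = "C + D"]) (force simp: distrib_right intro: order_trans[OF abs_triangle_ineq add_mono])
qed

lemma hbound_uminus: "hbound S h k f \<Longrightarrow> hbound S h k (\<lambda>i. - f i)"
  by (simp add: hbound_def)

lemma hbound_diff:
  "hbound S h k f \<Longrightarrow> hbound S h k g \<Longrightarrow> hbound S h k (\<lambda>i. f i - g i)"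
  using hbound_add[of S h k f "\<lambda>i. - g i"] hbound_uminus[of S h k g] by simp

lemma hbound_mult:
  assumes "hbound S h k f" "hbound S h l g"
  shows "hbound S h (k + l) (\<lambda>i. f i * g i)"
proof -
  obtain C D where C: "\<And>i. i \<in> S \<Longrightarrow> \<bar>f i\<bar> \<le> C * h i ^ k" and D: "\<And>i. i \<in> S \<Longrightarrow> \<bar>g i\<bar> \<le> D * h i ^ l"
    using assms by (metis hboundE)
  show ?thesis
  proof (rule hboundI)
    fix i assume i: "i \<in> S"
    have "\<bar>f i * g i\<bar> \<le> (C * h i ^ k) * (D * h i ^ l)"
      unfolding abs_mult by (rule mult_mono) (use C[OF i] D[OF i] in auto)
    then show "\<bar>f i * g i\<bar> \<le> (C * D) * h i ^ (k + l)"
      by (simp add: power_add mult_ac)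
  qed
qed

lemma hbound_cmult:
  assumes "hbound S h k f"
  shows "hbound S h k (\<lambda>i. c * f i)"
  using hbound_mult[OF hboundI[of S "\<lambda>i. c" "\<bar>c\<bar>" h 0] assms] by simp

lemma hbound_sum:
  "(\<And>j. j \<in> J \<Longrightarrow> hbound S h k (f j)) \<Longrightarrow> hbound S h k (\<lambda>i. \<Sum>j\<in>J. f j i)"
  by (induction J rule: infinite_finite_induct) (auto intro: hbound_add)

lemma hbound_cuts:
  assumes "\<And>a b. forest_size a + forest_size b = forest_size \<zeta> \<Longrightarrow> hbound S h k (\<lambda>i. F i a b)"
  shows "hbound S h k (\<lambda>i. cuts \<zeta> (F i))"
  using assms
proof (induction \<zeta> arbitrary: F rule: forest_induct)
  case empty
  then show ?case by simp
next
  case (graft j \<zeta>)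
  have "hbound S h k (\<lambda>i. cuts \<zeta> (\<lambda>a b. F i a {#Node j b#}))"
    by (rule graft.IH, rule graft.prems) (simp flip: forest_size_def)
  then show ?case
    unfolding cuts_graft by (intro hbound_add graft.prems) simp
next
  case (plus \<zeta> \<eta>)
  show ?case
    unfolding cuts_plus
    by (rule plus.IH(1), rule plus.IH(2), rule plus.prems) simp
qed

text \<open>
  Homogeneity adds up under multiplication and degrees add up under \<open>\<Delta>\<^sub>\<star>\<close>.
\<close>

lemma hbound_proper_cuts:
  fixes \<zeta> :: "'d forest"
  assumes "\<And>a. forest_size a < forest_size \<zeta> \<Longrightarrow> hbound S h (forest_size a) (\<lambda>i. x i a)"
    and "\<And>a. forest_size a < forest_size \<zeta> \<Longrightarrow> hbound S h (forest_size a) (\<lambda>i. y i a)"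
  shows "hbound S h (forest_size \<zeta>) (\<lambda>i. proper_cuts \<zeta> (\<lambda>a b. x i a * y i b))"
  unfolding proper_cuts_def
proof (rule hbound_cuts)
  fix a b :: "'d forest"
  assume eq: "forest_size a + forest_size b = forest_size \<zeta>"
  show "hbound S h (forest_size \<zeta>) (\<lambda>i. if a = {#} \<or> b = {#} then 0 else x i a * y i b)"
  proof (cases "a = {#} \<or> b = {#}")
    case False
    then have "0 < forest_size a" "0 < forest_size b" by (metis forest_size_eq_0_iff gr0I)+
    then have "hbound S h (forest_size a + forest_size b) (\<lambda>i. x i a * y i b)"
      by (intro hbound_mult assms) (use eq in auto)
    with False eq show ?thesis by simp
  qed auto
qed

definition graded_bounded :: "enat \<Rightarrow> 'i set \<Rightarrow> ('i \<Rightarrow> real) \<Rightarrow> ('i \<Rightarrow> 'd series) \<Rightarrow> bool" where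
  "graded_bounded N S h x \<longleftrightarrow>
     (\<forall>\<zeta>. enat (forest_size \<zeta>) \<le> N \<longrightarrow> hbound S h (forest_size \<zeta>) (\<lambda>i. x i \<zeta>))"

lemma graded_boundedD:
  "graded_bounded N S h x \<Longrightarrow> enat (forest_size \<zeta>) \<le> N \<Longrightarrow> hbound S h (forest_size \<zeta>) (\<lambda>i. x i \<zeta>)"
  by (simp add: graded_bounded_def)

lemma enat_le_trans: "m \<le> n \<Longrightarrow> enat n \<le> N \<Longrightarrow> enat m \<le> N"
  by (metis enat_ord_simps(1) order_trans)

lemma graded_bounded_star:
  assumes "graded_bounded N S h x" "graded_bounded N S h y"
  shows "graded_bounded N S h (\<lambda>i. star (x i) (y i))"
  unfolding graded_bounded_def star_eq_cuts
proof (intro allI impI hbound_cuts)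
  fix \<zeta> a b :: "'b forest"
  assume \<zeta>: "enat (forest_size \<zeta>) \<le> N" and eq: "forest_size a + forest_size b = forest_size \<zeta>"
  have "hbound S h (forest_size a + forest_size b) (\<lambda>i. x i a * y i b)"
    by (intro hbound_mult graded_boundedD[OF assms(1)] graded_boundedD[OF assms(2)] enat_le_trans[OF _ \<zeta>])
      (use eq in auto)
  then show "hbound S h (forest_size \<zeta>) (\<lambda>i. x i a * y i b)" by (simp add: eq)
qed

text \<open>
  For \<open>\<zeta> \<noteq> \<one>\<close> the equation \<open>(x \<star> y) \<zeta> = 0\<close> expresses \<open>y \<zeta>\<close> by \<open>x \<zeta>\<close> and by values of \<open>x\<close> and
  \<open>y\<close> in lower degrees.
\<close>

lemma graded_bounded_inverse:
  fixes x y :: "'i \<Rightarrow> 'd series"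
  assumes "\<And>i. i \<in> S \<Longrightarrow> x i {#} = 1" "\<And>i. i \<in> S \<Longrightarrow> y i {#} = 1"
    and inv: "\<And>i. i \<in> S \<Longrightarrow> cutoff N (star (x i) (y i)) = unit_series"
    and x: "graded_bounded N S h x"
  shows "graded_bounded N S h y"
  unfolding graded_bounded_def
proof (intro allI impI)
  fix \<zeta> :: "'d forest"
  assume "enat (forest_size \<zeta>) \<le> N"
  then show "hbound S h (forest_size \<zeta>) (\<lambda>i. y i \<zeta>)"
  proof (induction "forest_size \<zeta>" arbitrary: \<zeta> rule: less_induct)
    case less
    show ?case
    proof (cases "\<zeta> = {#}")
      case True
      then show ?thesis using assms(2) by (intro hboundI[where C = 1]) simp
    next
      case False
      have "y i \<zeta> = - x i \<zeta> - proper_cuts \<zeta> (\<lambda>a b. x i a * y i b)" if i: "i \<in> S" for i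
        using fun_cong[OF inv[OF i], of \<zeta>] less.prems False assms(1,2)[OF i]
        by (simp add: cutoff_def star_split[OF False] unit_series_apply)
      moreover have "hbound S h (forest_size \<zeta>) (\<lambda>i. - x i \<zeta> - proper_cuts \<zeta> (\<lambda>a b. x i a * y i b))"
        by (intro hbound_diff hbound_uminus hbound_proper_cuts graded_boundedD[OF x] less.hyps less.prems)
          (use enat_le_trans[OF _ less.prems] in auto)
      ultimately show ?thesis by (simp cong: hbound_cong)
    qed
  qed
qed

lemma graded_bounded_truncated_character:
  assumes x: "\<And>i. i \<in> S \<Longrightarrow> truncated_character N (x i)"
    and trees: "\<And>\<tau>. enat (tree_size \<tau>) \<le> N \<Longrightarrow> hbound S h (tree_size \<tau>) (\<lambda>i. x i {#\<tau>#})"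
  shows "graded_bounded N S h x"
  unfolding graded_bounded_def
proof (intro allI impI)
  fix \<zeta> :: "'b forest"
  assume "enat (forest_size \<zeta>) \<le> N"
  then show "hbound S h (forest_size \<zeta>) (\<lambda>i. x i \<zeta>)"
  proof (induction \<zeta>)
    case empty
    show ?case using x by (intro hboundI[where C = 1]) (simp add: truncated_character_def)
  next
    case (add \<tau> \<zeta>)
    have "x i ({#\<tau>#} + \<zeta>) = x i {#\<tau>#} * x i \<zeta>" if "i \<in> S" for i
      using x[OF that] add.prems unfolding truncated_character_def by (auto simp del: union_mset_add_mset_left)
    then have "x i (add_mset \<tau> \<zeta>) = x i {#\<tau>#} * x i \<zeta>" if "i \<in> S" for i
      using that by simp
    moreover have "hbound S h (tree_size \<tau> + forest_size \<zeta>) (\<lambda>i. x i {#\<tau>#} * x i \<zeta>)"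
      by (intro hbound_mult trees add.IH enat_le_trans[OF _ add.prems]) simp_all
    ultimately show ?case
      using hbound_cong[of S "\<lambda>i. x i (add_mset \<tau> \<zeta>)" "\<lambda>i. x i {#\<tau>#} * x i \<zeta>"] by simp
  qed
qed

section \<open>The exponential of the Grossman-Larson product\<close>

definition star_power :: "'d series \<Rightarrow> nat \<Rightarrow> 'd series" where
  "star_power u k = (star u ^^ k) unit_series"

lemma star_power_0: "star_power u 0 = unit_series"
  and star_power_Suc: "star_power u (Suc k) = star u (star_power u k)"
  by (simp_all add: star_power_def)

text \<open>
  Dividing by the factorial here turns the binomial formula for primitive elements into a plain
  convolution.
\<close>

definition divided_power :: "'d series \<Rightarrow> nat \<Rightarrow> 'd series" where
  "divided_power u k \<zeta> = star_power u k \<zeta> / fact k"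

definition star_exp :: "'d series \<Rightarrow> 'd series" where
  "star_exp u \<zeta> = suminf (\<lambda>k. divided_power u k \<zeta>)"

text \<open>
  The infinitesimal characters: series supported on single trees.
\<close>

definition primitive :: "'d series \<Rightarrow> bool" where
  "primitive u \<longleftrightarrow> (\<forall>\<zeta>. size \<zeta> \<noteq> 1 \<longrightarrow> u \<zeta> = 0)"

lemma primitive_empty: "primitive u \<Longrightarrow> u {#} = 0"
  by (simp add: primitive_def)

lemma primitive_plus:
  assumes "primitive u"
  shows "u (\<zeta> + \<eta>) = u \<zeta> * unit_series \<eta> + unit_series \<zeta> * u \<eta>"
proof (cases "\<zeta> = {#} \<or> \<eta> = {#}")
  case True
  then show ?thesis using primitive_empty[OF assms] by (auto simp: unit_series_apply)
next
  case False
  then have "size \<zeta> \<noteq> 0" "size \<eta> \<noteq> 0" by simp_all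
  then have "size (\<zeta> + \<eta>) \<noteq> 1" unfolding size_union by linarith
  then have "u (\<zeta> + \<eta>) = 0" using assms unfolding primitive_def by blast
  then show ?thesis using False by (simp add: unit_series_apply)
qed

lemma star_power_eq_0:
  assumes u: "u {#} = 0"
  shows "forest_size \<zeta> < k \<Longrightarrow> star_power u k \<zeta> = 0"
proof (induction k arbitrary: \<zeta>)
  case (Suc k)
  have "star_power u (Suc k) \<zeta> = cuts \<zeta> (\<lambda>a b. 0)"
    unfolding star_power_Suc star_eq_cuts
  proof (rule cuts_cong)
    fix a b :: "'a forest"
    assume eq: "forest_size a + forest_size b = forest_size \<zeta>"
    show "u a * star_power u k b = 0"
    proof (cases "a = {#}")
      case False
      then have "0 < forest_size a" by (metis forest_size_eq_0_iff gr0I)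
      then have "star_power u k b = 0" using Suc.prems eq by (intro Suc.IH) simp
      then show ?thesis by simp
    qed (simp add: u)
  qed
  then show ?case by simp
qed simp

lemma divided_power_eq_0:
  "u {#} = 0 \<Longrightarrow> forest_size \<zeta> < k \<Longrightarrow> divided_power u k \<zeta> = 0"
  by (simp add: divided_power_def star_power_eq_0)

lemma star_exp_finite:
  assumes u: "u {#} = 0" and "forest_size \<zeta> \<le> n"
  shows "star_exp u \<zeta> = (\<Sum>k\<le>n. divided_power u k \<zeta>)"
  unfolding star_exp_def
  by (rule suminf_finite) (use assms in \<open>auto intro: divided_power_eq_0\<close>)

lemma summable_divided_power:
  assumes u: "u {#} = 0"
  shows "summable (\<lambda>k. \<bar>divided_power u k \<zeta>\<bar>)"
  by (rule summable_finite[of "{..forest_size \<zeta>}"]) (auto intro: divided_power_eq_0[of u, OF u])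

lemma divided_power_Suc: "real (Suc k) * divided_power u (Suc k) \<zeta> = star u (divided_power u k) \<zeta>"
proof -
  have "star u (divided_power u k) \<zeta> = star_power u (Suc k) \<zeta> / fact k"
    unfolding star_power_Suc star_eq_cuts divided_power_def
    using cuts_cmult_right[of \<zeta> "\<lambda>a b. u a * star_power u k b" "1 / fact k"] by simp
  then show ?thesis by (simp add: divided_power_def del: of_nat_Suc)
qed

text \<open>
  A primitive \<open>u\<close> is a derivation with respect to \<open>\<odot>\<close>, so multiplication by \<open>u\<close> obeys the Leibniz rule on
  products of forests, and the claim is the resulting binomial formula. It is proved from \<open>(k + 1) q\<^sub>k\<^sub>+\<^sub>1 = u \<star> q\<^sub>k\<close>; the two
  Leibniz terms contribute the weights \<open>j\<close> and \<open>k + 1 - j\<close>.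
\<close>

lemma divided_power_plus:
  assumes u: "primitive u"
  shows "divided_power u k (\<zeta> + \<eta>) = (\<Sum>j\<le>k. divided_power u j \<zeta> * divided_power u (k - j) \<eta>)"
proof (induction k arbitrary: \<zeta> \<eta>)
  case 0
  show ?case by (simp add: divided_power_def star_power_0 unit_series_apply)
next
  case (Suc k)
  let ?q = "divided_power u"
  let ?e = "unit_series :: 'a series"
  (* The j-th summand of the formula for q_k, after splitting u by the derivation property. *)
  have leibniz: "cuts \<zeta> (\<lambda>a b. cuts \<eta> (\<lambda>a' b'. (u a * ?e a' + ?e a * u a') * (?q j b * ?q l b')))
      = star u (?q j) \<zeta> * ?q l \<eta> + ?q j \<zeta> * star u (?q l) \<eta>" for j l
  proof -
    have "cuts \<zeta> (\<lambda>a b. cuts \<eta> (\<lambda>a' b'. (u a * ?e a' + ?e a * u a') * (?q j b * ?q l b'))) =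
      cuts \<zeta> (\<lambda>a b. cuts \<eta> (\<lambda>a' b'. (u a * ?q j b) * (?e a' * ?q l b') + (?e a * ?q j b) * (u a' * ?q l b')))"
      by (intro cuts_cong) (simp add: algebra_simps)
    also have "\<dots> = star u (?q j) \<zeta> * star ?e (?q l) \<eta> + star ?e (?q j) \<zeta> * star u (?q l) \<eta>"
      by (simp add: cuts_add cuts_cmult cuts_cmult_right star_eq_cuts)
    finally show ?thesis by (simp add: star_unit_left)
  qed
  have "real (Suc k) * ?q (Suc k) (\<zeta> + \<eta>) =
      cuts \<zeta> (\<lambda>a b. cuts \<eta> (\<lambda>a' b'. u (a + a') * ?q k (b + b')))"
    unfolding divided_power_Suc by (simp add: star_eq_cuts cuts_plus)
  also have "\<dots> = cuts \<zeta> (\<lambda>a b. cuts \<eta> (\<lambda>a' b'.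
      \<Sum>j\<le>k. (u a * ?e a' + ?e a * u a') * (?q j b * ?q (k - j) b')))"
    by (simp add: primitive_plus[OF u] Suc.IH sum_distrib_left)
  also have "\<dots> = (\<Sum>j\<le>k. star u (?q j) \<zeta> * ?q (k - j) \<eta> + ?q j \<zeta> * star u (?q (k - j)) \<eta>)"
    by (simp only: cuts_sum leibniz)
  also have "\<dots> = (\<Sum>j\<le>k. real (Suc j) * ?q (Suc j) \<zeta> * ?q (k - j) \<eta>)
      + (\<Sum>j\<le>k. ?q j \<zeta> * (real (Suc (k - j)) * ?q (Suc (k - j)) \<eta>))"
    by (simp only: divided_power_Suc sum.distrib)
  also have "(\<Sum>j\<le>k. real (Suc j) * ?q (Suc j) \<zeta> * ?q (k - j) \<eta>) =
      (\<Sum>j\<le>Suc k. real j * (?q j \<zeta> * ?q (Suc k - j) \<eta>))"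
    by (subst sum.atMost_Suc_shift) (simp add: mult.assoc)
  also have "(\<Sum>j\<le>k. ?q j \<zeta> * (real (Suc (k - j)) * ?q (Suc (k - j)) \<eta>)) =
      (\<Sum>j\<le>Suc k. real (Suc k - j) * (?q j \<zeta> * ?q (Suc k - j) \<eta>))"
    unfolding sum.atMost_Suc by (simp add: Suc_diff_le mult_ac)
  also have "(\<Sum>j\<le>Suc k. real j * (?q j \<zeta> * ?q (Suc k - j) \<eta>)) +
      (\<Sum>j\<le>Suc k. real (Suc k - j) * (?q j \<zeta> * ?q (Suc k - j) \<eta>)) =
      real (Suc k) * (\<Sum>j\<le>Suc k. ?q j \<zeta> * ?q (Suc k - j) \<eta>)"
    unfolding sum.distrib[symmetric] sum_distrib_left
    by (rule sum.cong) (auto simp: of_nat_diff algebra_simps)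
  finally have "real (Suc k) * ?q (Suc k) (\<zeta> + \<eta>) = real (Suc k) * (\<Sum>j\<le>Suc k. ?q j \<zeta> * ?q (Suc k - j) \<eta>)" .
  then show ?case by (simp only: mult_cancel_left of_nat_eq_0_iff) simp
qed

text \<open>
  The Cauchy product of the two exponential series, which have only finitely many nonzero terms at
  each forest.
\<close>

lemma character_star_exp:
  assumes u: "primitive u"
  shows "character (star_exp u)"
  unfolding character_def
proof (intro conjI allI)
  have u0: "u {#} = 0" by (rule primitive_empty[OF u])
  show "star_exp u {#} = 1"
    using star_exp_finite[of u, OF u0, of "{#}" 0]
    by (simp add: divided_power_def star_power_0 unit_series_apply)
  fix \<zeta> \<eta>
  show "star_exp u (\<zeta> + \<eta>) = star_exp u \<zeta> * star_exp u \<eta>"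
    unfolding star_exp_def divided_power_plus[OF u]
    by (rule Cauchy_product[symmetric]) (simp_all add: summable_divided_power[of u, OF u0])
qed

lemma star_power_cong:
  assumes "\<And>a. forest_size a \<le> forest_size \<zeta> \<Longrightarrow> u a = u' a"
  shows "star_power u k \<zeta> = star_power u' k \<zeta>"
  using assms
proof (induction k arbitrary: \<zeta>)
  case (Suc k)
  show ?case
    unfolding star_power_Suc
    by (rule star_cong) (auto intro!: Suc)
qed (simp add: star_power_0)

text \<open>
  From the second power on, only values of \<open>u\<close> in strictly lower degrees matter. This is what makes
  the exponential a triangular map.
\<close>

lemma star_power_cong_strict:
  assumes "u {#} = 0" "u' {#} = 0"
    and eq: "\<And>a. forest_size a < forest_size \<zeta> \<Longrightarrow> u a = u' a"
  shows "star_power u (Suc (Suc k)) \<zeta> = star_power u' (Suc (Suc k)) \<zeta>"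
proof (cases "\<zeta> = {#}")
  case True
  then show ?thesis using assms by (simp add: star_power_Suc)
next
  case False
  have "proper_cuts \<zeta> (\<lambda>a b. u a * star_power u (Suc k) b) =
    proper_cuts \<zeta> (\<lambda>a b. u' a * star_power u' (Suc k) b)"
  proof (rule proper_cuts_cong)
    fix a b :: "'a forest"
    assume "forest_size a < forest_size \<zeta>" "forest_size b < forest_size \<zeta>"
    then show "u a * star_power u (Suc k) b = u' a * star_power u' (Suc k) b"
      using star_power_cong[of b u u' "Suc k"] eq by simp
  qed
  then show ?thesis
    using assms by (simp add: star_power_Suc[of _ "Suc k"] star_split[OF False] star_power_eq_0)
qed

text \<open>
  The part of the exponential beyond the linear term. Powers above the degree vanish, so the range of
  summation is long enough.
\<close>

definition exp_remainder :: "'d series \<Rightarrow> 'd series" where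
  "exp_remainder u \<zeta> = (\<Sum>k<forest_size \<zeta>. divided_power u (Suc (Suc k)) \<zeta>)"

lemma star_exp_split:
  assumes u: "u {#} = 0" and "\<zeta> \<noteq> {#}"
  shows "star_exp u \<zeta> = u \<zeta> + exp_remainder u \<zeta>"
proof -
  have "star_exp u \<zeta> = (\<Sum>k\<le>Suc (forest_size \<zeta>). divided_power u k \<zeta>)"
    by (rule star_exp_finite[of u, OF u]) simp
  also have "\<dots> = divided_power u 0 \<zeta> + divided_power u (Suc 0) \<zeta> + exp_remainder u \<zeta>"
    unfolding sum.lessThan_Suc_shift lessThan_Suc_atMost[symmetric] exp_remainder_def by simp
  finally show ?thesis
    using assms by (simp add: divided_power_def star_power_0 star_power_Suc star_unit_right unit_series_apply)
qed

lemma exp_remainder_cong: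
  assumes "u {#} = 0" "u' {#} = 0"
    and "\<And>a. forest_size a < forest_size \<zeta> \<Longrightarrow> u a = u' a"
  shows "exp_remainder u \<zeta> = exp_remainder u' \<zeta>"
  unfolding exp_remainder_def divided_power_def
  using star_power_cong_strict[of u u' \<zeta>, OF assms] by simp

lemma star_exp_cong:
  assumes "\<And>a. forest_size a \<le> forest_size \<zeta> \<Longrightarrow> u a = u' a"
  shows "star_exp u \<zeta> = star_exp u' \<zeta>"
  unfolding star_exp_def divided_power_def using star_power_cong[of \<zeta> u u', OF assms] by simp

definition primitive_from_trees :: "('d rtree \<Rightarrow> real) \<Rightarrow> 'd series" where
  "primitive_from_trees f \<zeta> = (if size \<zeta> = 1 then from_trees f \<zeta> else 0)"

lemma primitive_primitive_from_trees: "primitive (primitive_from_trees f)"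
  by (simp add: primitive_def primitive_from_trees_def)

text \<open>
  Since \<open>exp u = u +\<close> a remainder that depends on lower degrees, the logarithm is found by recursion
  over trees. The exponential is then a character that agrees with \<open>g\<close> on trees, hence everywhere.
\<close>

lemma star_exp_surj:
  fixes g :: "'d series"
  assumes g: "character g"
  obtains u where "primitive u" "star_exp u = g"
proof -
  define \<Phi> where "\<Phi> f \<tau> = g {#\<tau>#} - exp_remainder (primitive_from_trees f) {#\<tau>#}" for f \<tau>
  have "\<exists>f. \<forall>\<tau>. f \<tau> = \<Phi> f \<tau>"
  proof (rule tree_recursion)
    fix f f' :: "'d rtree \<Rightarrow> real" and \<tau> :: "'d rtree"
    assume eq: "\<And>\<sigma>. tree_size \<sigma> < tree_size \<tau> \<Longrightarrow> f \<sigma> = f' \<sigma>"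
    have "exp_remainder (primitive_from_trees f) {#\<tau>#} = exp_remainder (primitive_from_trees f') {#\<tau>#}"
    proof (rule exp_remainder_cong)
      fix a :: "'d forest"
      assume "forest_size a < forest_size {#\<tau>#}"
      then have "from_trees f a = from_trees f' a"
        by (intro from_trees_cong) (simp add: eq)
      then show "primitive_from_trees f a = primitive_from_trees f' a"
        by (simp add: primitive_from_trees_def)
    qed (simp_all add: primitive_from_trees_def)
    then show "\<Phi> f \<tau> = \<Phi> f' \<tau>" by (simp add: \<Phi>_def)
  qed
  then obtain f where f: "\<And>\<tau>. f \<tau> = \<Phi> f \<tau>" by blast
  let ?u = "primitive_from_trees f"
  have u: "primitive ?u" by (rule primitive_primitive_from_trees)
  have on_trees: "star_exp ?u {#\<tau>#} = g {#\<tau>#}" for \<tau>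
    using f[of \<tau>] by (simp add: star_exp_split[of ?u, OF primitive_empty[OF u]] \<Phi>_def primitive_from_trees_def)
  have "star_exp ?u \<zeta> = g \<zeta>" for \<zeta>
    by (rule character_eqI[OF character_star_exp[OF u] g]) (simp add: on_trees)
  then have "star_exp ?u = g" ..
  with u show thesis by (rule that)
qed

section \<open>Logarithms and the homogeneous norm\<close>

lemma funpow_star_trunc: "(star_trunc n u ^^ k) unit_series = cutoff (enat n) (star_power u k)"
proof (induction k)
  case 0
  show ?case by (simp add: star_power_0)
next
  case (Suc k)
  have "(star_trunc n u ^^ Suc k) unit_series = star_trunc n u (cutoff (enat n) (star_power u k))"
    by (simp add: Suc)
  also have "\<dots> = cutoff (enat n) (star_power u (Suc k))"
    unfolding star_trunc_def cutoff_enat[symmetric] star_power_Suc by (rule cutoff_star_cong) simp_all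
  finally show ?case .
qed

lemma exp_trunc_eq: "exp_trunc n u = cutoff (enat n) (star_exp u)"
proof
  fix \<zeta>
  show "exp_trunc n u \<zeta> = cutoff (enat n) (star_exp u) \<zeta>"
    by (simp add: exp_trunc_def funpow_star_trunc cutoff_def star_exp_def divided_power_def)
qed

lemma tree_space_iff:
  fixes u :: "('d::finite) series"
  shows "u \<in> tree_space n \<longleftrightarrow> primitive u \<and> cutoff (enat n) u = u"
proof
  assume "u \<in> tree_space n"
  then have supp: "{\<zeta>. u \<zeta> \<noteq> 0} \<subseteq> (\<lambda>\<tau>. {#\<tau>#}) ` trees_upto n"
    by (simp add: tree_space_def free_space_def)
  have "u \<zeta> = 0" if "size \<zeta> \<noteq> 1 \<or> \<not> forest_size \<zeta> \<le> n" for \<zeta>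
  proof (rule ccontr)
    assume "u \<zeta> \<noteq> 0"
    with supp obtain \<tau> where "\<zeta> = {#\<tau>#}" "tree_size \<tau> \<le> n" by (auto simp: trees_upto_def)
    with that show False by auto
  qed
  then show "primitive u \<and> cutoff (enat n) u = u"
    unfolding primitive_def cutoff_def fun_eq_iff by auto
next
  assume u: "primitive u \<and> cutoff (enat n) u = u"
  have supp: "{\<zeta>. u \<zeta> \<noteq> 0} \<subseteq> (\<lambda>\<tau>. {#\<tau>#}) ` trees_upto n"
  proof
    fix \<zeta>
    assume "\<zeta> \<in> {\<zeta>. u \<zeta> \<noteq> 0}"
    then have nz: "u \<zeta> \<noteq> 0" by simp
    then have "size \<zeta> = 1" using u unfolding primitive_def by blast
    then obtain \<tau> where \<tau>: "\<zeta> = {#\<tau>#}" using size_1_singleton_mset by blast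
    have "cutoff (enat n) u \<zeta> = u \<zeta>" using u by simp
    with nz have "forest_size \<zeta> \<le> n" by (auto simp: cutoff_def split: if_splits)
    with \<tau> show "\<zeta> \<in> (\<lambda>\<tau>. {#\<tau>#}) ` trees_upto n" by (auto simp: trees_upto_def)
  qed
  moreover have "finite ((\<lambda>\<tau>. {#\<tau>#}) ` (trees_upto n :: 'd rtree set))"
    using finite_trees_forests by blast
  ultimately show "u \<in> tree_space n"
    unfolding tree_space_def free_space_def using finite_subset by blast
qed

text \<open>
  The same triangularity: where the exponentials agree and \<open>u\<close>, \<open>u'\<close> agree in lower degrees, the
  remainders agree and so do the linear terms.
\<close>

lemma exp_trunc_inj:
  fixes u u' :: "('d::finite) series"
  assumes u: "u \<in> tree_space n" and u': "u' \<in> tree_space n" and eq: "exp_trunc n u = exp_trunc n u'"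
  shows "u = u'"
proof
  fix \<zeta> :: "'d forest"
  have prim: "primitive u" "primitive u'" and cut: "cutoff (enat n) u = u" "cutoff (enat n) u' = u'"
    using u u' by (simp_all add: tree_space_iff)
  show "u \<zeta> = u' \<zeta>"
  proof (induction "forest_size \<zeta>" arbitrary: \<zeta> rule: less_induct)
    case less
    show ?case
    proof (cases "\<zeta> = {#} \<or> \<not> forest_size \<zeta> \<le> n")
      case True
      then show ?thesis
        using fun_cong[OF cut(1), of \<zeta>] fun_cong[OF cut(2), of \<zeta>]
        by (auto simp: primitive_empty[OF prim(1)] primitive_empty[OF prim(2)] cutoff_def)
    next
      case False
      have "star_exp u \<zeta> = star_exp u' \<zeta>"
        using fun_cong[OF eq, of \<zeta>] False by (simp add: exp_trunc_eq cutoff_def)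
      moreover have "exp_remainder u \<zeta> = exp_remainder u' \<zeta>"
        by (rule exp_remainder_cong) (simp_all add: less primitive_empty[of u] primitive_empty[of u'] prim)
      ultimately show ?thesis
        using False by (simp add: star_exp_split[of u] star_exp_split[of u'] primitive_empty[of u] primitive_empty[of u'] prim)
    qed
  qed
qed

lemma log_trunc:
  fixes g :: "('d::finite) series"
  assumes "g \<in> carrier (GL (enat n))"
  shows "log_trunc n g \<in> tree_space n" "exp_trunc n (log_trunc n g) = g"
proof -
  obtain G where G: "character G" "g = cutoff (enat n) G"
    using assms by (rule carrier_GL_cutoffE)
  obtain U where U: "primitive U" "star_exp U = G"
    using star_exp_surj[OF G(1)] .
  let ?u = "cutoff (enat n) U"
  have "?u \<in> tree_space n"
    using U(1) by (auto simp: tree_space_iff primitive_def cutoff_def)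
  moreover have "exp_trunc n ?u = g"
    unfolding exp_trunc_eq G(2) cutoff_eq_iff U(2)[symmetric]
  proof (intro allI impI)
    fix \<zeta> :: "'d forest"
    assume "enat (forest_size \<zeta>) \<le> enat n"
    then show "star_exp ?u \<zeta> = star_exp U \<zeta>"
      by (intro star_exp_cong) (simp add: cutoff_def)
  qed
  ultimately have "\<exists>!u. u \<in> tree_space n \<and> exp_trunc n u = g"
    using exp_trunc_inj by blast
  then have "log_trunc n g \<in> tree_space n \<and> exp_trunc n (log_trunc n g) = g"
    unfolding log_trunc_def by (rule theI')
  then show "log_trunc n g \<in> tree_space n" "exp_trunc n (log_trunc n g) = g" by simp_all
qed

lemma graded_bounded_star_power:
  assumes "graded_bounded N S h u"
  shows "graded_bounded N S h (\<lambda>i. star_power (u i) k)"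
proof (induction k)
  case 0
  have "hbound S h (forest_size \<zeta>) (\<lambda>i. unit_series \<zeta>)" for \<zeta> :: "'b forest"
    by (cases "\<zeta> = {#}") (auto simp: unit_series_apply intro: hboundI[where C = 1])
  then show ?case by (simp add: star_power_0 graded_bounded_def)
next
  case (Suc k)
  then show ?case unfolding star_power_Suc by (intro graded_bounded_star assms)
qed

text \<open>
  Powers are graded bounded if \<open>u\<close> is, which settles one direction. In the other, the remainder at
  \<open>\<zeta>\<close> is bounded by induction over the degree, and it is the difference between \<open>g \<zeta>\<close> and \<open>u \<zeta>\<close>.
\<close>

lemma graded_bounded_exp_iff:
  assumes u: "\<And>i. i \<in> S \<Longrightarrow> u i {#} = 0"
    and g: "\<And>i. i \<in> S \<Longrightarrow> g i = cutoff (enat n) (star_exp (u i))"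
  shows "graded_bounded (enat n) S h g \<longleftrightarrow> graded_bounded (enat n) S h u"
proof
  assume bd: "graded_bounded (enat n) S h u"
  show "graded_bounded (enat n) S h g"
    unfolding graded_bounded_def
  proof (intro allI impI)
    fix \<zeta> :: "'b forest"
    assume \<zeta>: "enat (forest_size \<zeta>) \<le> enat n"
    have "hbound S h (forest_size \<zeta>) (\<lambda>i. \<Sum>k\<le>n. 1 / fact k * star_power (u i) k \<zeta>)"
      by (intro hbound_sum hbound_cmult graded_boundedD[OF graded_bounded_star_power[OF bd] \<zeta>])
    moreover have "g i \<zeta> = (\<Sum>k\<le>n. 1 / fact k * star_power (u i) k \<zeta>)" if "i \<in> S" for i
      using star_exp_finite[of "u i" \<zeta> n, OF u[OF that]] \<zeta>
      by (simp add: g[OF that] cutoff_def divided_power_def)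
    ultimately show "hbound S h (forest_size \<zeta>) (\<lambda>i. g i \<zeta>)"
      using hbound_cong[of S "\<lambda>i. g i \<zeta>"] by simp
  qed
next
  assume bd: "graded_bounded (enat n) S h g"
  have "hbound S h (forest_size \<zeta>) (\<lambda>i. u i \<zeta>)" if "forest_size \<zeta> \<le> n" for \<zeta>
    using that
  proof (induction "forest_size \<zeta>" arbitrary: \<zeta> rule: less_induct)
    case less
    show ?case
    proof (cases "\<zeta> = {#}")
      case True
      then show ?thesis using u by (intro hboundI[where C = 0]) simp
    next
      case False
      have power: "hbound S h (forest_size a) (\<lambda>i. star_power (u i) k a)" if "forest_size a < forest_size \<zeta>" for a k
      proof -
        have "graded_bounded (enat (forest_size a)) S h u"
          unfolding graded_bounded_def using less that by simp
        then show ?thesis by (rule graded_boundedD[OF graded_bounded_star_power]) simp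
      qed
      have "hbound S h (forest_size \<zeta>)
        (\<lambda>i. proper_cuts \<zeta> (\<lambda>a b. u i a * star_power (u i) (Suc k) b))" for k
        by (intro hbound_proper_cuts power less.hyps) (use less.prems in auto)
      then have "hbound S h (forest_size \<zeta>) (\<lambda>i. \<Sum>k<forest_size \<zeta>.
          1 / fact (Suc (Suc k)) * proper_cuts \<zeta> (\<lambda>a b. u i a * star_power (u i) (Suc k) b))"
        by (intro hbound_sum hbound_cmult)
      then have "hbound S h (forest_size \<zeta>) (\<lambda>i. g i \<zeta> - (\<Sum>k<forest_size \<zeta>.
          1 / fact (Suc (Suc k)) * proper_cuts \<zeta> (\<lambda>a b. u i a * star_power (u i) (Suc k) b)))"
        by (intro hbound_diff graded_boundedD[OF bd]) (use less.prems in simp)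
      moreover have "u i \<zeta> = g i \<zeta> - (\<Sum>k<forest_size \<zeta>.
          1 / fact (Suc (Suc k)) * proper_cuts \<zeta> (\<lambda>a b. u i a * star_power (u i) (Suc k) b))"
        if i: "i \<in> S" for i
      proof -
        have "star_power (u i) (Suc (Suc k)) \<zeta> =
            proper_cuts \<zeta> (\<lambda>a b. u i a * star_power (u i) (Suc k) b)" for k
          using u[OF i] by (simp add: star_power_Suc[of _ "Suc k"] star_split[OF False] star_power_eq_0)
        then have "exp_remainder (u i) \<zeta> = (\<Sum>k<forest_size \<zeta>.
          1 / fact (Suc (Suc k)) * proper_cuts \<zeta> (\<lambda>a b. u i a * star_power (u i) (Suc k) b))"
          by (simp add: exp_remainder_def divided_power_def del: fact_Suc)
        moreover have "g i \<zeta> = u i \<zeta> + exp_remainder (u i) \<zeta>"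
          using star_exp_split[of "u i" \<zeta>, OF u[OF i] False] less.prems by (simp add: g[OF i] cutoff_def)
        ultimately show ?thesis by simp
      qed
      ultimately show ?thesis using hbound_cong[of S "\<lambda>i. u i \<zeta>"] by simp
    qed
  qed
  then show "graded_bounded (enat n) S h u" by (simp add: graded_bounded_def)
qed

lemma powr_power_nonneg:
  assumes "0 \<le> x" "0 < k"
  shows "(x powr \<gamma>) ^ k = x powr (\<gamma> * real k)"
proof (cases "x = 0")
  case False
  then show ?thesis using assms by (simp add: powr_powr flip: powr_realpow)
qed (use assms in simp)

lemma hbound_root_iff:
  assumes h: "\<And>i. i \<in> S \<Longrightarrow> 0 < h i" and k: "0 < k"
  shows "hbound S h k f \<longleftrightarrow> (\<exists>M. \<forall>i\<in>S. \<bar>f i\<bar> powr (1 / real k) / h i \<le> M)"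
proof
  assume "hbound S h k f"
  then obtain C where C: "\<And>i. i \<in> S \<Longrightarrow> \<bar>f i\<bar> \<le> C * h i ^ k" by (auto simp: hbound_def)
  have "\<bar>f i\<bar> powr (1 / real k) / h i \<le> \<bar>C\<bar> powr (1 / real k)" if i: "i \<in> S" for i
  proof -
    have "\<bar>f i\<bar> \<le> \<bar>C\<bar> * h i ^ k"
      using C[OF i] h[OF i] by (meson abs_ge_self less_imp_le mult_right_mono order_trans zero_le_power)
    then have "\<bar>f i\<bar> powr (1 / real k) \<le> (\<bar>C\<bar> * h i ^ k) powr (1 / real k)"
      by (intro powr_mono2) simp_all
    also have "\<dots> = \<bar>C\<bar> powr (1 / real k) * h i"
      using h[OF i] k by (simp add: powr_mult powr_powr flip: powr_realpow)
    finally show ?thesis using h[OF i] by (simp add: pos_divide_le_eq)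
  qed
  then show "\<exists>M. \<forall>i\<in>S. \<bar>f i\<bar> powr (1 / real k) / h i \<le> M" by blast
next
  assume "\<exists>M. \<forall>i\<in>S. \<bar>f i\<bar> powr (1 / real k) / h i \<le> M"
  then obtain M where M: "\<And>i. i \<in> S \<Longrightarrow> \<bar>f i\<bar> powr (1 / real k) / h i \<le> M" by blast
  show "hbound S h k f"
  proof (rule hboundI)
    fix i assume i: "i \<in> S"
    have "\<bar>f i\<bar> powr (1 / real k) \<le> M * h i"
      using M[OF i] h[OF i] by (simp add: pos_divide_le_eq)
    then have "(\<bar>f i\<bar> powr (1 / real k)) ^ k \<le> (M * h i) ^ k"
      by (rule power_mono) simp
    then show "\<bar>f i\<bar> \<le> M ^ k * h i ^ k"
      using k by (simp add: powr_power_nonneg power_mult_distrib)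
  qed
qed

text \<open>
  The summand of the homogeneous norm at \<open>\<tau>\<close> is at most \<open>M h\<close> exactly if the logarithm at \<open>\<tau>\<close> is in absolute value at most
  \<open>M ^ \<bar>\<tau>\<bar> h ^ \<bar>\<tau>\<bar>\<close>, so boundedness of the norm relative to \<open>h\<close> is graded boundedness of the
  logarithm.
\<close>

lemma hom_norm_bounded_iff:
  fixes g :: "'i \<Rightarrow> ('d::finite) series"
  assumes g: "\<And>i. i \<in> S \<Longrightarrow> g i \<in> carrier (GL (enat n))" and h: "\<And>i. i \<in> S \<Longrightarrow> 0 < h i"
  shows "bdd_above ((\<lambda>i. hom_norm n (g i) / h i) ` S) \<longleftrightarrow> graded_bounded (enat n) S h g"
proof -
  define u where "u i = log_trunc n (g i)" for i
  have u: "primitive (u i)" "g i = cutoff (enat n) (star_exp (u i))" if "i \<in> S" for i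
    using log_trunc[OF g[OF that]] by (simp_all add: u_def tree_space_iff exp_trunc_eq)
  let ?r = "\<lambda>\<tau> i. \<bar>u i {#\<tau>#}\<bar> powr (1 / real (tree_size \<tau>)) / h i"
  have fin: "finite (trees_upto n :: 'd rtree set)" using finite_trees_forests by blast
  have "bdd_above ((\<lambda>i. hom_norm n (g i) / h i) ` S) \<longleftrightarrow> (\<exists>M. \<forall>i\<in>S. (\<Sum>\<tau>\<in>trees_upto n. ?r \<tau> i) \<le> M)"
    by (auto simp: bdd_above_def hom_norm_def u_def sum_divide_distrib)
  also have "\<dots> \<longleftrightarrow> (\<forall>\<tau>\<in>trees_upto n. \<exists>M. \<forall>i\<in>S. ?r \<tau> i \<le> M)"
  proof
    assume "\<exists>M. \<forall>i\<in>S. (\<Sum>\<tau>\<in>trees_upto n. ?r \<tau> i) \<le> M"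
    then obtain M where M: "\<And>i. i \<in> S \<Longrightarrow> (\<Sum>\<tau>\<in>trees_upto n. ?r \<tau> i) \<le> M" by blast
    have "?r \<tau> i \<le> M" if "\<tau> \<in> trees_upto n" "i \<in> S" for \<tau> i
    proof -
      have "?r \<tau> i \<le> (\<Sum>\<tau>\<in>trees_upto n. ?r \<tau> i)"
        by (rule member_le_sum[OF that(1)]) (use h[OF that(2)] fin in auto)
      then show ?thesis using M[OF that(2)] by linarith
    qed
    then show "\<forall>\<tau>\<in>trees_upto n. \<exists>M. \<forall>i\<in>S. ?r \<tau> i \<le> M" by blast
  next
    assume "\<forall>\<tau>\<in>trees_upto n. \<exists>M. \<forall>i\<in>S. ?r \<tau> i \<le> M"
    then obtain M where "\<And>\<tau> i. \<tau> \<in> trees_upto n \<Longrightarrow> i \<in> S \<Longrightarrow> ?r \<tau> i \<le> M \<tau>" by metis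
    then have "\<forall>i\<in>S. (\<Sum>\<tau>\<in>trees_upto n. ?r \<tau> i) \<le> (\<Sum>\<tau>\<in>trees_upto n. M \<tau>)"
      by (intro ballI sum_mono)
    then show "\<exists>M. \<forall>i\<in>S. (\<Sum>\<tau>\<in>trees_upto n. ?r \<tau> i) \<le> M" ..
  qed
  also have "\<dots> \<longleftrightarrow> (\<forall>\<tau>\<in>trees_upto n. hbound S h (tree_size \<tau>) (\<lambda>i. u i {#\<tau>#}))"
    using hbound_root_iff[of S h, OF h] by (simp del: times_divide_eq_left)
  also have "\<dots> \<longleftrightarrow> graded_bounded (enat n) S h u"
  proof
    assume trees: "\<forall>\<tau>\<in>trees_upto n. hbound S h (tree_size \<tau>) (\<lambda>i. u i {#\<tau>#})"
    show "graded_bounded (enat n) S h u"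
      unfolding graded_bounded_def
    proof (intro allI impI)
      fix \<zeta> :: "'d forest"
      assume \<zeta>: "enat (forest_size \<zeta>) \<le> enat n"
      show "hbound S h (forest_size \<zeta>) (\<lambda>i. u i \<zeta>)"
      proof (cases "size \<zeta> = 1")
        case True
        then obtain \<tau> where "\<zeta> = {#\<tau>#}" using size_1_singleton_mset by blast
        with trees \<zeta> show ?thesis by (simp add: trees_upto_def)
      next
        case False
        then show ?thesis using u(1) unfolding primitive_def by (intro hboundI[where C = 0]) auto
      qed
    qed
  next
    assume bd: "graded_bounded (enat n) S h u"
    show "\<forall>\<tau>\<in>trees_upto n. hbound S h (tree_size \<tau>) (\<lambda>i. u i {#\<tau>#})"
    proof
      fix \<tau> :: "'d rtree"
      assume "\<tau> \<in> trees_upto n"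
      then show "hbound S h (tree_size \<tau>) (\<lambda>i. u i {#\<tau>#})"
        using graded_boundedD[OF bd, of "{#\<tau>#}"] by (simp add: trees_upto_def)
    qed
  qed
  also have "\<dots> \<longleftrightarrow> graded_bounded (enat n) S h g"
    by (rule graded_bounded_exp_iff[symmetric]) (use u primitive_empty in auto)
  finally show ?thesis .
qed

section \<open>A sewing lemma without continuity\<close>

text \<open>
  Halving the interval improves the constant by the factor \<open>2 powr (1 - \<theta>) < 1\<close>, and this can be
  repeated indefinitely.
\<close>

lemma additive_small_constant:
  fixes D :: "real \<Rightarrow> real"
  assumes \<theta>: "1 < \<theta>" and D: "\<And>s t. 0 \<le> s \<Longrightarrow> s \<le> t \<Longrightarrow> t \<le> T \<Longrightarrow> \<bar>D t - D s\<bar> \<le> C * (t - s) powr \<theta>"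
    and t: "0 \<le> t" "t \<le> T"
  shows "D t = D 0"
proof -
  define q where "q = (2::real) powr (1 - \<theta>)"
  have q: "0 \<le> q" "q < 1"
    using \<theta> by (simp_all add: q_def powr_less_one)
  have half: "2 * (x / 2) powr \<theta> = q * x powr \<theta>" if "0 \<le> x" for x :: real
    using that by (simp add: q_def powr_divide powr_diff)
  have iterate: "\<bar>D t - D s\<bar> \<le> q ^ k * (C * (t - s) powr \<theta>)" if "0 \<le> s" "s \<le> t" "t \<le> T" for s t k
    using that
  proof (induction k arbitrary: s t)
    case 0
    then show ?case using D by simp
  next
    case (Suc k)
    define m where "m = (s + t) / 2"
    have m: "s \<le> m" "m \<le> t" "m - s = (t - s) / 2" "t - m = (t - s) / 2"
      using Suc.prems by (simp_all add: m_def field_simps)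
    have "\<bar>D t - D s\<bar> \<le> \<bar>D m - D s\<bar> + \<bar>D t - D m\<bar>" by simp
    also have "\<dots> \<le> q ^ k * (C * (m - s) powr \<theta>) + q ^ k * (C * (t - m) powr \<theta>)"
      by (intro add_mono Suc.IH) (use Suc.prems m in auto)
    also have "\<dots> = q ^ k * C * (2 * ((t - s) / 2) powr \<theta>)"
      unfolding m(3,4) by (simp add: algebra_simps)
    also have "\<dots> = q ^ Suc k * (C * (t - s) powr \<theta>)"
      using half[of "t - s"] Suc.prems by simp
    finally show ?case .
  qed
  have "(\<lambda>k. q ^ k * (C * (t - 0) powr \<theta>)) \<longlonglongrightarrow> 0 * (C * (t - 0) powr \<theta>)"
    using q by (intro tendsto_mult LIMSEQ_power_zero tendsto_const) simp
  then have "\<bar>D t - D 0\<bar> \<le> 0 * (C * (t - 0) powr \<theta>)"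
    by (rule LIMSEQ_le_const) (use iterate[of 0 t] t in auto)
  then show ?thesis by simp
qed

text \<open>
  The sum along a partition of \<open>[p a, p b]\<close> is compared with the value on the whole interval by
  induction over the number of points. Let \<open>[p j, p (j + 1)]\<close> be the cell that contains the midpoint.
  Splitting off this cell costs two defects, and the remaining two pieces have at most half the
  length. So a constant \<open>K\<close> works if \<open>2 C + 2 powr (1 - \<theta>) K = K\<close>.
\<close>

lemma chain_bound:
  fixes A :: "real \<Rightarrow> real \<Rightarrow> real" and p :: "nat \<Rightarrow> real"
  assumes \<theta>: "1 < \<theta>"
    and defect: "\<And>s u t. 0 \<le> s \<Longrightarrow> s \<le> u \<Longrightarrow> u \<le> t \<Longrightarrow> t \<le> T \<Longrightarrow>
      \<bar>A s t - A s u - A u t\<bar> \<le> C * (t - s) powr \<theta>"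
    and "a \<le> b"
    and p: "\<And>i j. a \<le> i \<Longrightarrow> i \<le> j \<Longrightarrow> j \<le> b \<Longrightarrow> p i \<le> p j"
    and "0 \<le> p a" "p b \<le> T" and C: "0 \<le> C"
  shows "\<bar>A (p a) (p b) - (\<Sum>i=a..<b. A (p i) (p (Suc i)))\<bar>
    \<le> 2 * C / (1 - 2 powr (1 - \<theta>)) * (p b - p a) powr \<theta>"
  using assms(3-6)
proof (induction "b - a" arbitrary: a b rule: less_induct)
  case less
  define q where "q = (2::real) powr (1 - \<theta>)"
  define K where "K = 2 * C / (1 - q)"
  have q: "0 \<le> q" "q < 1"
    using \<theta> by (simp_all add: q_def powr_less_one)
  have K: "0 \<le> K" "K = 2 * C + q * K"
    using q C by (simp_all add: K_def field_simps)
  show ?case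
  proof (cases "a = b")
    case True
    then have "\<bar>A (p a) (p a) - A (p a) (p a) - A (p a) (p a)\<bar> \<le> C * (p a - p a) powr \<theta>"
      by (intro defect) (use less.prems in auto)
    with True show ?thesis by simp
  next
    case False
    define m where "m = (p a + p b) / 2"
    (* The cell containing the midpoint starts at the last point of the chain not beyond it. *)
    define J where "J = {j. a \<le> j \<and> j < b \<and> p j \<le> m}"
    have ab: "p a \<le> p b" using less.prems by simp
    have "finite J" "a \<in> J"
      using less.prems False ab by (auto simp: J_def m_def field_simps)
    define j where "j = Max J"
    have "j \<in> J" unfolding j_def using \<open>finite J\<close> \<open>a \<in> J\<close> by (intro Max_in) auto
    then have j: "a \<le> j" "j < b" "p j \<le> m" by (auto simp: J_def)
    have Sj: "m \<le> p (Suc j)"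
    proof (cases "Suc j < b")
      case True
      have "Suc j \<notin> J" using Max_ge[OF \<open>finite J\<close>, of "Suc j"] unfolding j_def by auto
      then show ?thesis using True j by (auto simp: J_def)
    next
      case False
      then have "Suc j = b" using j by simp
      then show ?thesis using ab by (simp add: m_def)
    qed
    have ord: "p a \<le> p j" "p j \<le> p (Suc j)" "p (Suc j) \<le> p b"
      using less.prems(2) j by auto
    then have rng: "p j \<le> T" "p (Suc j) \<le> T" "0 \<le> p j" "0 \<le> p (Suc j)"
      using less.prems(3,4) by linarith+
    define L where "L = p b - p a"
    have half: "(L / 2) powr \<theta> = q / 2 * L powr \<theta>"
      using ab by (simp add: q_def L_def powr_divide powr_diff)
    have d1: "\<bar>A (p a) (p b) - A (p a) (p j) - A (p j) (p b)\<bar> \<le> C * L powr \<theta>"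
      unfolding L_def by (rule defect) (use less.prems ord rng in auto)
    have "\<bar>A (p j) (p b) - A (p j) (p (Suc j)) - A (p (Suc j)) (p b)\<bar> \<le> C * (p b - p j) powr \<theta>"
      by (rule defect) (use less.prems ord rng in auto)
    also have "\<dots> \<le> C * L powr \<theta>"
      unfolding L_def by (intro mult_left_mono powr_mono2) (use ord \<theta> C in auto)
    finally have d2: "\<bar>A (p j) (p b) - A (p j) (p (Suc j)) - A (p (Suc j)) (p b)\<bar> \<le> C * L powr \<theta>" .
    have "\<bar>A (p a) (p j) - (\<Sum>i=a..<j. A (p i) (p (Suc i)))\<bar> \<le> K * (p j - p a) powr \<theta>"
      unfolding K_def q_def by (rule less.hyps) (use less.prems ord rng j in auto)
    also have "\<dots> \<le> K * (L / 2) powr \<theta>"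
      by (intro mult_left_mono powr_mono2) (use ord j \<theta> K in \<open>auto simp: L_def m_def\<close>)
    finally have d3: "\<bar>A (p a) (p j) - (\<Sum>i=a..<j. A (p i) (p (Suc i)))\<bar> \<le> K * (L / 2) powr \<theta>" .
    have "\<bar>A (p (Suc j)) (p b) - (\<Sum>i=Suc j..<b. A (p i) (p (Suc i)))\<bar> \<le> K * (p b - p (Suc j)) powr \<theta>"
      unfolding K_def q_def by (rule less.hyps) (use less.prems ord rng j in auto)
    also have "\<dots> \<le> K * (L / 2) powr \<theta>"
      by (intro mult_left_mono powr_mono2) (use ord Sj \<theta> K in \<open>auto simp: L_def m_def\<close>)
    finally have d4: "\<bar>A (p (Suc j)) (p b) - (\<Sum>i=Suc j..<b. A (p i) (p (Suc i)))\<bar> \<le> K * (L / 2) powr \<theta>" .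
    have "(\<Sum>i=a..<b. A (p i) (p (Suc i))) =
        (\<Sum>i=a..<j. A (p i) (p (Suc i))) + A (p j) (p (Suc j)) + (\<Sum>i=Suc j..<b. A (p i) (p (Suc i)))"
      using j sum.atLeastLessThan_concat[of a j b "\<lambda>i. A (p i) (p (Suc i))"]
      by (simp add: sum.atLeast_Suc_lessThan)
    with d1 d2 d3 d4 have "\<bar>A (p a) (p b) - (\<Sum>i=a..<b. A (p i) (p (Suc i)))\<bar>
        \<le> 2 * (C * L powr \<theta>) + 2 * (K * (L / 2) powr \<theta>)"
      by linarith
    also have "\<dots> = (2 * C + q * K) * L powr \<theta>"
      by (simp add: half algebra_simps)
    also have "\<dots> = K * L powr \<theta>" using K by simp
    finally show ?thesis by (simp add: K_def q_def L_def)
  qed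
qed

text \<open>
  On finitely many points, summing along consecutive points gives an exactly additive function. The
  constant does not depend on the points.
\<close>

lemma sewing_finite:
  fixes A :: "real \<Rightarrow> real \<Rightarrow> real" and P :: "real set"
  assumes \<theta>: "1 < \<theta>"
    and defect: "\<And>s u t. 0 \<le> s \<Longrightarrow> s \<le> u \<Longrightarrow> u \<le> t \<Longrightarrow> t \<le> T \<Longrightarrow>
      \<bar>A s t - A s u - A u t\<bar> \<le> C * (t - s) powr \<theta>"
    and C: "0 \<le> C" and P: "finite P" "P \<subseteq> {0..T}"
  shows "\<exists>f. \<forall>s\<in>P. \<forall>t\<in>P. s \<le> t \<longrightarrow>
    \<bar>A s t - (f t - f s)\<bar> \<le> 2 * C / (1 - 2 powr (1 - \<theta>)) * (t - s) powr \<theta>"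
proof -
  define xs where "xs = sorted_list_of_set P"
  have xs: "sorted xs" "distinct xs" "set xs = P"
    using P by (simp_all add: xs_def)
  define idx where "idx x = (SOME i. i < length xs \<and> xs ! i = x)" for x
  have idx: "idx x < length xs" "xs ! idx x = x" if "x \<in> P" for x
    using someI_ex[of "\<lambda>i. i < length xs \<and> xs ! i = x"] that xs(3)
    unfolding idx_def by (auto simp: in_set_conv_nth)
  define f where "f x = (\<Sum>i=0..<idx x. A (xs ! i) (xs ! Suc i))" for x
  show ?thesis
  proof (intro exI[of _ f] ballI impI)
    fix s t
    assume st: "s \<in> P" "t \<in> P" "s \<le> t"
    have le: "idx s \<le> idx t"
    proof (rule ccontr)
      assume "\<not> idx s \<le> idx t"
      then have "t \<le> s" using sorted_nth_mono[OF xs(1), of "idx t" "idx s"] idx st by simp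
      with st have "s = t" by simp
      with \<open>\<not> idx s \<le> idx t\<close> show False by simp
    qed
    have "\<bar>A (xs ! idx s) (xs ! idx t) - (\<Sum>i=idx s..<idx t. A (xs ! i) (xs ! Suc i))\<bar>
      \<le> 2 * C / (1 - 2 powr (1 - \<theta>)) * (xs ! idx t - xs ! idx s) powr \<theta>"
    proof (rule chain_bound[OF \<theta> defect le _ _ _ C])
      show "xs ! i \<le> xs ! j" if "i \<le> j" "j \<le> idx t" for i j
        using that idx(1)[OF st(2)] by (intro sorted_nth_mono xs) auto
    qed (use idx st P in auto)
    moreover have "f t - f s = (\<Sum>i=idx s..<idx t. A (xs ! i) (xs ! Suc i))"
      unfolding f_def using sum.atLeastLessThan_concat[of 0 "idx s" "idx t" "\<lambda>i. A (xs ! i) (xs ! Suc i)"] le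
      by simp
    ultimately show "\<bar>A s t - (f t - f s)\<bar> \<le> 2 * C / (1 - 2 powr (1 - \<theta>)) * (t - s) powr \<theta>"
      using idx st by simp
  qed
qed

text \<open>
  The length of a path \<open>x, ys\<close> in the complete graph with edge weights \<open>c\<close>.
\<close>

primrec path_cost :: "('a \<Rightarrow> 'a \<Rightarrow> real) \<Rightarrow> 'a \<Rightarrow> 'a list \<Rightarrow> real" where
  "path_cost c x [] = 0"
| "path_cost c x (y # ys) = c x y + path_cost c y ys"

lemma path_cost_append: "path_cost c x (ys @ [z]) = path_cost c x ys + c (last (x # ys)) z"
  by (induction ys arbitrary: x) auto

lemma path_cost_lower_bound:
  assumes "\<And>x y. x \<in> P \<Longrightarrow> y \<in> P \<Longrightarrow> f y - f x \<le> c x y" "x \<in> P" "set ys \<subseteq> P"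
  shows "f (last (x # ys)) - f x \<le> path_cost c x ys"
  using assms(2,3)
proof (induction ys arbitrary: x)
  case (Cons y ys)
  then have "f (last (y # ys)) - f y \<le> path_cost c y ys" "f y - f x \<le> c x y"
    using assms(1) by auto
  then show ?case by simp
qed simp

text \<open>
  A system of constraints \<open>f y - f x \<le> c x y\<close> is solvable if each finite subsystem is: the
  shortest-path distance from a base point solves it. Finite solvability excludes negative cycles, so
  these distances are bounded below, and the constraints are the triangle inequality for
  distances.
\<close>

lemma difference_constraints_compactness:
  fixes c :: "'a \<Rightarrow> 'a \<Rightarrow> real"
  assumes "\<And>P. finite P \<Longrightarrow> P \<subseteq> U \<Longrightarrow> \<exists>f :: 'a \<Rightarrow> real. \<forall>x\<in>P. \<forall>y\<in>P. f y - f x \<le> c x y"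
  shows "\<exists>f :: 'a \<Rightarrow> real. \<forall>x\<in>U. \<forall>y\<in>U. f y - f x \<le> c x y"
proof (cases "U = {}")
  case False
  then obtain src where src: "src \<in> U" by blast
  define costs where "costs y = {path_cost c src ys | ys. set ys \<subseteq> U \<and> last (src # ys) = y}" for y
  define f where "f y = Inf (costs y)" for y
  have nonempty: "costs y \<noteq> {}" if "y \<in> U" for y
    using that unfolding costs_def by (auto intro!: exI[of _ "[y]"])
  have lower: "- c y src \<le> r" if "y \<in> U" and r: "r \<in> costs y" for y r
  proof -
    obtain ys where ys: "set ys \<subseteq> U" "last (src # ys) = y" "r = path_cost c src ys"
      using r unfolding costs_def by blast
    let ?P = "insert src (set ys)"
    obtain g :: "'a \<Rightarrow> real" where g: "\<And>x y. x \<in> ?P \<Longrightarrow> y \<in> ?P \<Longrightarrow> g y - g x \<le> c x y"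
      using assms[of ?P] ys(1) src by (metis List.finite_set finite.insertI insert_subset)
    have "g y - g src \<le> r"
      using path_cost_lower_bound[of ?P g c src ys, OF g] ys by auto
    moreover have "y \<in> ?P" using ys(2) by (metis last_in_set list.distinct(1) list.simps(15))
    then have "g src - g y \<le> c y src" by (intro g) auto
    ultimately show ?thesis by simp
  qed
  have "f y - f x \<le> c x y" if "x \<in> U" "y \<in> U" for x y
  proof -
    have "f y - c x y \<le> r" if r: "r \<in> costs x" for r
    proof -
      obtain ys where ys: "set ys \<subseteq> U" "last (src # ys) = x" "r = path_cost c src ys"
        using r unfolding costs_def by blast
      have "r + c x y = path_cost c src (ys @ [y])"
        using ys by (simp add: path_cost_append)
      moreover have "set (ys @ [y]) \<subseteq> U" "last (src # ys @ [y]) = y"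
        using ys \<open>y \<in> U\<close> by auto
      ultimately have "r + c x y \<in> costs y"
        unfolding costs_def by blast
      then have "f y \<le> r + c x y"
        unfolding f_def by (rule cInf_lower) (use lower \<open>y \<in> U\<close> in \<open>auto simp: bdd_below_def\<close>)
      then show ?thesis by simp
    qed
    then have "f y - c x y \<le> f x"
      unfolding f_def[of x] by (intro cInf_greatest nonempty \<open>x \<in> U\<close>)
    then show ?thesis by simp
  qed
  then show ?thesis by blast
qed simp

text \<open>
  The inequality \<open>\<bar>A s t - (f t - f s)\<bar> \<le> K (t - s) powr \<theta>\<close> is a pair of difference constraints on
  \<open>f\<close>, so it suffices to solve it on finite sets of times. In contrast to a limit of Riemann sums,
  no refinement of partitions has to be discussed.
\<close>

lemma sewing:
  fixes A :: "real \<Rightarrow> real \<Rightarrow> real"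
  assumes \<theta>: "1 < \<theta>"
    and defect: "\<And>s u t. 0 \<le> s \<Longrightarrow> s \<le> u \<Longrightarrow> u \<le> t \<Longrightarrow> t \<le> T \<Longrightarrow>
      \<bar>A s t - A s u - A u t\<bar> \<le> C * (t - s) powr \<theta>"
  shows "\<exists>f K. \<forall>s t. 0 \<le> s \<longrightarrow> s \<le> t \<longrightarrow> t \<le> T \<longrightarrow> \<bar>A s t - (f t - f s)\<bar> \<le> K * (t - s) powr \<theta>"
proof -
  define K where "K = 2 * \<bar>C\<bar> / (1 - 2 powr (1 - \<theta>))"
  (* The two-sided estimate becomes one constraint for each direction of travel between x and y. *)
  define c where "c x y = (if x \<le> y then A x y else - A y x) + K * \<bar>y - x\<bar> powr \<theta>" for x y
  have diag: "A s s = 0" if "0 \<le> s" "s \<le> T" for s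
    using defect[of s s s] that by simp
  have defect': "\<bar>A s t - A s u - A u t\<bar> \<le> \<bar>C\<bar> * (t - s) powr \<theta>"
    if "0 \<le> s" "s \<le> u" "u \<le> t" "t \<le> T" for s u t
    using defect[OF that] by (rule order_trans) (simp add: mult_right_mono)
  have "\<exists>f. \<forall>x\<in>{0..T}. \<forall>y\<in>{0..T}. f y - f x \<le> c x y"
  proof (rule difference_constraints_compactness)
    fix P assume P: "finite P" "P \<subseteq> {0..T}"
    obtain f where f: "\<And>s t. s \<in> P \<Longrightarrow> t \<in> P \<Longrightarrow> s \<le> t \<Longrightarrow> \<bar>A s t - (f t - f s)\<bar> \<le> K * (t - s) powr \<theta>"
      using sewing_finite[OF \<theta> defect' _ P] unfolding K_def by auto
    have "f y - f x \<le> c x y" if "x \<in> P" "y \<in> P" for x y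
      using f[of x y] f[of y x] that by (cases "x \<le> y") (auto simp: c_def abs_le_iff)
    then show "\<exists>f. \<forall>x\<in>P. \<forall>y\<in>P. f y - f x \<le> c x y" by blast
  qed
  then obtain f where f: "\<And>x y. x \<in> {0..T} \<Longrightarrow> y \<in> {0..T} \<Longrightarrow> f y - f x \<le> c x y" by blast
  have "\<bar>A s t - (f t - f s)\<bar> \<le> K * (t - s) powr \<theta>" if "0 \<le> s" "s \<le> t" "t \<le> T" for s t
    using f[of s t] f[of t s] diag[of s] that by (cases "s = t") (auto simp: c_def abs_le_iff)
  then show ?thesis by blast
qed

section \<open>Paths of characters and functionals\<close>

definition simplex :: "real \<Rightarrow> (real \<times> real) set" where
  "simplex T = {(s, t). 0 \<le> s \<and> s < t \<and> t \<le> T}"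

text \<open>
  The functionals are indexed by all pairs of distinct times, the norms of increments by ordered
  pairs.
\<close>

definition off_diagonal :: "real \<Rightarrow> (real \<times> real) set" where
  "off_diagonal T = {(s, t). s \<in> {0..T} \<and> t \<in> {0..T} \<and> s \<noteq> t}"

definition gauge :: "real \<Rightarrow> real \<times> real \<Rightarrow> real" where
  "gauge \<gamma> = (\<lambda>(s, t). \<bar>t - s\<bar> powr \<gamma>)"

lemma setcompr2_eq_image: "{f s t | s t. P s t} = (\<lambda>(s, t). f s t) ` {(s, t). P s t}"
  by auto

lemma gauge_pos: "p \<in> off_diagonal T \<Longrightarrow> 0 < gauge \<gamma> p"
  by (auto simp: gauge_def off_diagonal_def)

lemma gauge_power: "s \<noteq> t \<Longrightarrow> gauge \<gamma> (s, t) ^ k = \<bar>t - s\<bar> powr (\<gamma> * real k)"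
  by (simp add: gauge_def powr_powr flip: powr_realpow)

lemma simplex_subset: "simplex T \<subseteq> off_diagonal T"
  by (auto simp: simplex_def off_diagonal_def)

text \<open>
  The two notions of a rough path that consist of group-valued maps, with the bound on the homogeneous
  norm replaced by the equivalent graded bound.
\<close>

definition path_space :: "enat \<Rightarrow> real \<Rightarrow> real \<Rightarrow> (real \<Rightarrow> 'd series) set" where
  "path_space N \<gamma> T = {X \<in> {0..T} \<rightarrow>\<^sub>E carrier (GL N). X 0 = unit_series \<and>
     graded_bounded N (simplex T) (gauge \<gamma>) (\<lambda>(s, t). increment (GL N) X s t)}"

lemma increment_closed:
  assumes "group G" "X s \<in> carrier G" "X t \<in> carrier G"
  shows "increment G X s t \<in> carrier G"
proof -
  interpret group G by fact
  show ?thesis using assms by (simp add: increment_def)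
qed

lemma increment_mult:
  assumes "group G" "X s \<in> carrier G" "X u \<in> carrier G" "X t \<in> carrier G"
  shows "increment G X s u \<otimes>\<^bsub>G\<^esub> increment G X u t = increment G X s t"
proof -
  interpret group G by fact
  have "X u \<otimes>\<^bsub>G\<^esub> (inv\<^bsub>G\<^esub> X u \<otimes>\<^bsub>G\<^esub> X t) = X t"
    using assms by (simp add: m_assoc[symmetric])
  then show ?thesis using assms by (simp add: increment_def m_assoc)
qed

lemma increment_self:
  assumes "group G" "X t \<in> carrier G"
  shows "increment G X t t = \<one>\<^bsub>G\<^esub>"
proof -
  interpret group G by fact
  show ?thesis using assms by (simp add: increment_def)
qed

lemma increment_from_one:
  assumes "group G" "X s = \<one>\<^bsub>G\<^esub>" "X t \<in> carrier G"
  shows "increment G X s t = X t"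
proof -
  interpret group G by fact
  show ?thesis using assms by (simp add: increment_def)
qed

lemma increment_in_carrier:
  assumes X: "X \<in> {0..T} \<rightarrow>\<^sub>E carrier (GL N)" and p: "p \<in> simplex T"
  shows "(\<lambda>(s, t). increment (GL N) X s t) p \<in> carrier (GL N)"
proof -
  obtain s t where st: "p = (s, t)" "s \<in> {0..T}" "t \<in> {0..T}"
    using p by (auto simp: simplex_def)
  have "increment (GL N) X s t \<in> carrier (GL N)"
    by (rule increment_closed[OF group_GL PiE_mem[OF X st(2)] PiE_mem[OF X st(3)]])
  then show ?thesis by (simp add: st)
qed

lemma rough_paths_eq_path_space:
  "rough_paths \<gamma> T = (path_space (enat (rp_order \<gamma>)) \<gamma> T :: (real \<Rightarrow> ('d::finite) series) set)"
proof -
  let ?n = "rp_order \<gamma>"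
  have *: "bdd_above {hom_norm ?n (increment (GL (enat ?n)) X s t) / \<bar>t - s\<bar> powr \<gamma> | s t. 0 \<le> s \<and> s < t \<and> t \<le> T}
    \<longleftrightarrow> graded_bounded (enat ?n) (simplex T) (gauge \<gamma>) (\<lambda>(s, t). increment (GL (enat ?n)) X s t)"
    if X: "X \<in> {0..T} \<rightarrow>\<^sub>E carrier (GL (enat ?n))" for X :: "real \<Rightarrow> 'd series"
  proof -
    have "{hom_norm ?n (increment (GL (enat ?n)) X s t) / \<bar>t - s\<bar> powr \<gamma> | s t. 0 \<le> s \<and> s < t \<and> t \<le> T} =
      (\<lambda>p. hom_norm ?n ((\<lambda>(s, t). increment (GL (enat ?n)) X s t) p) / gauge \<gamma> p) ` simplex T"
      unfolding setcompr2_eq_image simplex_def by (rule image_cong) (auto simp: gauge_def)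
    also have "bdd_above \<dots> \<longleftrightarrow>
      graded_bounded (enat ?n) (simplex T) (gauge \<gamma>) (\<lambda>(s, t). increment (GL (enat ?n)) X s t)"
    proof (rule hom_norm_bounded_iff)
      show "0 < gauge \<gamma> p" if "p \<in> simplex T" for p
        using gauge_pos simplex_subset that by blast
      show "(\<lambda>(s, t). increment (GL (enat ?n)) X s t) p \<in> carrier (GL (enat ?n))" if "p \<in> simplex T" for p
        using X that by (rule increment_in_carrier)
    qed
    finally show ?thesis .
  qed
  show ?thesis
    unfolding rough_paths_def path_space_def GL_group_trunc_eq by (intro Collect_cong conj_cong refl *)
qed

lemma graded_bounded_infinity_iff:
  "graded_bounded \<infinity> S h x \<longleftrightarrow> (\<forall>n. graded_bounded (enat n) S h x)"
  by (auto simp: graded_bounded_def)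

lemma graded_bounded_cutoff:
  "graded_bounded N S h (\<lambda>i. cutoff N (x i)) \<longleftrightarrow> graded_bounded N S h x"
  by (auto simp: graded_bounded_def cutoff_def)

lemma full_rough_paths_eq_path_space:
  "full_rough_paths \<gamma> T = (path_space \<infinity> \<gamma> T :: (real \<Rightarrow> ('d::finite) series) set)"
proof -
  have *: "bdd_above {hom_norm n (proj n (increment (GL \<infinity>) X s t)) / \<bar>t - s\<bar> powr \<gamma> | s t. 0 \<le> s \<and> s < t \<and> t \<le> T}
    \<longleftrightarrow> graded_bounded (enat n) (simplex T) (gauge \<gamma>) (\<lambda>(s, t). increment (GL \<infinity>) X s t)"
    if X: "X \<in> {0..T} \<rightarrow>\<^sub>E carrier (GL \<infinity>)" for X :: "real \<Rightarrow> 'd series" and n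
  proof -
    have "{hom_norm n (proj n (increment (GL \<infinity>) X s t)) / \<bar>t - s\<bar> powr \<gamma> | s t. 0 \<le> s \<and> s < t \<and> t \<le> T} =
      (\<lambda>p. hom_norm n (cutoff (enat n) ((\<lambda>(s, t). increment (GL \<infinity>) X s t) p)) / gauge \<gamma> p) ` simplex T"
      unfolding setcompr2_eq_image simplex_def by (rule image_cong) (auto simp: gauge_def cutoff_enat)
    also have "bdd_above \<dots> \<longleftrightarrow>
      graded_bounded (enat n) (simplex T) (gauge \<gamma>) (\<lambda>p. cutoff (enat n) ((\<lambda>(s, t). increment (GL \<infinity>) X s t) p))"
    proof (rule hom_norm_bounded_iff)
      show "0 < gauge \<gamma> p" if "p \<in> simplex T" for p
        using gauge_pos simplex_subset that by blast
      show "cutoff (enat n) ((\<lambda>(s, t). increment (GL \<infinity>) X s t) p) \<in> carrier (GL (enat n))"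
        if "p \<in> simplex T" for p
      proof -
        have "(\<lambda>(s, t). increment (GL \<infinity>) X s t) p \<in> carrier (GL \<infinity>)"
          using X that by (rule increment_in_carrier)
        then show ?thesis using cutoff_hom unfolding hom_def by blast
      qed
    qed
    finally show ?thesis by (simp add: graded_bounded_cutoff)
  qed
  show ?thesis
    unfolding full_rough_paths_def path_space_def GL_group_eq graded_bounded_infinity_iff
    by (intro Collect_cong conj_cong refl all_cong1 *)
qed

definition degree_upto :: "enat \<Rightarrow> 'd forest set" where
  "degree_upto N = {\<zeta>. enat (forest_size \<zeta>) \<le> N}"

lemma degree_upto_enat: "degree_upto (enat n) = forests_upto n"
  by (simp add: degree_upto_def forests_upto_def)

lemma degree_upto_infinity: "degree_upto \<infinity> = UNIV"
  by (simp add: degree_upto_def)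

lemma mem_degree_upto: "\<zeta> \<in> degree_upto N \<longleftrightarrow> enat (forest_size \<zeta>) \<le> N"
  by (simp add: degree_upto_def)

text \<open>
  The two notions of a rough path that consist of maps into a dual space, in the same uniform form.
\<close>

definition functional_space :: "enat \<Rightarrow> real \<Rightarrow> real \<Rightarrow> (real \<times> real \<Rightarrow> 'd series \<Rightarrow> real) set" where
  "functional_space N \<gamma> T =
     {X \<in> {0..T} \<times> {0..T} \<rightarrow>\<^sub>E alg_dual (free_space (degree_upto N)).
        (\<forall>s\<in>{0..T}. \<forall>t\<in>{0..T}.
           X (s, t) (basis_vec {#}) = 1 \<and>
           (\<forall>\<zeta>\<^sub>1 \<zeta>\<^sub>2. enat (forest_size \<zeta>\<^sub>1 + forest_size \<zeta>\<^sub>2) \<le> N \<longrightarrow>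
              X (s, t) (basis_vec (\<zeta>\<^sub>1 + \<zeta>\<^sub>2)) =
              X (s, t) (basis_vec \<zeta>\<^sub>1) * X (s, t) (basis_vec \<zeta>\<^sub>2))) \<and>
        (\<forall>t\<in>{0..T}. X (t, t) = restrict counit (free_space (degree_upto N))) \<and>
        (\<forall>s\<in>{0..T}. \<forall>u\<in>{0..T}. \<forall>t\<in>{0..T}. \<forall>\<zeta>\<in>degree_upto N.
           X (s, t) (basis_vec \<zeta>) =
           cuts \<zeta> (\<lambda>a b. X (s, u) (basis_vec a) * X (u, t) (basis_vec b))) \<and>
        (\<forall>\<zeta>\<in>degree_upto N.
           hbound (off_diagonal T) (gauge \<gamma>) (forest_size \<zeta>) (\<lambda>p. X p (basis_vec \<zeta>)))}"

lemma functional_spaceD: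
  assumes "X \<in> functional_space N \<gamma> T"
  shows "X \<in> {0..T} \<times> {0..T} \<rightarrow>\<^sub>E alg_dual (free_space (degree_upto N))"
    and "s \<in> {0..T} \<Longrightarrow> t \<in> {0..T} \<Longrightarrow> X (s, t) (basis_vec {#}) = 1"
    and "s \<in> {0..T} \<Longrightarrow> t \<in> {0..T} \<Longrightarrow> enat (forest_size a + forest_size b) \<le> N \<Longrightarrow>
      X (s, t) (basis_vec (a + b)) = X (s, t) (basis_vec a) * X (s, t) (basis_vec b)"
    and "t \<in> {0..T} \<Longrightarrow> X (t, t) = restrict counit (free_space (degree_upto N))"
    and "s \<in> {0..T} \<Longrightarrow> u \<in> {0..T} \<Longrightarrow> t \<in> {0..T} \<Longrightarrow> \<zeta> \<in> degree_upto N \<Longrightarrow>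
      X (s, t) (basis_vec \<zeta>) = cuts \<zeta> (\<lambda>a b. X (s, u) (basis_vec a) * X (u, t) (basis_vec b))"
    and "\<zeta> \<in> degree_upto N \<Longrightarrow>
      hbound (off_diagonal T) (gauge \<gamma>) (forest_size \<zeta>) (\<lambda>p. X p (basis_vec \<zeta>))"
  using assms unfolding functional_space_def by blast+

lemma bdd_above_quotient_iff:
  "bdd_above {\<bar>F (s, t) y\<bar> / \<bar>t - s\<bar> powr (\<gamma> * real k) | s t. s \<in> {0..T} \<and> t \<in> {0..T} \<and> s \<noteq> t}
    \<longleftrightarrow> hbound (off_diagonal T) (gauge \<gamma>) k (\<lambda>p. F p y)"
proof -
  have "{\<bar>F (s, t) y\<bar> / \<bar>t - s\<bar> powr (\<gamma> * real k) | s t. s \<in> {0..T} \<and> t \<in> {0..T} \<and> s \<noteq> t} =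
    (\<lambda>p. \<bar>F p y\<bar> / gauge \<gamma> p ^ k) ` off_diagonal T"
    by (force simp: off_diagonal_def image_iff gauge_power)
  moreover have "\<bar>F p y\<bar> / gauge \<gamma> p ^ k \<le> C \<longleftrightarrow> \<bar>F p y\<bar> \<le> C * gauge \<gamma> p ^ k" if "p \<in> off_diagonal T" for p C
    using gauge_pos[OF that, of \<gamma>] by (simp add: pos_divide_le_eq)
  ultimately show ?thesis
    by (simp add: bdd_above_def hbound_def)
qed

lemma tensor_functional_coprod_star:
  "tensor_functional f g (coprod_star \<zeta>) = cuts \<zeta> (\<lambda>a b. f (basis_vec a) * g (basis_vec b))"
  by (simp add: tensor_functional_def cuts_def pairing_lookup)

lemma functional_rough_paths_eq:
  "functional_rough_paths \<gamma> T = functional_space (enat (rp_order \<gamma>)) \<gamma> T"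
  unfolding functional_rough_paths_def functional_space_def tensor_functional_coprod_star
    degree_upto_enat bdd_above_quotient_iff enat_ord_simps ..

lemma full_functional_rough_paths_eq:
  "full_functional_rough_paths \<gamma> T = functional_space \<infinity> \<gamma> T"
  unfolding full_functional_rough_paths_def functional_space_def tensor_functional_coprod_star
    degree_upto_infinity bdd_above_quotient_iff by (simp del: atLeastAtMost_iff)

lemma pairing_superset:
  assumes "finite S" "{b. y b \<noteq> 0} \<subseteq> S"
  shows "pairing y g = (\<Sum>b\<in>S. y b * g b)"
  unfolding pairing_def by (rule sum.mono_neutral_left) (use assms in auto)

lemma pairing_basis_vec [simp]: "pairing (basis_vec b) g = g b"
  using pairing_superset[of "{b}" "basis_vec b" g] by (auto simp: basis_vec_def split: if_splits)

lemma basis_vec_in_free_space: "b \<in> D \<Longrightarrow> basis_vec b \<in> free_space D"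
proof -
  have "{c. basis_vec b c \<noteq> 0} = {b}" by (auto simp: basis_vec_def split: if_splits)
  then show "b \<in> D \<Longrightarrow> basis_vec b \<in> free_space D" by (simp add: free_space_def)
qed

lemma free_space_linear_comb:
  assumes "x \<in> free_space D" "y \<in> free_space D"
  shows "(\<lambda>c. a * x c + b * y c) \<in> free_space D"
proof -
  have "{c. a * x c + b * y c \<noteq> 0} \<subseteq> {c. x c \<noteq> 0} \<union> {c. y c \<noteq> 0}" by auto
  then show ?thesis
    using assms finite_subset[of "{c. a * x c + b * y c \<noteq> 0}"] unfolding free_space_def by blast
qed

lemma pairing_in_alg_dual: "(\<lambda>y\<in>free_space D. pairing y g) \<in> alg_dual (free_space D)"
  unfolding alg_dual_def
proof (intro CollectI conjI ballI allI)
  fix x y a b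
  assume xy: "x \<in> free_space D" "y \<in> free_space D"
  let ?S = "{c. x c \<noteq> 0} \<union> {c. y c \<noteq> 0}"
  have S: "finite ?S" using xy by (simp add: free_space_def)
  have "pairing (\<lambda>c. a * x c + b * y c) g = (\<Sum>c\<in>?S. (a * x c + b * y c) * g c)"
    using S by (rule pairing_superset) auto
  also have "\<dots> = a * (\<Sum>c\<in>?S. x c * g c) + b * (\<Sum>c\<in>?S. y c * g c)"
    by (simp add: distrib_right sum.distrib sum_distrib_left mult.assoc)
  also have "\<dots> = a * pairing x g + b * pairing y g"
    using pairing_superset[OF S, of x g] pairing_superset[OF S, of y g] by simp
  finally show "(\<lambda>y\<in>free_space D. pairing y g) (\<lambda>c. a * x c + b * y c) =
    a * (\<lambda>y\<in>free_space D. pairing y g) x + b * (\<lambda>y\<in>free_space D. pairing y g) y"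
    using xy free_space_linear_comb[OF xy] by simp
qed simp

text \<open>
  A functional on a space of finite sums is determined by its values on the basis.
\<close>

lemma alg_dual_expand:
  assumes F: "F \<in> alg_dual (free_space D)" and y: "y \<in> free_space D"
  shows "F y = pairing y (\<lambda>b. F (basis_vec b))"
proof -
  have lin: "F (\<lambda>c. a * x c + b * z c) = a * F x + b * F z"
    if "x \<in> free_space D" "z \<in> free_space D" for x z a b
    using F that by (simp add: alg_dual_def)
  have "F z = (\<Sum>b\<in>S. z b * F (basis_vec b))" if "finite S" "S \<subseteq> D" "{b. z b \<noteq> 0} \<subseteq> S" for S z
    using that
  proof (induction S arbitrary: z rule: finite_induct)
    case empty
    then have z: "z = (\<lambda>c. 0)" by auto
    have "(\<lambda>c. 0) \<in> free_space D" by (simp add: free_space_def)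
    from lin[OF this this, of 0 0] show ?case by (simp add: z)
  next
    case (insert b S)
    let ?z = "z(b := 0)"
    have supp: "{c. ?z c \<noteq> 0} \<subseteq> S" using insert.prems by auto
    then have "?z \<in> free_space D"
      using insert finite_subset[of _ S] unfolding free_space_def by blast
    moreover have "basis_vec b \<in> free_space D" using insert.prems by (intro basis_vec_in_free_space) auto
    moreover have "z = (\<lambda>c. 1 * ?z c + z b * basis_vec b c)" by (auto simp: basis_vec_def)
    ultimately have "F z = F ?z + z b * F (basis_vec b)" using lin[of ?z "basis_vec b" 1 "z b"] by simp
    also have "F ?z = (\<Sum>c\<in>S. ?z c * F (basis_vec c))" using insert supp by (intro insert.IH) auto
    also have "\<dots> = (\<Sum>c\<in>S. z c * F (basis_vec c))" using insert.hyps by (intro sum.cong) auto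
    finally show ?case using insert.hyps by simp
  qed
  then show ?thesis using y unfolding pairing_def free_space_def by blast
qed

lemma path_spaceD:
  assumes "X \<in> path_space N \<gamma> T"
  shows "X 0 = unit_series" "t \<in> {0..T} \<Longrightarrow> X t \<in> carrier (GL N)"
    "graded_bounded N (simplex T) (gauge \<gamma>) (\<lambda>(s, t). increment (GL N) X s t)"
  using assms by (auto simp: path_space_def)

text \<open>
  Reversing time inverts the increment, and inversion preserves graded boundedness.
\<close>

lemma graded_bounded_off_diagonal:
  assumes X: "\<And>t. t \<in> {0..T} \<Longrightarrow> X t \<in> carrier (GL N)"
    and bd: "graded_bounded N (simplex T) (gauge \<gamma>) (\<lambda>(s, t). increment (GL N) X s t)"
  shows "graded_bounded N (off_diagonal T) (gauge \<gamma>) (\<lambda>(s, t). increment (GL N) X s t)"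
proof -
  let ?x = "increment (GL N) X"
  have closed: "?x s t \<in> carrier (GL N)" if "s \<in> {0..T}" "t \<in> {0..T}" for s t
    using that by (intro increment_closed group_GL X)
  then have one: "?x s t {#} = 1" if "s \<in> {0..T}" "t \<in> {0..T}" for s t
    using that by (auto simp: carrier_GL truncated_character_def)
  have reverse: "graded_bounded N (simplex T) (gauge \<gamma>) (\<lambda>(s, t). ?x t s)"
  proof (rule graded_bounded_inverse[OF _ _ _ bd])
    fix p assume p: "p \<in> simplex T"
    then obtain s t where st: "p = (s, t)" "s \<in> {0..T}" "t \<in> {0..T}" by (auto simp: simplex_def)
    show "(\<lambda>(s, t). ?x s t) p {#} = 1" "(\<lambda>(s, t). ?x t s) p {#} = 1"
      using one st by simp_all
    have "?x s t \<otimes>\<^bsub>GL N\<^esub> ?x t s = \<one>\<^bsub>GL N\<^esub>"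
      using st X by (simp add: increment_mult increment_self group_GL del: atLeastAtMost_iff)
    then show "cutoff N (star ((\<lambda>(s, t). ?x s t) p) ((\<lambda>(s, t). ?x t s) p)) = unit_series"
      by (simp add: mult_GL one_GL st)
  qed
  show ?thesis
    unfolding graded_bounded_def
  proof (intro allI impI)
    fix \<zeta> :: "'a forest"
    assume \<zeta>: "enat (forest_size \<zeta>) \<le> N"
    obtain C where C: "\<And>p. p \<in> simplex T \<Longrightarrow> \<bar>(\<lambda>(s, t). ?x s t) p \<zeta>\<bar> \<le> C * gauge \<gamma> p ^ forest_size \<zeta>"
      using graded_boundedD[OF bd \<zeta>] unfolding hbound_def by blast
    obtain D where D: "\<And>p. p \<in> simplex T \<Longrightarrow> \<bar>(\<lambda>(s, t). ?x t s) p \<zeta>\<bar> \<le> D * gauge \<gamma> p ^ forest_size \<zeta>"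
      using graded_boundedD[OF reverse \<zeta>] unfolding hbound_def by blast
    show "hbound (off_diagonal T) (gauge \<gamma>) (forest_size \<zeta>) (\<lambda>p. (\<lambda>(s, t). ?x s t) p \<zeta>)"
    proof (rule hboundI[where C = "max C D"])
      fix p assume p: "p \<in> off_diagonal T"
      then obtain s t where st: "p = (s, t)" "s \<in> {0..T}" "t \<in> {0..T}" "s \<noteq> t"
        by (auto simp: off_diagonal_def)
      have "\<bar>?x s t \<zeta>\<bar> \<le> C * gauge \<gamma> p ^ forest_size \<zeta> \<or> \<bar>?x s t \<zeta>\<bar> \<le> D * gauge \<gamma> p ^ forest_size \<zeta>"
        using C[of "(s, t)"] D[of "(t, s)"] st
        by (cases "s < t") (auto simp: simplex_def gauge_def abs_minus_commute)
      moreover have "C * gauge \<gamma> p ^ forest_size \<zeta> \<le> max C D * gauge \<gamma> p ^ forest_size \<zeta>"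
        "D * gauge \<gamma> p ^ forest_size \<zeta> \<le> max C D * gauge \<gamma> p ^ forest_size \<zeta>"
        using gauge_pos[OF p, of \<gamma>] by (auto intro!: mult_right_mono)
      ultimately show "\<bar>(\<lambda>(s, t). ?x s t) p \<zeta>\<bar> \<le> max C D * gauge \<gamma> p ^ forest_size \<zeta>"
        using st by auto
    qed
  qed
qed

definition functional_of_path :: "enat \<Rightarrow> real \<Rightarrow> (real \<Rightarrow> 'd series) \<Rightarrow> (real \<times> real \<Rightarrow> 'd series \<Rightarrow> real)" where
  "functional_of_path N T X = (\<lambda>(s, t)\<in>{0..T} \<times> {0..T}. \<lambda>y\<in>free_space (degree_upto N).
     pairing y (increment (GL N) X s t))"

definition coefficients :: "enat \<Rightarrow> (real \<times> real \<Rightarrow> 'd series \<Rightarrow> real) \<Rightarrow> real \<Rightarrow> real \<Rightarrow> 'd series" where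
  "coefficients N F s t = (\<lambda>\<zeta>. if \<zeta> \<in> degree_upto N then F (s, t) (basis_vec \<zeta>) else 0)"

lemma functional_of_path_basis_vec:
  assumes "s \<in> {0..T}" "t \<in> {0..T}" "\<zeta> \<in> degree_upto N"
  shows "functional_of_path N T X (s, t) (basis_vec \<zeta>) = increment (GL N) X s t \<zeta>"
  using assms basis_vec_in_free_space[OF assms(3)] by (simp add: functional_of_path_def)

lemma degree_upto_plus:
  "a + b \<in> degree_upto N \<Longrightarrow> a \<in> degree_upto N" "a + b \<in> degree_upto N \<Longrightarrow> b \<in> degree_upto N"
  unfolding mem_degree_upto forest_size_plus by (erule enat_le_trans[rotated], simp)+

lemma empty_in_degree_upto [simp]: "{#} \<in> degree_upto N"
  by (simp add: degree_upto_def flip: zero_enat_def)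

lemma functional_of_path_in_functional_space:
  fixes X :: "real \<Rightarrow> 'd series"
  assumes "X \<in> path_space N \<gamma> T"
  shows "functional_of_path N T X \<in> functional_space N \<gamma> T"
proof -
  note X = path_spaceD[OF assms]
  let ?x = "increment (GL N) X"
  let ?F = "functional_of_path N T X"
  have chr: "truncated_character N (?x s t)" if "s \<in> {0..T}" "t \<in> {0..T}" for s t
    using increment_closed[where G = "GL N" and X = X and s = s and t = t,
        OF group_GL X(2)[OF that(1)] X(2)[OF that(2)]] by (simp add: carrier_GL)
  show ?thesis
    unfolding functional_space_def
  proof (intro CollectI conjI ballI allI impI)
    show "?F \<in> {0..T} \<times> {0..T} \<rightarrow>\<^sub>E alg_dual (free_space (degree_upto N))"
      by (auto simp: functional_of_path_def intro!: pairing_in_alg_dual)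
  next
    fix s t assume st: "s \<in> {0..T}" "t \<in> {0..T}"
    show "?F (s, t) (basis_vec {#}) = 1"
      using chr[OF st] by (simp add: functional_of_path_basis_vec[OF st] truncated_character_def)
    fix a b :: "'d forest"
    assume "enat (forest_size a + forest_size b) \<le> N"
    then have "a + b \<in> degree_upto N" "a \<in> degree_upto N" "b \<in> degree_upto N"
      using degree_upto_plus[of a b N] by (auto simp: degree_upto_def)
    then show "?F (s, t) (basis_vec (a + b)) = ?F (s, t) (basis_vec a) * ?F (s, t) (basis_vec b)"
      using chr[OF st] by (simp add: functional_of_path_basis_vec[OF st] truncated_character_def mem_degree_upto)
  next
    fix t assume t: "t \<in> {0..T}"
    have "?x t t = unit_series" using increment_self[where G = "GL N" and X = X and t = t, OF group_GL X(2)[OF t]] by (simp add: one_GL)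
    moreover have "pairing y unit_series = counit y" if "y \<in> free_space (degree_upto N)" for y :: "'d series"
    proof -
      have "finite (insert {#} {b. y b \<noteq> 0})" using that by (simp add: free_space_def)
      then have "pairing y unit_series = (\<Sum>b\<in>insert {#} {b. y b \<noteq> 0}. y b * unit_series b)"
        by (rule pairing_superset) auto
      also have "\<dots> = (\<Sum>b\<in>insert {#} {b. y b \<noteq> 0}. if b = {#} then y {#} else 0)"
        by (intro sum.cong) (auto simp: unit_series_apply)
      also have "\<dots> = y {#}"
        using \<open>finite (insert {#} {b. y b \<noteq> 0})\<close> by (subst sum.delta) auto
      finally show ?thesis by (simp add: counit_def)
    qed
    ultimately have "(\<lambda>y\<in>free_space (degree_upto N). pairing y (?x t t)) = restrict counit (free_space (degree_upto N))"
      by (intro restrict_ext) simp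
    then show "?F (t, t) = restrict counit (free_space (degree_upto N))"
      using t by (simp add: functional_of_path_def)
  next
    fix s u t and \<zeta> :: "'d forest"
    assume st: "s \<in> {0..T}" "u \<in> {0..T}" "t \<in> {0..T}" and \<zeta>: "\<zeta> \<in> degree_upto N"
    have "?x s t = cutoff N (star (?x s u) (?x u t))"
      using increment_mult[where G = "GL N" and X = X and s = s and u = u and t = t,
          OF group_GL X(2)[OF st(1)] X(2)[OF st(2)] X(2)[OF st(3)]] by (simp add: mult_GL)
    then have "?x s t \<zeta> = cuts \<zeta> (\<lambda>a b. ?x s u a * ?x u t b)"
      using \<zeta> by (simp add: cutoff_def star_eq_cuts degree_upto_def)
    also have "\<dots> = cuts \<zeta> (\<lambda>a b. ?F (s, u) (basis_vec a) * ?F (u, t) (basis_vec b))"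
    proof (rule cuts_cong)
      fix a b :: "'d forest"
      assume "forest_size a + forest_size b = forest_size \<zeta>"
      then have "a + b \<in> degree_upto N" using \<zeta> by (simp add: degree_upto_def)
      then show "?x s u a * ?x u t b = ?F (s, u) (basis_vec a) * ?F (u, t) (basis_vec b)"
        using degree_upto_plus[of a b N] st by (simp add: functional_of_path_basis_vec del: atLeastAtMost_iff)
    qed
    finally show "?F (s, t) (basis_vec \<zeta>) = cuts \<zeta> (\<lambda>a b. ?F (s, u) (basis_vec a) * ?F (u, t) (basis_vec b))"
      using \<zeta> st by (simp add: functional_of_path_basis_vec del: atLeastAtMost_iff)
  next
    fix \<zeta> :: "'d forest"
    assume \<zeta>: "\<zeta> \<in> degree_upto N"
    have "hbound (off_diagonal T) (gauge \<gamma>) (forest_size \<zeta>) (\<lambda>p. (\<lambda>(s, t). ?x s t) p \<zeta>)"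
      by (rule graded_boundedD[OF graded_bounded_off_diagonal[OF X(2,3)]]) (use \<zeta> in \<open>auto simp: degree_upto_def\<close>)
    then show "hbound (off_diagonal T) (gauge \<gamma>) (forest_size \<zeta>) (\<lambda>p. ?F p (basis_vec \<zeta>))"
      by (rule hbound_transfer) (use \<zeta> in \<open>auto simp: off_diagonal_def functional_of_path_basis_vec\<close>)
  qed
qed

text \<open>
  Multiplicativity of the functional is membership in the group, the condition on the diagonal is the
  unit, and the compatibility with \<open>\<Delta>\<^sub>\<star>\<close> is Chen's relation for the coefficients.
\<close>

lemma coefficients_group:
  fixes F :: "real \<times> real \<Rightarrow> 'd series \<Rightarrow> real"
  assumes F: "F \<in> functional_space N \<gamma> T"
  shows "s \<in> {0..T} \<Longrightarrow> t \<in> {0..T} \<Longrightarrow> coefficients N F s t \<in> carrier (GL N)"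
    and "t \<in> {0..T} \<Longrightarrow> coefficients N F t t = \<one>\<^bsub>GL N\<^esub>"
    and "s \<in> {0..T} \<Longrightarrow> u \<in> {0..T} \<Longrightarrow> t \<in> {0..T} \<Longrightarrow>
      coefficients N F s u \<otimes>\<^bsub>GL N\<^esub> coefficients N F u t = coefficients N F s t"
proof -
  assume st: "s \<in> {0..T}" "t \<in> {0..T}"
  have "coefficients N F s t (a + b) = coefficients N F s t a * coefficients N F s t b"
    if "enat (forest_size a + forest_size b) \<le> N" for a b :: "'d forest"
  proof -
    have "a + b \<in> degree_upto N" "a \<in> degree_upto N" "b \<in> degree_upto N"
      using that degree_upto_plus[of a b N] by (auto simp: degree_upto_def)
    then show ?thesis using functional_spaceD(3)[OF F st that] by (simp add: coefficients_def)
  qed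
  moreover have "coefficients N F s t {#} = 1"
    using functional_spaceD(2)[OF F st] by (simp add: coefficients_def)
  ultimately show "coefficients N F s t \<in> carrier (GL N)"
    by (simp add: carrier_GL truncated_character_def) (simp add: coefficients_def degree_upto_def)
next
  assume t: "t \<in> {0..T}"
  have "F (t, t) (basis_vec \<zeta>) = counit (basis_vec \<zeta>)" if "\<zeta> \<in> degree_upto N" for \<zeta>
    using basis_vec_in_free_space[OF that] by (simp add: functional_spaceD(4)[OF F t])
  then show "coefficients N F t t = \<one>\<^bsub>GL N\<^esub>"
    by (auto simp: coefficients_def one_GL counit_def basis_vec_def fun_eq_iff)
next
  assume st: "s \<in> {0..T}" "u \<in> {0..T}" "t \<in> {0..T}"
  show "coefficients N F s u \<otimes>\<^bsub>GL N\<^esub> coefficients N F u t = coefficients N F s t"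
    unfolding mult_GL
  proof
    fix \<zeta> :: "'d forest"
    show "cutoff N (star (coefficients N F s u) (coefficients N F u t)) \<zeta> = coefficients N F s t \<zeta>"
    proof (cases "\<zeta> \<in> degree_upto N")
      case True
      have "star (coefficients N F s u) (coefficients N F u t) \<zeta> =
        cuts \<zeta> (\<lambda>a b. F (s, u) (basis_vec a) * F (u, t) (basis_vec b))"
        unfolding star_eq_cuts
      proof (rule cuts_cong)
        fix a b :: "'d forest"
        assume "forest_size a + forest_size b = forest_size \<zeta>"
        then have "a + b \<in> degree_upto N" using True by (simp add: degree_upto_def)
        then show "coefficients N F s u a * coefficients N F u t b = F (s, u) (basis_vec a) * F (u, t) (basis_vec b)"
          using degree_upto_plus[of a b N] by (simp add: coefficients_def)
      qed
      also have "\<dots> = F (s, t) (basis_vec \<zeta>)"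
        by (rule functional_spaceD(5)[OF F st True, symmetric])
      finally show ?thesis using True by (simp add: cutoff_def coefficients_def degree_upto_def)
    next
      case False
      then show ?thesis by (simp add: cutoff_def coefficients_def degree_upto_def)
    qed
  qed
qed

text \<open>
  By Chen's relation \<open>X\<^sub>0\<^sub>t = X\<^sub>0\<^sub>s \<star> X\<^sub>s\<^sub>t\<close>.
\<close>

lemma increment_coefficients:
  assumes F: "F \<in> functional_space N \<gamma> T" and st: "s \<in> {0..T}" "t \<in> {0..T}"
  shows "increment (GL N) (\<lambda>t\<in>{0..T}. coefficients N F 0 t) s t = coefficients N F s t"
proof -
  interpret group "GL N" by (rule group_GL)
  have 0: "0 \<in> {0..T}" using st by auto
  have "coefficients N F 0 t = coefficients N F 0 s \<otimes>\<^bsub>GL N\<^esub> coefficients N F s t"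
    using coefficients_group(3)[OF F 0 st] by simp
  then show ?thesis
    using st coefficients_group(1)[OF F 0 st(1)] coefficients_group(1)[OF F st]
    by (simp add: increment_def m_assoc[symmetric] del: atLeastAtMost_iff)
qed

text \<open>
  The inverse sends a functional to the path of its coefficients at \<open>(0, t)\<close>; no information is lost
  because paths start at the unit.
\<close>

lemma functional_of_path_bij:
  assumes T: "0 \<le> T"
  shows "bij_betw (functional_of_path N T)
    (path_space N \<gamma> T :: (real \<Rightarrow> 'd series) set) (functional_space N \<gamma> T)"
proof (rule bij_betw_byWitness[where f' = "\<lambda>F. \<lambda>t\<in>{0..T}. coefficients N F 0 t"])
  let ?I = "functional_of_path N T :: (real \<Rightarrow> 'd series) \<Rightarrow> _"
  let ?J = "\<lambda>F :: real \<times> real \<Rightarrow> 'd series \<Rightarrow> real. \<lambda>t\<in>{0..T}. coefficients N F 0 t"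
  have 0: "0 \<in> {0..T}" using T by simp
  show "\<forall>X\<in>path_space N \<gamma> T. ?J (?I X) = X"
  proof
    fix X :: "real \<Rightarrow> 'd series"
    assume X: "X \<in> path_space N \<gamma> T"
    have "coefficients N (?I X) 0 t \<zeta> = X t \<zeta>" if t: "t \<in> {0..T}" for t \<zeta>
    proof (cases "\<zeta> \<in> degree_upto N")
      case True
      have "increment (GL N) X 0 t = X t"
        using path_spaceD[OF X] t by (intro increment_from_one group_GL) (simp_all add: one_GL)
      then show ?thesis
        using True by (simp add: coefficients_def functional_of_path_basis_vec[OF 0 t])
    next
      case False
      then show ?thesis using path_spaceD(2)[OF X t]
        by (auto simp: coefficients_def carrier_GL truncated_character_def degree_upto_def)
    qed
    moreover have "X \<in> extensional {0..T}" using X by (auto simp: path_space_def PiE_def)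
    ultimately show "?J (?I X) = X"
      by (intro extensionalityI[where A = "{0..T}"]) auto
  qed
  show "\<forall>F\<in>functional_space N \<gamma> T. ?I (?J F) = F"
  proof
    fix F :: "real \<times> real \<Rightarrow> 'd series \<Rightarrow> real"
    assume F: "F \<in> functional_space N \<gamma> T"
    note PiE = functional_spaceD(1)[OF F]
    show "?I (?J F) = F"
    proof (rule extensionalityI[where A = "{0..T} \<times> {0..T}"])
      fix p assume p: "p \<in> {0..T} \<times> {0..T}"
      then obtain s t where st: "p = (s, t)" "s \<in> {0..T}" "t \<in> {0..T}" by blast
      have dual: "F (s, t) \<in> alg_dual (free_space (degree_upto N))" using PiE p st by auto
      have "?I (?J F) (s, t) = (\<lambda>y\<in>free_space (degree_upto N). pairing y (coefficients N F s t))"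
        using st(2,3) by (simp add: functional_of_path_def increment_coefficients[OF F])
      also have "\<dots> = F (s, t)"
      proof (rule extensionalityI[where A = "free_space (degree_upto N)"])
        show "F (s, t) \<in> extensional (free_space (degree_upto N))" using dual by (simp add: alg_dual_def)
        fix y :: "'d series"
        assume y: "y \<in> free_space (degree_upto N)"
        have "pairing y (coefficients N F s t) = pairing y (\<lambda>b. F (s, t) (basis_vec b))"
          using y unfolding pairing_def
          by (intro sum.cong) (auto simp: free_space_def coefficients_def)
        then show "(\<lambda>y\<in>free_space (degree_upto N). pairing y (coefficients N F s t)) y = F (s, t) y"
          using y alg_dual_expand[OF dual y] by simp
      qed simp
      finally show "?I (?J F) p = F p" using st by simp
    qed (use PiE in \<open>auto simp: functional_of_path_def PiE_def\<close>)
  qed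
  show "?I ` path_space N \<gamma> T \<subseteq> functional_space N \<gamma> T"
    using functional_of_path_in_functional_space by blast
  show "?J ` functional_space N \<gamma> T \<subseteq> path_space N \<gamma> T"
  proof (rule image_subsetI)
    fix F :: "real \<times> real \<Rightarrow> 'd series \<Rightarrow> real"
    assume F: "F \<in> functional_space N \<gamma> T"
    show "?J F \<in> path_space N \<gamma> T"
      unfolding path_space_def
    proof (intro CollectI conjI)
      show "?J F \<in> {0..T} \<rightarrow>\<^sub>E carrier (GL N)"
        using coefficients_group(1)[OF F 0] by auto
      show "?J F 0 = unit_series"
        using coefficients_group(2)[OF F 0] T by (simp add: one_GL)
      show "graded_bounded N (simplex T) (gauge \<gamma>) (\<lambda>(s, t). increment (GL N) (?J F) s t)"
        unfolding graded_bounded_def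
      proof (intro allI impI)
        fix \<zeta> :: "'d forest"
        assume \<zeta>: "enat (forest_size \<zeta>) \<le> N"
        have "hbound (off_diagonal T) (gauge \<gamma>) (forest_size \<zeta>) (\<lambda>p. F p (basis_vec \<zeta>))"
          using \<zeta> by (intro functional_spaceD(6)[OF F]) (simp add: degree_upto_def)
        then have "hbound (simplex T) (gauge \<gamma>) (forest_size \<zeta>) (\<lambda>p. F p (basis_vec \<zeta>))"
          using simplex_subset unfolding hbound_def by blast
        then show "hbound (simplex T) (gauge \<gamma>) (forest_size \<zeta>)
            (\<lambda>p. (\<lambda>(s, t). increment (GL N) (?J F) s t) p \<zeta>)"
        proof (rule hbound_transfer)
          fix p assume "p \<in> simplex T"
          then obtain s t where st: "p = (s, t)" "s \<in> {0..T}" "t \<in> {0..T}" by (auto simp: simplex_def)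
          show "(\<lambda>(s, t). increment (GL N) (?J F) s t) p \<zeta> = F p (basis_vec \<zeta>)"
            using \<zeta> by (simp only: st prod.case increment_coefficients[OF F st(2,3)])
              (simp add: coefficients_def degree_upto_def)
        qed
      qed
    qed
  qed
qed

section \<open>Extension to all degrees\<close>

lemma carrier_GL_infinity: "g \<in> carrier (GL \<infinity>) \<longleftrightarrow> character g"
  by (auto simp: carrier_GL truncated_character_iff)

lemma increment_GL_cutoff:
  assumes "character (X s)" "character (X t)" "x s = cutoff N (X s)" "x t = cutoff N (X t)"
  shows "increment (GL N) x s t = cutoff N (increment (GL \<infinity>) X s t)"
proof -
  have "increment (GL N) x s t = increment (GL N) (\<lambda>t. cutoff N (X t)) s t"
    by (simp add: increment_def assms(3,4))
  also have "\<dots> = cutoff N (increment (GL \<infinity>) X s t)"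
    by (rule increment_cutoff) (simp_all add: carrier_GL_infinity assms(1,2))
  finally show ?thesis .
qed

lemma increment_cutoff_cong:
  assumes "character (X s)" "character (X t)" "character (X' s)" "character (X' t)"
    and "cutoff N (X' s) = cutoff N (X s)" "cutoff N (X' t) = cutoff N (X t)"
  shows "cutoff N (increment (GL \<infinity>) X' s t) = cutoff N (increment (GL \<infinity>) X s t)"
  using increment_GL_cutoff[where x = "\<lambda>t. cutoff N (X t)" and X = X and s = s and t = t and N = N]
    increment_GL_cutoff[where x = "\<lambda>t. cutoff N (X t)" and X = X' and s = s and t = t and N = N] assms
  by simp

lemma character_increment:
  "character (X s) \<Longrightarrow> character (X t) \<Longrightarrow> character (increment (GL \<infinity>) X s t)"
  using increment_closed[where G = "GL \<infinity>" and X = X and s = s and t = t]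
  by (simp add: carrier_GL_infinity group_GL)

lemma star_increment:
  assumes "character (X s)" "character (X t)"
  shows "star (X s) (increment (GL \<infinity>) X s t) = X t"
proof -
  interpret group "GL \<infinity>" by (rule group_GL)
  have "X s \<in> carrier (GL \<infinity>)" "X t \<in> carrier (GL \<infinity>)"
    using assms by (simp_all add: carrier_GL_infinity)
  then have "X s \<otimes>\<^bsub>GL \<infinity>\<^esub> increment (GL \<infinity>) X s t = X t"
    by (simp add: increment_def m_assoc[symmetric])
  then show ?thesis by (simp add: mult_GL)
qed

lemma chen:
  assumes "character (X s)" "character (X u)" "character (X t)"
  shows "star (increment (GL \<infinity>) X s u) (increment (GL \<infinity>) X u t) = increment (GL \<infinity>) X s t"
  using increment_mult[where G = "GL \<infinity>" and X = X and s = s and u = u and t = t] assms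
  by (simp add: group_GL carrier_GL_infinity mult_GL)

lemma increment_diag: "character (X t) \<Longrightarrow> increment (GL \<infinity>) X t t = unit_series"
  using increment_self[where G = "GL \<infinity>" and X = X and t = t]
  by (simp add: group_GL carrier_GL_infinity one_GL)

text \<open>
  In \<open>X\<^sub>t = X\<^sub>s \<star> X\<^sub>s\<^sub>t\<close> the terms of degree \<open>m + 1\<close> enter linearly, and all others are shared by the two
  paths.
\<close>

lemma increment_next_degree:
  assumes chr: "character (X s)" "character (X t)" "character (X' s)" "character (X' t)"
    and agree: "cutoff (enat m) (X' s) = cutoff (enat m) (X s)" "cutoff (enat m) (X' t) = cutoff (enat m) (X t)"
    and \<zeta>: "forest_size \<zeta> = Suc m"
  shows "increment (GL \<infinity>) X' s t \<zeta> - increment (GL \<infinity>) X s t \<zeta> =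
    (X' t \<zeta> - X t \<zeta>) - (X' s \<zeta> - X s \<zeta>)"
proof -
  let ?z = "increment (GL \<infinity>) X s t" and ?z' = "increment (GL \<infinity>) X' s t"
  have ne: "\<zeta> \<noteq> {#}" using \<zeta> by auto
  have zz: "cutoff (enat m) ?z' = cutoff (enat m) ?z"
    by (rule increment_cutoff_cong[OF chr agree])
  have one: "X s {#} = 1" "X' s {#} = 1" "?z {#} = 1" "?z' {#} = 1"
    using chr by (simp_all add: character_empty[of "X s"] character_empty[of "X' s"]
        character_empty[OF character_increment])
  have "X' t \<zeta> = X' s \<zeta> + ?z' \<zeta> + proper_cuts \<zeta> (\<lambda>a b. X' s a * ?z' b)"
    using star_increment[OF chr(3,4)] star_split[OF ne, of "X' s" ?z'] one by simp
  moreover have "X t \<zeta> = X s \<zeta> + ?z \<zeta> + proper_cuts \<zeta> (\<lambda>a b. X s a * ?z b)"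
    using star_increment[OF chr(1,2)] star_split[OF ne, of "X s" ?z] one by simp
  moreover have "proper_cuts \<zeta> (\<lambda>a b. X' s a * ?z' b) = proper_cuts \<zeta> (\<lambda>a b. X s a * ?z b)"
    by (rule proper_cuts_cong) (use agree(1) zz \<zeta> in \<open>simp add: cutoff_eq_iff\<close>)
  ultimately show ?thesis by simp
qed

text \<open>
  Induction over the degree: at each new degree \<open>m + 1\<close> the difference of the two paths is a function
  whose increments are of order \<open>\<gamma> (m + 1) > 1\<close>, hence constant, and it starts at zero.
\<close>

lemma path_space_infinity_unique:
  fixes X X' :: "real \<Rightarrow> 'd series"
  assumes X: "X \<in> path_space \<infinity> \<gamma> T" and X': "X' \<in> path_space \<infinity> \<gamma> T"
    and \<gamma>: "0 < \<gamma>" "1 < \<gamma> * real (Suc n)"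
    and agree: "\<And>t. t \<in> {0..T} \<Longrightarrow> cutoff (enat n) (X' t) = cutoff (enat n) (X t)"
  shows "X' = X"
proof -
  have chr: "character (X t)" "character (X' t)" if "t \<in> {0..T}" for t
    using path_spaceD(2)[OF X that] path_spaceD(2)[OF X' that] by (simp_all add: carrier_GL_infinity)
  have step: "X' t \<zeta> = X t \<zeta>"
    if m: "n \<le> m" and IH: "\<And>t. t \<in> {0..T} \<Longrightarrow> cutoff (enat m) (X' t) = cutoff (enat m) (X t)"
      and \<zeta>: "forest_size \<zeta> = Suc m" and t: "t \<in> {0..T}" for m \<zeta> t
  proof -
    define D where "D t = X' t \<zeta> - X t \<zeta>" for t
    let ?z = "\<lambda>(s, t). increment (GL \<infinity>) X s t" and ?z' = "\<lambda>(s, t). increment (GL \<infinity>) X' s t"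
    have "hbound (simplex T) (gauge \<gamma>) (forest_size \<zeta>) (\<lambda>p. ?z' p \<zeta> - ?z p \<zeta>)"
      by (intro hbound_diff graded_boundedD[OF path_spaceD(3)[OF X]] graded_boundedD[OF path_spaceD(3)[OF X']]) simp_all
    then obtain C where C: "\<And>p. p \<in> simplex T \<Longrightarrow> \<bar>?z' p \<zeta> - ?z p \<zeta>\<bar> \<le> C * gauge \<gamma> p ^ Suc m"
      unfolding hbound_def \<zeta> by blast
    have "D t = D 0"
    proof (rule additive_small_constant)
      have "\<gamma> * real (Suc n) \<le> \<gamma> * real (Suc m)" using m \<gamma> by (intro mult_left_mono) auto
      with \<gamma>(2) show "1 < \<gamma> * real (Suc m)" by (rule less_le_trans)
      fix s t assume st: "0 \<le> s" "s \<le> t" "t \<le> T"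
      then have mem: "s \<in> {0..T}" "t \<in> {0..T}" by auto
      show "\<bar>D t - D s\<bar> \<le> C * (t - s) powr (\<gamma> * real (Suc m))"
      proof (cases "s = t")
        case False
        then have "\<bar>?z' (s, t) \<zeta> - ?z (s, t) \<zeta>\<bar> \<le> C * gauge \<gamma> (s, t) ^ Suc m"
          using st by (intro C) (simp add: simplex_def)
        moreover have "?z' (s, t) \<zeta> - ?z (s, t) \<zeta> = D t - D s"
          using increment_next_degree[of X s t X' m \<zeta>, OF chr(1)[OF mem(1)] chr(1)[OF mem(2)]
              chr(2)[OF mem(1)] chr(2)[OF mem(2)] IH[OF mem(1)] IH[OF mem(2)] \<zeta>]
          by (simp add: D_def)
        ultimately show ?thesis using False st gauge_power[of s t \<gamma> "Suc m"] by simp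
      qed simp
    qed (use t in auto)
    then show ?thesis
      using path_spaceD(1)[OF X] path_spaceD(1)[OF X'] by (simp add: D_def)
  qed
  have all: "cutoff (enat (n + k)) (X' t) = cutoff (enat (n + k)) (X t)" if "t \<in> {0..T}" for k t
    using that
  proof (induction k arbitrary: t)
    case 0
    then show ?case using agree by simp
  next
    case (Suc k)
    show ?case
      unfolding cutoff_eq_iff
    proof (intro allI impI)
      fix \<zeta> :: "'d forest"
      assume "enat (forest_size \<zeta>) \<le> enat (n + Suc k)"
      then consider "forest_size \<zeta> \<le> n + k" | "forest_size \<zeta> = Suc (n + k)" by force
      then show "X' t \<zeta> = X t \<zeta>"
      proof cases
        case 1
        then show ?thesis using Suc by (simp add: cutoff_eq_iff)
      next
        case 2
        then show ?thesis using step[of "n + k" \<zeta> t] Suc by simp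
      qed
    qed
  qed
  have "X' t = X t" if "t \<in> {0..T}" for t
  proof
    fix \<zeta>
    show "X' t \<zeta> = X t \<zeta>" using all[OF that, of "forest_size \<zeta>"] by (simp add: cutoff_eq_iff)
  qed
  moreover have "X \<in> extensional {0..T}" "X' \<in> extensional {0..T}"
    using X X' by (auto simp: path_space_def PiE_def)
  ultimately show ?thesis by (intro extensionalityI[where A = "{0..T}"]) auto
qed

text \<open>
  A path of full characters that is graded bounded up to degree \<open>N\<close> only. Working with these instead of truncated
  characters keeps Chen's relation valid in all degrees, including those not yet controlled.
\<close>

definition character_path :: "enat \<Rightarrow> real \<Rightarrow> real \<Rightarrow> (real \<Rightarrow> 'd series) \<Rightarrow> bool" where
  "character_path N \<gamma> T X \<longleftrightarrow> (\<forall>t\<in>{0..T}. character (X t)) \<and> X 0 = unit_series \<and>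
     graded_bounded N (simplex T) (gauge \<gamma>) (\<lambda>(s, t). increment (GL \<infinity>) X s t)"

text \<open>
  Chen's relation at degree \<open>m + 1\<close> says that the defect of additivity is the reduced coproduct applied
  to the increments over \<open>[s, u]\<close> and \<open>[u, t]\<close>. It involves only the degrees that are already
  controlled.
\<close>

lemma defect_bound:
  fixes X :: "real \<Rightarrow> 'd series"
  assumes X: "character_path (enat m) \<gamma> T X" and \<zeta>: "forest_size \<zeta> = Suc m" and \<gamma>: "0 < \<gamma>"
  shows "\<exists>C. \<forall>s u t. 0 \<le> s \<longrightarrow> s \<le> u \<longrightarrow> u \<le> t \<longrightarrow> t \<le> T \<longrightarrow>
    \<bar>increment (GL \<infinity>) X s t \<zeta> - increment (GL \<infinity>) X s u \<zeta> - increment (GL \<infinity>) X u t \<zeta>\<bar>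
      \<le> C * (t - s) powr (\<gamma> * real (Suc m))"
proof -
  let ?z = "increment (GL \<infinity>) X"
  have chr: "character (X t)" if "t \<in> {0..T}" for t using X that by (simp add: character_path_def)
  define S where "S = {(s, u, t). 0 \<le> s \<and> s \<le> u \<and> u \<le> t \<and> t \<le> T}"
  define h where "h = (\<lambda>(s :: real, u :: real, t :: real). (t - s) powr \<gamma>)"
  have sub: "\<exists>C. \<forall>s u v. 0 \<le> s \<longrightarrow> s \<le> u \<longrightarrow> u \<le> T \<longrightarrow> u - s \<le> v \<longrightarrow> \<bar>?z s u a\<bar> \<le> C * (v powr \<gamma>) ^ forest_size a"
    if a: "forest_size a \<le> m" for a
  proof -
    have "hbound (simplex T) (gauge \<gamma>) (forest_size a) (\<lambda>p. (\<lambda>(s, t). ?z s t) p a)"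
      using X a by (intro graded_boundedD[where N = "enat m"]) (simp_all add: character_path_def)
    then obtain C where C: "\<And>p. p \<in> simplex T \<Longrightarrow> \<bar>(\<lambda>(s, t). ?z s t) p a\<bar> \<le> C * gauge \<gamma> p ^ forest_size a"
      unfolding hbound_def by blast
    (* The 1 takes care of the degenerate interval s = u, where the increment is the unit. *)
    have "\<bar>?z s u a\<bar> \<le> max \<bar>C\<bar> 1 * (v powr \<gamma>) ^ forest_size a"
      if su: "0 \<le> s" "s \<le> u" "u \<le> T" "u - s \<le> v" for s u v
    proof (cases "s = u")
      case True
      then have "?z s u = unit_series" using su by (auto intro!: increment_diag chr)
      then show ?thesis by (auto simp: unit_series_apply)
    next
      case False
      have "\<bar>?z s u a\<bar> \<le> C * gauge \<gamma> (s, u) ^ forest_size a"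
        using C[of "(s, u)"] su False by (simp add: simplex_def)
      also have "\<dots> \<le> max \<bar>C\<bar> 1 * gauge \<gamma> (s, u) ^ forest_size a"
        by (intro mult_right_mono) (auto simp: gauge_def)
      also have "\<dots> \<le> max \<bar>C\<bar> 1 * (v powr \<gamma>) ^ forest_size a"
        using su \<gamma> by (intro mult_left_mono power_mono) (auto simp: gauge_def intro!: powr_mono2)
      finally show ?thesis .
    qed
    then show ?thesis by blast
  qed
  have left: "hbound S h (forest_size a) (\<lambda>i. (\<lambda>(s, u, t). ?z s u) i a)" if "forest_size a < forest_size \<zeta>" for a
  proof -
    have "forest_size a \<le> m" using that \<zeta> by simp
    from sub[OF this] obtain C where C':
      "\<forall>s u v. 0 \<le> s \<longrightarrow> s \<le> u \<longrightarrow> u \<le> T \<longrightarrow> u - s \<le> v \<longrightarrow> \<bar>?z s u a\<bar> \<le> C * (v powr \<gamma>) ^ forest_size a" ..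
    have C: "\<bar>?z s u a\<bar> \<le> C * (v powr \<gamma>) ^ forest_size a"
      if "0 \<le> s" "s \<le> u" "u \<le> T" "u - s \<le> v" for s u v
      using C'[rule_format, OF that] .
    show ?thesis
    proof (rule hboundI)
      fix i assume "i \<in> S"
      then obtain s u t where "i = (s, u, t)" "0 \<le> s" "s \<le> u" "u \<le> t" "t \<le> T" by (auto simp: S_def)
      then show "\<bar>(\<lambda>(s, u, t). ?z s u) i a\<bar> \<le> C * h i ^ forest_size a"
        using C[of s u "t - s"] by (simp add: h_def)
    qed
  qed
  have right: "hbound S h (forest_size a) (\<lambda>i. (\<lambda>(s, u, t). ?z u t) i a)" if "forest_size a < forest_size \<zeta>" for a
  proof -
    have "forest_size a \<le> m" using that \<zeta> by simp
    from sub[OF this] obtain C where C':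
      "\<forall>s u v. 0 \<le> s \<longrightarrow> s \<le> u \<longrightarrow> u \<le> T \<longrightarrow> u - s \<le> v \<longrightarrow> \<bar>?z s u a\<bar> \<le> C * (v powr \<gamma>) ^ forest_size a" ..
    have C: "\<bar>?z s u a\<bar> \<le> C * (v powr \<gamma>) ^ forest_size a"
      if "0 \<le> s" "s \<le> u" "u \<le> T" "u - s \<le> v" for s u v
      using C'[rule_format, OF that] .
    show ?thesis
    proof (rule hboundI)
      fix i assume "i \<in> S"
      then obtain s u t where "i = (s, u, t)" "0 \<le> s" "s \<le> u" "u \<le> t" "t \<le> T" by (auto simp: S_def)
      then show "\<bar>(\<lambda>(s, u, t). ?z u t) i a\<bar> \<le> C * h i ^ forest_size a"
        using C[of u t "t - s"] by (simp add: h_def)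
    qed
  qed
  have "hbound S h (forest_size \<zeta>)
      (\<lambda>i. proper_cuts \<zeta> (\<lambda>a b. (\<lambda>(s, u, t). ?z s u) i a * (\<lambda>(s, u, t). ?z u t) i b))"
    by (rule hbound_proper_cuts[OF left right])
  then obtain C where
    C: "\<And>i. i \<in> S \<Longrightarrow> \<bar>proper_cuts \<zeta> (\<lambda>a b. (\<lambda>(s, u, t). ?z s u) i a * (\<lambda>(s, u, t). ?z u t) i b)\<bar> \<le> C * h i ^ Suc m"
    unfolding hbound_def \<zeta> by blast
  have "\<bar>?z s t \<zeta> - ?z s u \<zeta> - ?z u t \<zeta>\<bar> \<le> C * (t - s) powr (\<gamma> * real (Suc m))"
    if sut: "0 \<le> s" "s \<le> u" "u \<le> t" "t \<le> T" for s u t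
  proof -
    have "s \<in> {0..T}" "u \<in> {0..T}" "t \<in> {0..T}" using sut by auto
    note c = this[THEN chr]
    have ne: "\<zeta> \<noteq> {#}" using \<zeta> by auto
    have "?z s t \<zeta> = ?z s u \<zeta> + ?z u t \<zeta> + proper_cuts \<zeta> (\<lambda>a b. ?z s u a * ?z u t b)"
      using chen[of X s u t, OF c] star_split[OF ne, of "?z s u" "?z u t"]
        character_empty[OF character_increment[of X s u, OF c(1,2)]]
        character_empty[OF character_increment[of X u t, OF c(2,3)]] by simp
    moreover have "\<bar>proper_cuts \<zeta> (\<lambda>a b. ?z s u a * ?z u t b)\<bar> \<le> C * ((t - s) powr \<gamma>) ^ Suc m"
      using C[of "(s, u, t)"] sut by (simp add: S_def h_def)
    moreover have "((t - s) powr \<gamma>) ^ Suc m = (t - s) powr (\<gamma> * real (Suc m))"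
      by (rule powr_power_nonneg) (use sut in auto)
    ultimately show ?thesis by simp
  qed
  then show ?thesis by blast
qed

text \<open>
  The path is changed at the trees of degree \<open>m + 1\<close> by the functions from the sewing lemma, and
  extended multiplicatively. Forests of degree \<open>m + 1\<close> that are not trees need no separate treatment:
  they are products of forests of lower degree.
\<close>

lemma extend_one_degree:
  fixes X :: "real \<Rightarrow> 'd series"
  assumes X: "character_path (enat m) \<gamma> T X" and \<gamma>: "0 < \<gamma>" "1 < \<gamma> * real (Suc m)" and T: "0 \<le> T"
  shows "\<exists>X'. character_path (enat (Suc m)) \<gamma> T X' \<and>
    (\<forall>t\<in>{0..T}. cutoff (enat m) (X' t) = cutoff (enat m) (X t))"
proof -
  let ?z = "increment (GL \<infinity>) X"
  have chr: "character (X t)" if "t \<in> {0..T}" for t using X that by (simp add: character_path_def)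
  have "\<exists>f K. \<forall>s t. 0 \<le> s \<longrightarrow> s \<le> t \<longrightarrow> t \<le> T \<longrightarrow>
      \<bar>?z s t {#\<tau>#} - (f t - f s)\<bar> \<le> K * (t - s) powr (\<gamma> * real (Suc m))"
    if "tree_size \<tau> = Suc m" for \<tau> :: "'d rtree"
  proof -
    have "\<exists>C. \<forall>s u t. 0 \<le> s \<longrightarrow> s \<le> u \<longrightarrow> u \<le> t \<longrightarrow> t \<le> T \<longrightarrow>
      \<bar>?z s t {#\<tau>#} - ?z s u {#\<tau>#} - ?z u t {#\<tau>#}\<bar> \<le> C * (t - s) powr (\<gamma> * real (Suc m))"
      by (rule defect_bound[OF X _ \<gamma>(1)]) (simp add: that)
    then obtain C where C: "\<forall>s u t. 0 \<le> s \<longrightarrow> s \<le> u \<longrightarrow> u \<le> t \<longrightarrow> t \<le> T \<longrightarrow>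
      \<bar>?z s t {#\<tau>#} - ?z s u {#\<tau>#} - ?z u t {#\<tau>#}\<bar> \<le> C * (t - s) powr (\<gamma> * real (Suc m))" by blast
    show ?thesis by (rule sewing[OF \<gamma>(2), where C = C]) (use C in blast)
  qed
  then obtain f K where f: "\<And>\<tau> s t. tree_size \<tau> = Suc m \<Longrightarrow> 0 \<le> s \<Longrightarrow> s \<le> t \<Longrightarrow> t \<le> T \<Longrightarrow>
      \<bar>?z s t {#\<tau>#} - (f \<tau> t - f \<tau> s)\<bar> \<le> K \<tau> * (t - s) powr (\<gamma> * real (Suc m))"
    by metis
  define X' where "X' t = from_trees (\<lambda>\<tau>. X t {#\<tau>#} - (if tree_size \<tau> = Suc m then f \<tau> t - f \<tau> 0 else 0))" for t
  let ?z' = "increment (GL \<infinity>) X'"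
  have chr': "character (X' t)" for t by (simp add: X'_def character_from_trees)
  have agree: "cutoff (enat m) (X' t) = cutoff (enat m) (X t)" if "t \<in> {0..T}" for t
    unfolding cutoff_eq_iff
  proof (intro allI impI)
    fix \<zeta> :: "'d forest"
    assume \<zeta>: "enat (forest_size \<zeta>) \<le> enat m"
    show "X' t \<zeta> = X t \<zeta>"
      by (rule character_eqI[OF chr' chr[OF that]]) (use \<zeta> in \<open>simp add: X'_def\<close>)
  qed
  have agree_increment: "cutoff (enat m) (?z' s t) = cutoff (enat m) (?z s t)"
    if "s \<in> {0..T}" "t \<in> {0..T}" for s t
    using that by (intro increment_cutoff_cong chr chr' agree)
  have "X' 0 \<zeta> = unit_series \<zeta>" for \<zeta>
    by (rule character_eqI[OF chr' character_unit]) (use X in \<open>simp add: X'_def character_path_def\<close>)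
  then have start: "X' 0 = unit_series" ..
  have "graded_bounded (enat (Suc m)) (simplex T) (gauge \<gamma>) (\<lambda>p. cutoff (enat (Suc m)) ((\<lambda>(s, t). ?z' s t) p))"
  proof (rule graded_bounded_truncated_character)
    fix p
    show "truncated_character (enat (Suc m)) (cutoff (enat (Suc m)) ((\<lambda>(s, t). ?z' s t) p))"
      unfolding truncated_character_iff
      by (cases p) (use character_increment[of X', OF chr' chr'] in auto)
  next
    fix \<tau> :: "'d rtree"
    assume \<tau>: "enat (tree_size \<tau>) \<le> enat (Suc m)"
    show "hbound (simplex T) (gauge \<gamma>) (tree_size \<tau>)
        (\<lambda>p. cutoff (enat (Suc m)) ((\<lambda>(s, t). ?z' s t) p) {#\<tau>#})"
    proof (cases "tree_size \<tau> = Suc m")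
      case True
      show ?thesis
      proof (rule hboundI)
        fix p assume "p \<in> simplex T"
        then obtain s t where st: "p = (s, t)" "s \<in> {0..T}" "t \<in> {0..T}" "s < t" by (auto simp: simplex_def)
        have "?z' s t {#\<tau>#} - ?z s t {#\<tau>#} =
            (X' t {#\<tau>#} - X t {#\<tau>#}) - (X' s {#\<tau>#} - X s {#\<tau>#})"
          by (rule increment_next_degree[of X s t X' m]) (use st True chr chr' agree in auto)
        then have "?z' s t {#\<tau>#} = ?z s t {#\<tau>#} - (f \<tau> t - f \<tau> s)"
          using True by (simp add: X'_def)
        then have "\<bar>?z' s t {#\<tau>#}\<bar> \<le> K \<tau> * (t - s) powr (\<gamma> * real (Suc m))"
          using f[OF True, of s t] st by simp
        then show "\<bar>cutoff (enat (Suc m)) ((\<lambda>(s, t). ?z' s t) p) {#\<tau>#}\<bar> \<le> K \<tau> * gauge \<gamma> p ^ tree_size \<tau>"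
          using st True gauge_power[of s t \<gamma> "Suc m"] by (simp add: cutoff_def)
      qed
    next
      case False
      with \<tau> have le: "tree_size \<tau> \<le> m" by simp
      have "hbound (simplex T) (gauge \<gamma>) (forest_size {#\<tau>#}) (\<lambda>p. (\<lambda>(s, t). ?z s t) p {#\<tau>#})"
        using X le by (intro graded_boundedD[where N = "enat m"]) (simp_all add: character_path_def)
      then have "hbound (simplex T) (gauge \<gamma>) (tree_size \<tau>) (\<lambda>p. (\<lambda>(s, t). ?z s t) p {#\<tau>#})" by simp
      then show ?thesis
      proof (rule hbound_transfer)
        fix p assume "p \<in> simplex T"
        then obtain s t where st: "p = (s, t)" "s \<in> {0..T}" "t \<in> {0..T}" by (auto simp: simplex_def)
        show "cutoff (enat (Suc m)) ((\<lambda>(s, t). ?z' s t) p) {#\<tau>#} = (\<lambda>(s, t). ?z s t) p {#\<tau>#}"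
          using agree_increment[OF st(2,3)] le \<tau> by (simp add: st cutoff_eq_iff cutoff_def[of "enat (Suc m)"])
      qed
    qed
  qed
  then have "graded_bounded (enat (Suc m)) (simplex T) (gauge \<gamma>) (\<lambda>(s, t). ?z' s t)"
    by (simp only: graded_bounded_cutoff)
  then have "character_path (enat (Suc m)) \<gamma> T X'"
    using chr' start by (simp add: character_path_def)
  with agree show ?thesis by blast
qed

text \<open>
  The extensions \<open>F k\<close> up to degree \<open>n + k\<close> agree on their common range, so taking the value at \<open>\<zeta>\<close> from
  \<open>F \<bar>\<zeta>\<bar>\<close> gives a path that agrees with each \<open>F k\<close> up to degree \<open>n + k\<close>.
\<close>

lemma extend_all_degrees:
  fixes X :: "real \<Rightarrow> 'd series"
  assumes X: "character_path (enat n) \<gamma> T X" and \<gamma>: "0 < \<gamma>" "1 < \<gamma> * real (Suc n)" and T: "0 \<le> T"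
  shows "\<exists>Y. character_path \<infinity> \<gamma> T Y \<and> (\<forall>t\<in>{0..T}. cutoff (enat n) (Y t) = cutoff (enat n) (X t))"
proof -
  define P where "P k Y \<longleftrightarrow> character_path (enat (n + k)) \<gamma> T Y \<and>
    (\<forall>t\<in>{0..T}. cutoff (enat n) (Y t) = cutoff (enat n) (X t))" for k and Y :: "real \<Rightarrow> 'd series"
  define Q where "Q k Y Y' \<longleftrightarrow> (\<forall>t\<in>{0..T}. cutoff (enat (n + k)) (Y' t) = cutoff (enat (n + k)) (Y t))"
    for k and Y Y' :: "real \<Rightarrow> 'd series"
  have "\<exists>F. \<forall>k. P k (F k) \<and> Q k (F k) (F (Suc k))"
  proof (rule dependent_nat_choice)
    show "\<exists>Y. P 0 Y" using X by (auto simp: P_def)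
    fix Y k assume Y: "P k Y"
    have "\<gamma> * real (Suc n) \<le> \<gamma> * real (Suc (n + k))" using \<gamma> by (intro mult_left_mono) auto
    with \<gamma>(2) have "1 < \<gamma> * real (Suc (n + k))" by (rule less_le_trans)
    then obtain Y' where Y': "character_path (enat (Suc (n + k))) \<gamma> T Y'" "Q k Y Y'"
      using extend_one_degree[of "n + k" \<gamma> T Y] Y \<gamma> T unfolding P_def Q_def by blast
    have "cutoff (enat n) (Y' t) = cutoff (enat n) (X t)" if "t \<in> {0..T}" for t
      using that Y Y'(2) by (auto simp: P_def Q_def cutoff_eq_iff)
    then show "\<exists>Y'. P (Suc k) Y' \<and> Q k Y Y'" using Y' by (auto simp: P_def)
  qed
  then obtain F where F: "\<And>k. P k (F k)" "\<And>k. Q k (F k) (F (Suc k))" by blast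
  have mono: "F (k + l) t \<zeta> = F k t \<zeta>" if "t \<in> {0..T}" "forest_size \<zeta> \<le> n + k" for k l t \<zeta>
  proof (induction l)
    case (Suc l)
    have "F (Suc (k + l)) t \<zeta> = F (k + l) t \<zeta>"
      using F(2)[of "k + l"] that by (simp add: Q_def cutoff_eq_iff)
    then show ?case using Suc by simp
  qed simp
  define Y where "Y t \<zeta> = F (forest_size \<zeta>) t \<zeta>" for t \<zeta>
  have Y: "Y t \<zeta> = F k t \<zeta>" if "t \<in> {0..T}" "forest_size \<zeta> \<le> n + k" for k t \<zeta>
  proof (cases "k \<le> forest_size \<zeta>")
    case True
    then show ?thesis using mono[of t \<zeta> k "forest_size \<zeta> - k"] that by (simp add: Y_def)
  next
    case False
    then show ?thesis using mono[of t \<zeta> "forest_size \<zeta>" "k - forest_size \<zeta>"] that by (simp add: Y_def)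
  qed
  have chrF: "character (F k t)" if "t \<in> {0..T}" for k t
    using F(1)[of k] that by (simp add: P_def character_path_def)
  have chrY: "character (Y t)" if t: "t \<in> {0..T}" for t
    unfolding character_def
  proof (intro conjI allI)
    show "Y t {#} = 1" using character_empty[OF chrF[OF t]] by (simp add: Y_def)
    fix a b :: "'d forest"
    let ?k = "forest_size a + forest_size b"
    show "Y t (a + b) = Y t a * Y t b"
      using Y[OF t, of "a + b" ?k] Y[OF t, of a ?k] Y[OF t, of b ?k] character_plus[OF chrF[OF t]] by simp
  qed
  have agree: "cutoff (enat (n + k)) (Y t) = cutoff (enat (n + k)) (F k t)" if "t \<in> {0..T}" for t k
    using Y[OF that] by (simp add: cutoff_eq_iff)
  have "graded_bounded \<infinity> (simplex T) (gauge \<gamma>) (\<lambda>(s, t). increment (GL \<infinity>) Y s t)"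
    unfolding graded_bounded_def
  proof (intro allI impI)
    fix \<zeta> :: "'d forest"
    let ?k = "forest_size \<zeta>"
    have "hbound (simplex T) (gauge \<gamma>) ?k (\<lambda>p. (\<lambda>(s, t). increment (GL \<infinity>) (F ?k) s t) p \<zeta>)"
      using F(1)[of ?k] by (intro graded_boundedD[where N = "enat (n + ?k)"]) (simp_all add: P_def character_path_def)
    then show "hbound (simplex T) (gauge \<gamma>) ?k (\<lambda>p. (\<lambda>(s, t). increment (GL \<infinity>) Y s t) p \<zeta>)"
    proof (rule hbound_transfer)
      fix p assume "p \<in> simplex T"
      then obtain s t where st: "p = (s, t)" "s \<in> {0..T}" "t \<in> {0..T}" by (auto simp: simplex_def)
      have "cutoff (enat (n + ?k)) (increment (GL \<infinity>) Y s t) = cutoff (enat (n + ?k)) (increment (GL \<infinity>) (F ?k) s t)"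
        using st by (intro increment_cutoff_cong chrF chrY agree)
      then show "(\<lambda>(s, t). increment (GL \<infinity>) Y s t) p \<zeta> = (\<lambda>(s, t). increment (GL \<infinity>) (F ?k) s t) p \<zeta>"
        by (simp add: st cutoff_eq_iff)
    qed
  qed
  moreover have "Y 0 = unit_series"
    using F(1) by (auto simp: Y_def P_def character_path_def fun_eq_iff)
  moreover have "cutoff (enat n) (Y t) = cutoff (enat n) (X t)" if "t \<in> {0..T}" for t
    using agree[OF that, of 0] F(1)[of 0] that by (simp add: P_def)
  ultimately show ?thesis using chrY unfolding character_path_def by blast
qed

lemma cutoff_path_bij:
  assumes \<gamma>: "0 < \<gamma>" "1 < \<gamma> * real (Suc n)" and T: "0 \<le> T"
  shows "bij_betw (\<lambda>X. \<lambda>t\<in>{0..T}. cutoff (enat n) (X t))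
    (path_space \<infinity> \<gamma> T :: (real \<Rightarrow> 'd series) set) (path_space (enat n) \<gamma> T)"
  (is "bij_betw ?I _ _")
proof (rule bij_betw_imageI)
  have chr: "character (X t)" if "X \<in> path_space \<infinity> \<gamma> T" "t \<in> {0..T}" for X :: "real \<Rightarrow> 'd series" and t
    using path_spaceD(2)[OF that] by (simp add: carrier_GL_infinity)
  show "inj_on ?I (path_space \<infinity> \<gamma> T)"
  proof (rule inj_onI)
    fix X X' :: "real \<Rightarrow> 'd series"
    assume X: "X \<in> path_space \<infinity> \<gamma> T" "X' \<in> path_space \<infinity> \<gamma> T" and eq: "?I X = ?I X'"
    have "cutoff (enat n) (X t) = cutoff (enat n) (X' t)" if "t \<in> {0..T}" for t
      using fun_cong[OF eq, of t] that by simp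
    then show "X = X'" by (rule path_space_infinity_unique[OF X(2,1) \<gamma>])
  qed
  show "?I ` path_space \<infinity> \<gamma> T = path_space (enat n) \<gamma> T"
  proof (intro equalityI image_subsetI subsetI)
    fix X :: "real \<Rightarrow> 'd series"
    assume X: "X \<in> path_space \<infinity> \<gamma> T"
    have inc: "increment (GL (enat n)) (?I X) s t = cutoff (enat n) (increment (GL \<infinity>) X s t)"
      if "s \<in> {0..T}" "t \<in> {0..T}" for s t
      using that by (intro increment_GL_cutoff chr[OF X]) simp_all
    have "graded_bounded (enat n) (simplex T) (gauge \<gamma>) (\<lambda>(s, t). increment (GL \<infinity>) X s t)"
      using path_spaceD(3)[OF X] by (simp add: graded_bounded_def)
    then have "graded_bounded (enat n) (simplex T) (gauge \<gamma>) (\<lambda>(s, t). increment (GL (enat n)) (?I X) s t)"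
      unfolding graded_bounded_def
    proof (intro allI impI, elim allE impE)
      fix \<zeta> :: "'d forest"
      assume \<zeta>: "enat (forest_size \<zeta>) \<le> enat n"
      assume "hbound (simplex T) (gauge \<gamma>) (forest_size \<zeta>) (\<lambda>i. (\<lambda>(s, t). increment (GL \<infinity>) X s t) i \<zeta>)"
      then show "hbound (simplex T) (gauge \<gamma>) (forest_size \<zeta>) (\<lambda>i. (\<lambda>(s, t). increment (GL (enat n)) (?I X) s t) i \<zeta>)"
      proof (rule hbound_transfer)
        fix p assume "p \<in> simplex T"
        then obtain s t where st: "p = (s, t)" "s \<in> {0..T}" "t \<in> {0..T}" by (auto simp: simplex_def)
        show "(\<lambda>(s, t). increment (GL (enat n)) (?I X) s t) p \<zeta> = (\<lambda>(s, t). increment (GL \<infinity>) X s t) p \<zeta>"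
          using \<zeta> by (simp only: st prod.case inc[OF st(2,3)]) (simp add: cutoff_def)
      qed
    qed
    moreover have "?I X \<in> {0..T} \<rightarrow>\<^sub>E carrier (GL (enat n))"
      using chr[OF X] by (auto intro: cutoff_in_carrier_GL)
    moreover have "?I X 0 = unit_series"
      using T path_spaceD(1)[OF X] by simp
    ultimately show "?I X \<in> path_space (enat n) \<gamma> T" unfolding path_space_def by blast
  next
    fix x :: "real \<Rightarrow> 'd series"
    assume x: "x \<in> path_space (enat n) \<gamma> T"
    have "\<forall>t\<in>{0..T}. \<exists>G. character G \<and> x t = cutoff (enat n) G"
      using path_spaceD(2)[OF x] unfolding carrier_GL truncated_character_iff mem_Collect_eq by blast
    then obtain X0 where X0: "\<And>t. t \<in> {0..T} \<Longrightarrow> character (X0 t) \<and> x t = cutoff (enat n) (X0 t)"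
      by metis
    (* The chosen lift at time 0 need not be the unit; the unit is another lift of the same element. *)
    define X where "X = X0(0 := unit_series)"
    have X: "character (X t)" "x t = cutoff (enat n) (X t)" if "t \<in> {0..T}" for t
      using X0[OF that] path_spaceD(1)[OF x] by (auto simp: X_def character_unit)
    have "graded_bounded (enat n) (simplex T) (gauge \<gamma>) (\<lambda>(s, t). increment (GL \<infinity>) X s t)"
      unfolding graded_bounded_def
    proof (intro allI impI)
      fix \<zeta> :: "'d forest"
      assume \<zeta>: "enat (forest_size \<zeta>) \<le> enat n"
      show "hbound (simplex T) (gauge \<gamma>) (forest_size \<zeta>) (\<lambda>i. (\<lambda>(s, t). increment (GL \<infinity>) X s t) i \<zeta>)"
      proof (rule hbound_transfer[OF graded_boundedD[OF path_spaceD(3)[OF x] \<zeta>]])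
        fix p assume "p \<in> simplex T"
        then obtain s t where st: "p = (s, t)" "s \<in> {0..T}" "t \<in> {0..T}" by (auto simp: simplex_def)
        have "increment (GL (enat n)) x s t = cutoff (enat n) (increment (GL \<infinity>) X s t)"
          using st by (intro increment_GL_cutoff X)
        then show "(\<lambda>(s, t). increment (GL \<infinity>) X s t) p \<zeta> = (\<lambda>(s, t). increment (GL (enat n)) x s t) p \<zeta>"
          using \<zeta> by (simp add: st cutoff_def)
      qed
    qed
    then have "character_path (enat n) \<gamma> T X"
      using X(1) by (simp add: character_path_def) (simp add: X_def)
    then obtain Y where Y: "character_path \<infinity> \<gamma> T Y"
      "\<And>t. t \<in> {0..T} \<Longrightarrow> cutoff (enat n) (Y t) = cutoff (enat n) (X t)"
      using extend_all_degrees[of n \<gamma> T X] \<gamma> T by blast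
    have bd: "graded_bounded \<infinity> (simplex T) (gauge \<gamma>) (\<lambda>(s, t). increment (GL \<infinity>) (restrict Y {0..T}) s t)"
      unfolding graded_bounded_def
    proof (intro allI impI)
      fix \<zeta> :: "'d forest"
      have "graded_bounded \<infinity> (simplex T) (gauge \<gamma>) (\<lambda>(s, t). increment (GL \<infinity>) Y s t)"
        using Y(1) by (simp add: character_path_def)
      then have "hbound (simplex T) (gauge \<gamma>) (forest_size \<zeta>) (\<lambda>i. (\<lambda>(s, t). increment (GL \<infinity>) Y s t) i \<zeta>)"
        by (rule graded_boundedD) simp
      then show "hbound (simplex T) (gauge \<gamma>) (forest_size \<zeta>)
          (\<lambda>i. (\<lambda>(s, t). increment (GL \<infinity>) (restrict Y {0..T}) s t) i \<zeta>)"
        by (rule hbound_transfer) (auto simp: simplex_def increment_def)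
    qed
    have "restrict Y {0..T} \<in> path_space \<infinity> \<gamma> T"
      unfolding path_space_def using Y(1) T bd
      by (auto simp: character_path_def carrier_GL_infinity)
    moreover have "x = ?I (restrict Y {0..T})"
    proof (rule extensionalityI[where A = "{0..T}"])
      show "x \<in> extensional {0..T}" using x by (auto simp: path_space_def PiE_def)
    qed (use X(2) Y(2) in auto)
    ultimately show "x \<in> ?I ` path_space \<infinity> \<gamma> T" by blast
  qed
qed

theorem theorem4p12:
  fixes \<gamma> T :: real
  assumes "0 < \<gamma>" and "\<gamma> < 1" and "0 < T"
  shows
    "bij_betw (I1 \<gamma> T)
       (full_rough_paths \<gamma> T :: (real \<Rightarrow> ('d::finite) series) set)
       (rough_paths \<gamma> T :: (real \<Rightarrow> 'd series) set) \<and>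
     bij_betw (I2 \<gamma> T)
       (rough_paths \<gamma> T :: (real \<Rightarrow> 'd series) set)
       (functional_rough_paths \<gamma> T :: (real \<times> real \<Rightarrow> 'd series \<Rightarrow> real) set) \<and>
     bij_betw (I3 T)
       (full_rough_paths \<gamma> T :: (real \<Rightarrow> 'd series) set)
       (full_functional_rough_paths \<gamma> T :: (real \<times> real \<Rightarrow> 'd series \<Rightarrow> real) set)"
proof (intro conjI)
  let ?n = "rp_order \<gamma>"
  have T: "0 \<le> T" using assms by simp
  have "1 / \<gamma> < real (Suc ?n)"
    unfolding rp_order_def using assms(1) by linarith
  then have n: "1 < \<gamma> * real (Suc ?n)"
    using assms(1) by (simp add: pos_divide_less_eq mult.commute)
  have I1: "I1 \<gamma> T = (\<lambda>X :: real \<Rightarrow> 'd series. \<lambda>t\<in>{0..T}. cutoff (enat ?n) (X t))"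
    by (simp add: I1_def cutoff_enat fun_eq_iff)
  show "bij_betw (I1 \<gamma> T) (full_rough_paths \<gamma> T :: (real \<Rightarrow> 'd series) set) (rough_paths \<gamma> T)"
    unfolding I1 full_rough_paths_eq_path_space rough_paths_eq_path_space
    by (rule cutoff_path_bij[OF assms(1) n T])
  have I2: "I2 \<gamma> T = (functional_of_path (enat ?n) T :: (real \<Rightarrow> 'd series) \<Rightarrow> _)"
    by (intro ext) (simp only: I2_def functional_of_path_def degree_upto_enat GL_group_trunc_eq)
  show "bij_betw (I2 \<gamma> T) (rough_paths \<gamma> T :: (real \<Rightarrow> 'd series) set) (functional_rough_paths \<gamma> T)"
    unfolding I2 rough_paths_eq_path_space functional_rough_paths_eq
    by (rule functional_of_path_bij[OF T])
  have I3: "I3 T = (functional_of_path \<infinity> T :: (real \<Rightarrow> 'd series) \<Rightarrow> _)"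
    by (intro ext) (simp only: I3_def functional_of_path_def degree_upto_infinity GL_group_eq)
  show "bij_betw (I3 T) (full_rough_paths \<gamma> T :: (real \<Rightarrow> 'd series) set) (full_functional_rough_paths \<gamma> T)"
    unfolding I3 full_rough_paths_eq_path_space full_functional_rough_paths_eq
    by (rule functional_of_path_bij[OF T])
qed

end
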